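(* Let $0<d^-\leqslant d^+$ be fixed, let $d$ be a nonnegative multiplicative function on $S_n$ with $0<d^-\leqslant d_j:=\hat d(j)\leqslant d^+$, and let $p$ be fixed with $\infty\geqslant p>\max\{2,1/d^-\}$. Let $h:S_n\to\mathbb R$ be an additive function taking the value $\tilde h_n(k)$ on cycles of length $k$, normalized so that $\sum_{k=1}^n d_k\tilde h_n(k)^2/k=1$. Put $F_n(x)=\nu_{n,d}(h(\sigma)-A(n)<x)$. Then $$\sup_{x\in\mathbb R}\left|F_n(x)-\Phi(x)+\frac{1}{\sqrt{2\pi}}e^{-x^2/2}C_n\right|\ll L_{n,3}+L_{n,p}^{2/p}+L'_{n,2},$$ where for $p=\infty$ one interprets $L_{n,\infty}^{1/\infty}=\max_{1\leqslant j\leqslant n}|\tilde h_n(j)|$.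
   Context: A function $h:S_n\to\mathbb R$ is additive if $h(\sigma)=h(\kappa_1)+\dots+h(\kappa_{\omega})$ for the disjoint cycle decomposition $\sigma=\kappa_1\cdots\kappa_\omega$, with $h(\kappa)$ depending only on the cycle length. A function is multiplicative if it is the product over cycles of values depending only on cycle lengths; $\hat d(j)$ is the value of $d$ on cycles of length $j$. $\nu_{n,d}(\{\sigma\})=d(\sigma)/\sum_{w\in S_n}d(w)$. $p_m=\frac1{m!}\sum_{\sigma\in S_m}d(\sigma)$, $p_0=1$. $\Phi$ is the standard normal distribution function. $A(n)=\sum_{k=1}^n d_k\tilde h_n(k)/k$, $C_n=\sum_{j=1}^n d_j\frac{\tilde h_n(j)}{j}\big(\frac{p_{n-j}}{p_n}-1\big)$, $L_{n,q}=\sum_{k=1}^n|\tilde h_n(k)|^q/k$, $L'_{n,2}=\sum_{j=1}^n\frac{\tilde h_n(j)^2}{j}\big|\frac{p_{n-j}}{p_n}-1\big|$. The implied constant depends only on $d^-,d^+,p$. *)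

theory Defs
  imports "HOL-Probability.Probability" "HOL-Combinatorics.Orbits"
begin

text \<open>
  \<open>S\<^sub>n\<close> is realised as the set of all \<open>\<sigma>\<close> with \<open>\<sigma> permutes {1..n}\<close>; such a \<open>\<sigma>\<close> is a total
  function that is the identity outside \<open>{1..n}\<close>.  The disjoint cycles of \<open>\<sigma>\<close> are represented by
  their underlying sets, i.e. by the orbits of \<open>\<sigma>\<close> on \<open>{1..n}\<close>.  Fixed points count as cycles of
  length 1, so \<open>n\<close> cannot be recovered from \<open>\<sigma>\<close> and has to be given explicitly.
\<close>

definition cycles :: "nat \<Rightarrow> (nat \<Rightarrow> nat) \<Rightarrow> nat set set" where
  "cycles n \<sigma> = orbit \<sigma> ` {1..n}"

text \<open>In the next two predicates the last argument gives the value on cycles of each length.\<close>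

definition additive_with :: "nat \<Rightarrow> ((nat \<Rightarrow> nat) \<Rightarrow> real) \<Rightarrow> (nat \<Rightarrow> real) \<Rightarrow> bool" where
  "additive_with n h ht \<longleftrightarrow>
     (\<forall>\<sigma>. \<sigma> permutes {1..n} \<longrightarrow> h \<sigma> = (\<Sum>c\<in>cycles n \<sigma>. ht (card c)))"

definition multiplicative_with :: "nat \<Rightarrow> ((nat \<Rightarrow> nat) \<Rightarrow> real) \<Rightarrow> (nat \<Rightarrow> real) \<Rightarrow> bool" where
  "multiplicative_with n d dh \<longleftrightarrow>
     (\<forall>\<sigma>. \<sigma> permutes {1..n} \<longrightarrow> d \<sigma> = (\<Prod>c\<in>cycles n \<sigma>. dh (card c)))"

definition nu :: "nat \<Rightarrow> ((nat \<Rightarrow> nat) \<Rightarrow> real) \<Rightarrow> (nat \<Rightarrow> nat) measure" where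
  "nu n d = point_measure {\<sigma>. \<sigma> permutes {1..n}}
              (\<lambda>\<sigma>. ennreal (d \<sigma> / (\<Sum>w | w permutes {1..n}. d w)))"

text \<open>
  For \<open>m < n\<close> the value \<open>d(\<sigma>)\<close>, \<open>\<sigma> \<in> S\<^sub>m\<close>, is the product over the cycles of \<open>\<sigma>\<close> as an
  element of \<open>S\<^sub>m\<close>; it only involves the values \<open>dh j\<close> with \<open>1 \<le> j \<le> m\<close>.  For \<open>m = 0\<close> the
  formula gives 1.
\<close>

definition p_avg :: "(nat \<Rightarrow> real) \<Rightarrow> nat \<Rightarrow> real" where
  "p_avg dh m = (\<Sum>\<sigma> | \<sigma> permutes {1..m}. \<Prod>c\<in>cycles m \<sigma>. dh (card c)) / fact m"

definition A_center :: "nat \<Rightarrow> (nat \<Rightarrow> real) \<Rightarrow> (nat \<Rightarrow> real) \<Rightarrow> real" where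
  "A_center n dh ht = (\<Sum>k=1..n. dh k * ht k / real k)"

definition C_corr :: "nat \<Rightarrow> (nat \<Rightarrow> real) \<Rightarrow> (nat \<Rightarrow> real) \<Rightarrow> real" where
  "C_corr n dh ht =
     (\<Sum>j=1..n. dh j * (ht j / real j) * (p_avg dh (n - j) / p_avg dh n - 1))"

definition L_sum :: "nat \<Rightarrow> (nat \<Rightarrow> real) \<Rightarrow> real \<Rightarrow> real" where
  "L_sum n ht q = (\<Sum>k=1..n. \<bar>ht k\<bar> powr q / real k)"

text \<open>\<open>L_two_root n ht p\<close> is \<open>L\<^sub>n\<^sub>,\<^sub>p\<close> to the power \<open>2/p\<close>, i.e. the square of its \<open>p\<close>-th root,
  where for \<open>p = \<infinity>\<close> that root is read as the maximum of the absolute values.\<close>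

definition L_two_root :: "nat \<Rightarrow> (nat \<Rightarrow> real) \<Rightarrow> ereal \<Rightarrow> real" where
  "L_two_root n ht p =
     (if p = \<infinity> then (Max ((\<lambda>j. \<bar>ht j\<bar>) ` {1..n}))\<^sup>2
      else L_sum n ht (real_of_ereal p) powr (2 / real_of_ereal p))"

definition L'_two :: "nat \<Rightarrow> (nat \<Rightarrow> real) \<Rightarrow> (nat \<Rightarrow> real) \<Rightarrow> real" where
  "L'_two n dh ht =
     (\<Sum>j=1..n. (ht j)\<^sup>2 / real j * \<bar>p_avg dh (n - j) / p_avg dh n - 1\<bar>)"

definition F_dist ::
    "nat \<Rightarrow> ((nat \<Rightarrow> nat) \<Rightarrow> real) \<Rightarrow> ((nat \<Rightarrow> nat) \<Rightarrow> real) \<Rightarrow> real \<Rightarrow> real \<Rightarrow> real" where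
  "F_dist n d h a x = measure (nu n d) {\<sigma> \<in> space (nu n d). h \<sigma> - a < x}"

definition Phi :: "real \<Rightarrow> real" where
  "Phi x = cdf std_normal_distribution x"

end

theory Submission
  imports Defs "HOL-Complex_Analysis.Complex_Analysis"
begin

text \<open>
  The characteristic function of \<open>h\<close> is a ratio of coefficients of power series
  \<open>exp (\<Sum>j. d\<^sub>j f\<^sub>j z ^ j / j)\<close> with \<open>f\<^sub>j = exp (i t h\<^sub>j)\<close>.  Put \<open>U(z) = \<Sum>j. d\<^sub>j (f\<^sub>j - 1) z ^ j / j\<close>
  and \<open>P(z) = \<Sum>m. p\<^sub>m z ^ m\<close>.  Taylor expansion in \<open>s\<close> of the \<open>n\<close>-th coefficient of
  \<open>P(z) exp (s U(z) + (1 - s) U(1))\<close> between \<open>s = 0\<close> and \<open>s = 1\<close> gives the main term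
  \<open>exp (U(1))\<close> times \<open>p\<^sub>n\<close>, then the correction \<open>C\<^sub>n\<close> from the first derivative; the second derivative
  involves mixed second differences of the coefficients of \<open>P exp (s U)\<close>.

  These are controlled as in the Halasz-Montgomery method: if \<open>F = exp A\<close> with \<open>A\<close> a polynomial, then
  \<open>z F' = F \<cdot> z A'\<close>, so Parseval bounds the mean square of \<open>m F\<^sub>m\<close> by the maximum of \<open>F\<close> on the unit
  circle times the bounded coefficients of \<open>z A'\<close>.  The same applied to \<open>(1 - z ^ k) F\<close> gives a
  Hoelder-type regularity of \<open>m \<mapsto> F\<^sub>m\<close>.  The maximum is small away from \<open>z = 1\<close> because the powers of
  \<open>z\<close> equidistribute, while \<open>f\<^sub>j\<close> can imitate \<open>z ^ (-j)\<close> only if many \<open>t h\<^sub>j\<close> are bounded below, which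
  \<open>|t| \<le> c / L\<^sub>n\<^sub>,\<^sub>3\<close> excludes.  The estimate is then valid with a factor \<open>exp (- c t ^ 2)\<close> on the whole
  range \<open>|t| \<le> c / L\<^sub>n\<^sub>,\<^sub>3\<close>, and Esseen's smoothing inequality concludes.
\<close>

section \<open>Weighted sums over permutations\<close>

text \<open>The weights d_j are only confined to an interval, so p_m has no asymptotic formula; what
  survives is its order of magnitude. Every bound is therefore taken relative to exp (Lam n) / n,
  where Lam n is the sum of the d_j / j, and a lower bound for p_n by the same quantity turns bounds
  for coefficients into bounds for the characteristic function. With a = min (d^-, 1), a coefficient
  of index m < n may exceed the n-th one by a factor (n/m)^(1-a+5\<kappa>). This blow-up occurs when
  j is close to n, and the p-norm of h has to absorb it: Hoelder's inequality works if 1 - a +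
  6\<kappa> < 1 - 1/p, which is possible because p > 1/a. Here \<kappa> is the Hoelder exponent of m
  \<mapsto> \<open>F\<^sub>m\<close>; it must also be small compared with a for the decay on the
  circle. The error is quadratic in the p-th root R of \<open>L\<^sub>n\<^sub>,\<^sub>p\<close>,
  because each of the two differencings in a mixed second difference pays for one weighted sum over
  j. If R > 1 the claim is trivial, since \<open>C\<^sub>n\<close> itself is O(R).\<close>

text \<open>The Taylor coefficients of \<open>exp (\<Sum>j. c j * z ^ j / j)\<close>, computed from its logarithmic derivative.\<close>

fun ecoef :: "(nat \<Rightarrow> complex) \<Rightarrow> nat \<Rightarrow> complex" where
  "ecoef c n = (if n = 0 then 1 else (\<Sum>j\<in>{1..n}. c j * ecoef c (n - j)) / of_nat n)"

declare ecoef.simps [simp del]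

lemma ecoef_0 [simp]: "ecoef c 0 = 1"
  by (simp add: ecoef.simps)

lemma ecoef_rec: "of_nat n * ecoef c n = (if n = 0 then 0 else (\<Sum>j=1..n. c j * ecoef c (n - j)))"
  by (subst ecoef.simps) simp

lemma ecoef_cong:
  assumes "\<And>j. 1 \<le> j \<Longrightarrow> j \<le> n \<Longrightarrow> c j = c' j"
  shows "ecoef c n = ecoef c' n"
  using assms
proof (induction n rule: less_induct)
  case (less n)
  have "(\<Sum>j=1..n. c j * ecoef c (n - j)) = (\<Sum>j=1..n. c' j * ecoef c' (n - j))"
    using less by (intro sum.cong refl arg_cong2[where f="(*)"]) auto
  then show ?case
    by (subst (1 2) ecoef.simps) simp
qed

lemma ecoef_unique:
  assumes "e 0 = 1"
    and "\<And>n. 1 \<le> n \<Longrightarrow> n \<le> m \<Longrightarrow> of_nat n * e n = (\<Sum>j=1..n. c j * e (n - j))"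
  shows "e m = ecoef c m"
  using assms(2)
proof (induction m rule: less_induct)
  case (less n)
  show ?case
  proof (cases "n = 0")
    case True
    then show ?thesis using assms(1) by simp
  next
    case False
    have "of_nat n * e n = (\<Sum>j=1..n. c j * e (n - j))"
      using False less.prems by simp
    also have "\<dots> = (\<Sum>j=1..n. c j * ecoef c (n - j))"
      using less by (intro sum.cong refl arg_cong2[where f="(*)"]) auto
    also have "\<dots> = of_nat n * ecoef c n"
      using False by (simp add: ecoef_rec)
    finally show ?thesis using False by simp
  qed
qed

text \<open>Since \<open>q\<close> fixes \<open>a\<close>, composing with the transposition inserts
  \<open>a\<close> into the cycle of \<open>b\<close>, immediately before \<open>b\<close>:
  \<open>p\<close> sends \<open>a\<close> to \<open>b\<close> and the old predecessor of
  \<open>b\<close> to \<open>a\<close>, and agrees with \<open>q\<close> elsewhere.\<close>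

lemma orbit_insert_point:
  fixes q :: "'a \<Rightarrow> 'a"
  assumes S: "finite S" "a \<notin> S" "b \<in> S" and q: "q permutes S"
  defines "p \<equiv> Transposition.transpose a b \<circ> q"
  shows "orbit p a = insert a (orbit q b)"
    and "x \<in> S \<Longrightarrow> orbit p x = (if orbit q x = orbit q b then insert a (orbit q b) else orbit q x)"
proof -
  have pq: "permutation q" using S q permutes_imp_permutation by blast
  have "p permutes insert a S"
    unfolding p_def using S q
    by (intro permutes_compose[OF permutes_subset[OF q]] permutes_swap_id) auto
  then have pp: "permutation p" using S permutes_imp_permutation by blast
  have qa: "q a = a" using q S by (simp add: permutes_not_in)
  have pa: "p a = b" by (simp add: p_def qa)
  have pv: "p y = q y" if "q y \<noteq> b" "y \<noteq> a" for y
  proof -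
    have "q y \<noteq> a" using that qa q by (metis permutes_inj injD)
    then show ?thesis using that by (simp add: p_def Transposition.transpose_def)
  qed
  have pv2: "p y = a" if "q y = b" for y using that by (simp add: p_def)
  have osub: "orbit q y \<subseteq> S" if "y \<in> S" for y using q that by (rule permutes_orbit_subset)
  have ab: "b \<noteq> a" using S by auto
  have bin: "b \<in> orbit p a" using pa by (metis orbit.base)
  have ain: "a \<in> orbit p a" using pp by (rule permutation_self_in_orbit)
  have sub1: "y \<in> orbit p a" if "y \<in> orbit q b" for y
    using that
  proof induction
    case base
    show ?case
      using bin pv[of b] orbit.step[OF bin] ab by (cases "q b = b") auto
  next
    case (step y)
    have "y \<noteq> a" using step(1) osub[OF S(3)] S(2) by auto
    then show ?case
      using bin pv[of y] orbit.step[OF step(2)] by (cases "q y = b") auto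
  qed
  have sub2: "y \<in> insert a (orbit q b)" if "y \<in> orbit p a" for y
    using that
  proof induction
    case base
    show ?case using pa permutation_self_in_orbit[OF pq] by simp
  next
    case (step y)
    show ?case
    proof (cases "y = a")
      case True
      then show ?thesis using pa permutation_self_in_orbit[OF pq] by simp
    next
      case False
      with step have "q y \<in> orbit q b" by (auto intro: orbit.step)
      then show ?thesis using False pv[of y] pv2[of y] by (cases "q y = b") auto
    qed
  qed
  show A: "orbit p a = insert a (orbit q b)"
    using sub1 sub2 ain by blast
  show "orbit p x = (if orbit q x = orbit q b then insert a (orbit q b) else orbit q x)" if x: "x \<in> S"
  proof (cases "orbit q x = orbit q b")
    case True
    then have "x \<in> orbit p a"
      using sub1 permutation_self_in_orbit[OF pq, of x] by auto
    then have "orbit p x = orbit p a"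
      using cyclic_on_orbit'[OF pp] orbit_cyclic_eq3 by metis
    then show ?thesis using True A by simp
  next
    case False
    have nb: "b \<notin> orbit q x"
      using False cyclic_on_orbit'[OF pq] orbit_cyclic_eq3 by metis
    have "orbit p x = orbit q x"
    proof (rule orbit_cong[OF permutation_self_in_orbit[OF pq]])
      fix s assume s: "s \<in> orbit q x"
      have "q s \<noteq> b" using nb orbit.step[OF s] by auto
      moreover have "s \<noteq> a" using s osub[OF x] S(2) by auto
      ultimately show "p s = q s" by (rule pv)
    qed
    then show ?thesis using False by simp
  qed
qed

text \<open>\<open>k\<close> counts the points already removed from the cycle of \<open>x\<close>; removing one point at a time
  yields the recursion for the sum over all permutations.\<close>

definition marked_weight :: "(nat \<Rightarrow> complex) \<Rightarrow> 'a set \<Rightarrow> ('a \<Rightarrow> 'a) \<Rightarrow> 'a \<Rightarrow> nat \<Rightarrow> complex" where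
  "marked_weight g S p x k =
     g (k + card (orbit p x)) * (\<Prod>c\<in>orbit p ` S - {orbit p x}. g (card c))"

text \<open>Deleting the marked point \<open>a\<close> passes the mark to its successor
  \<open>b\<close>. The marked cycle loses one point and \<open>k\<close> gains one, so the argument
  of \<open>g\<close> is unchanged, and so are all other cycles.\<close>

lemma marked_weight_insert:
  assumes S: "finite S" "a \<notin> S" "b \<in> S" and q: "q permutes S"
  shows "marked_weight g (insert a S) (Transposition.transpose a b \<circ> q) a k = marked_weight g S q b (Suc k)"
proof -
  define p where "p = Transposition.transpose a b \<circ> q"
  note o = orbit_insert_point[OF S q, folded p_def]
  have pq: "permutation q" using S q permutes_imp_permutation by blast
  have sub: "orbit q b \<subseteq> S" using q S(3) by (rule permutes_orbit_subset)
  have card: "card (orbit p a) = Suc (card (orbit q b))"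
    using o(1) sub S by (metis card_insert_disjoint finite_subset subsetD)
  have "orbit p ` insert a S - {orbit p a} = orbit q ` S - {orbit q b}"
  proof (intro set_eqI iffI)
    fix c assume c: "c \<in> orbit p ` insert a S - {orbit p a}"
    then obtain x where x: "x \<in> S" "c = orbit p x" by auto
    with c show "c \<in> orbit q ` S - {orbit q b}"
      using o(1) o(2)[OF x(1)] by (auto split: if_splits)
  next
    fix c assume c: "c \<in> orbit q ` S - {orbit q b}"
    then obtain x where x: "x \<in> S" "c = orbit q x" by auto
    have "orbit p x = c" using o(2)[OF x(1)] x c by auto
    moreover have "a \<notin> c" using permutes_orbit_subset[OF q x(1)] x S by auto
    ultimately show "c \<in> orbit p ` insert a S - {orbit p a}" using x o(1) by auto
  qed
  then show ?thesis
    unfolding marked_weight_def p_def[symmetric] card by simp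
qed

lemma marked_weight_fixed:
  assumes S: "finite S" "a \<notin> S" and q: "q permutes S"
  shows "marked_weight g (insert a S) q a k = g (Suc k) * (\<Prod>c\<in>orbit q ` S. g (card c))"
proof -
  have qa: "q a = a" using q S by (simp add: permutes_not_in)
  then have oa: "orbit q a = {a}" by (simp add: orbit_eq_singleton_iff)
  have "orbit q ` insert a S - {orbit q a} = orbit q ` S"
    using permutes_orbit_subset[OF q] S(2) oa by fastforce
  then show ?thesis by (simp add: marked_weight_def oa)
qed

lemma marked_weight_0:
  assumes "finite S" "x \<in> S"
  shows "marked_weight g S p x 0 = (\<Prod>c\<in>orbit p ` S. g (card c))"
  unfolding marked_weight_def using assms by (simp add: prod.remove[where x="orbit p x"])

text \<open>Both sums are treated in one induction on the size of \<open>S\<close>. In a marked sum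
  the marked point is either alone in its cycle, which leaves an unmarked sum on one point fewer, or
  its removal leaves a marked sum with \<open>Suc k\<close>; hence \<open>k\<close> must be
  arbitrary. The value does not depend on the marked point, so the m choices of \<open>b\<close>
  turn (m - 1)! into m!. The unmarked sum is the marked one at \<open>k = 0\<close>.\<close>

lemma sum_marked_weight:
  assumes "finite S"
  shows "(\<Sum>p | p permutes S. \<Prod>c\<in>orbit p ` S. g (card c)) = fact (card S) * ecoef g (card S)"
    and "x \<in> S \<Longrightarrow> (\<Sum>p | p permutes S. marked_weight g S p x k)
           = fact (card S - 1) * (\<Sum>j=1..card S. g (k + j) * ecoef g (card S - j))"
  using assms
proof (induction "card S" arbitrary: S x k)
  case 0
  {
    case 1
    with 0 show ?case by simp
  next
    case 2
    with 0 show ?case by auto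
  }
next
  case (Suc m)
  have Y: "(\<Sum>p | p permutes S. marked_weight g S p x k)
           = fact (card S - 1) * (\<Sum>j=1..card S. g (k + j) * ecoef g (card S - j))"
    if x: "x \<in> S" and fS: "finite S" for x k
  proof -
    define R where "R = S - {x}"
    have R: "finite R" "x \<notin> R" "S = insert x R" "card R = m"
      using x Suc(3) fS by (auto simp: R_def)
    have "(\<Sum>p | p permutes S. marked_weight g S p x k) =
      (\<Sum>b\<in>insert x R. \<Sum>q | q permutes R. marked_weight g S (Transposition.transpose x b \<circ> q) x k)"
      unfolding R(3) by (rule sum_over_permutations_insert[OF R(1,2)])
    also have "\<dots> = (\<Sum>q | q permutes R. marked_weight g S q x k) +
        (\<Sum>b\<in>R. \<Sum>q | q permutes R. marked_weight g S (Transposition.transpose x b \<circ> q) x k)"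
      using R by simp
    also have "(\<Sum>q | q permutes R. marked_weight g S q x k) =
       g (Suc k) * (\<Sum>q | q permutes R. \<Prod>c\<in>orbit q ` R. g (card c))"
      unfolding sum_distrib_left R(3) using R by (intro sum.cong marked_weight_fixed) auto
    also have "\<dots> = g (Suc k) * (fact m * ecoef g m)"
      using Suc(1)[of R] R by simp
    also have "(\<Sum>b\<in>R. \<Sum>q | q permutes R. marked_weight g S (Transposition.transpose x b \<circ> q) x k)
       = (\<Sum>b\<in>R. \<Sum>q | q permutes R. marked_weight g R q b (Suc k))"
      unfolding R(3) using R by (intro sum.cong marked_weight_insert) auto
    also have "\<dots> = (\<Sum>b\<in>R. fact (m - 1) * (\<Sum>j=1..m. g (Suc k + j) * ecoef g (m - j)))"
      using Suc(2)[of R] R by (intro sum.cong) auto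
    also have "\<dots> = fact m * (\<Sum>j=1..m. g (Suc k + j) * ecoef g (m - j))"
      using R by (cases m) (simp_all add: fact_reduce algebra_simps)
    also have "(\<Sum>j=1..m. g (Suc k + j) * ecoef g (m - j)) = (\<Sum>j=2..Suc m. g (k + j) * ecoef g (Suc m - j))"
      by (rule sum.reindex_bij_witness[where i="\<lambda>j. j - 1" and j=Suc]) auto
    also have "g (Suc k) * (fact m * ecoef g m) + fact m * (\<Sum>j=2..Suc m. g (k + j) * ecoef g (Suc m - j))
      = fact m * (\<Sum>j=1..Suc m. g (k + j) * ecoef g (Suc m - j))"
      by (subst sum.atLeast_Suc_atMost[of 1 "Suc m"]) (simp_all add: numeral_2_eq_2 algebra_simps)
    finally show ?thesis using Suc(3) by (metis diff_Suc_1)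
  qed
  {
    case 1
    then obtain x where x: "x \<in> S" using Suc(3) by (metis card.empty ex_in_conv nat.distinct(1))
    have "(\<Sum>p | p permutes S. \<Prod>c\<in>orbit p ` S. g (card c)) = (\<Sum>p | p permutes S. marked_weight g S p x 0)"
      using 1 x by (simp add: marked_weight_0)
    also have "\<dots> = fact (card S - 1) * (of_nat (card S) * ecoef g (card S))"
      unfolding ecoef_rec using Y[OF x 1, of 0] Suc(3)[symmetric] by simp
    also have "\<dots> = fact (card S) * ecoef g (card S)"
      using Suc(3)[symmetric] by (simp add: mult.assoc mult.left_commute)
    finally show ?case .
  next
    case 2
    then show ?case by (rule Y)
  }
qed

lemma sum_permutations_cycles:
  "(\<Sum>p | p permutes {1..n}. \<Prod>c\<in>cycles n p. g (card c)) = fact n * ecoef g n"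
  using sum_marked_weight(1)[of "{1..n}" g] by (simp add: cycles_def)

lemma p_avg_eq_ecoef: "complex_of_real (p_avg dh m) = ecoef (\<lambda>j. complex_of_real (dh j)) m"
proof -
  have "complex_of_real (\<Sum>\<sigma> | \<sigma> permutes {1..m}. \<Prod>c\<in>cycles m \<sigma>. dh (card c)) =
    fact m * ecoef (\<lambda>j. complex_of_real (dh j)) m"
    by (simp flip: sum_permutations_cycles)
  then show ?thesis by (simp add: p_avg_def)
qed

section \<open>A Parseval inequality for coefficients\<close>

text \<open>With D(z) the sum of the c_j z^j, the function F satisfies z F' = D F, and comparing
  Taylor coefficients yields the recursion of \<open>ecoef\<close>. Truncation at \<open>x\<close>
  makes the exponent a polynomial, so F is entire and the series converges for every
  \<open>z\<close>.\<close>

lemma exp_sum_sums_ecoef: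
  fixes c :: "nat \<Rightarrow> complex"
  shows "(\<lambda>l. ecoef (\<lambda>j. if j \<le> x then c j else 0) l * z ^ l) sums exp (\<Sum>j=1..x. c j * z ^ j / of_nat j)"
proof -
  define F where "F = (\<lambda>z. exp (\<Sum>j=1..x. c j * z ^ j / of_nat j))"
  define D where "D = (\<lambda>z. \<Sum>j=1..x. c j * z ^ j)"
  define P where "P = fps_expansion F 0"
  define Dp where "Dp = (\<Sum>j=1..x. fps_const (c j) * fps_X ^ j)"
  have hol: "F holomorphic_on A" for A
    unfolding F_def by (intro holomorphic_intros) auto
  have expF: "F has_fps_expansion P"
    unfolding P_def by (rule has_fps_expansion_fps_expansion[of UNIV]) (auto intro: hol)
  have dF: "z * deriv F z = D z * F z" for z
  proof -
    have "(F has_field_derivative (\<Sum>j=1..x. c j * (of_nat j * z ^ (j - 1)) / of_nat j) * F z) (at z)"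
      unfolding F_def by (auto intro!: derivative_eq_intros simp: mult.commute)
    then have "z * deriv F z = z * ((\<Sum>j=1..x. c j * (of_nat j * z ^ (j - 1)) / of_nat j) * F z)"
      by (simp add: DERIV_imp_deriv)
    moreover have "z * (\<Sum>j=1..x. c j * (of_nat j * z ^ (j - 1)) / of_nat j) = D z"
      unfolding D_def sum_distrib_left
      by (intro sum.cong refl) (auto simp: field_simps power_eq_if)
    ultimately show ?thesis by (simp only: mult.assoc[symmetric])
  qed
  have "D has_fps_expansion Dp"
    unfolding D_def Dp_def by (intro fps_expansion_intros)
  then have e1: "(\<lambda>z. D z * F z) has_fps_expansion Dp * P"
    using expF by (rule has_fps_expansion_mult)
  have e2: "(\<lambda>z. z * deriv F z) has_fps_expansion fps_X * fps_deriv P"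
    using expF by (intro fps_expansion_intros)
  have eq: "fps_X * fps_deriv P = Dp * P"
    using e1 e2 dF by (intro fps_expansion_unique_complex[of "\<lambda>z. D z * F z"]) simp_all
  have Dn: "Dp $ i = (if 1 \<le> i \<and> i \<le> x then c i else 0)" for i
  proof -
    have "Dp $ i = (\<Sum>j=1..x. if j = i then c j else 0)"
      unfolding Dp_def fps_sum_nth by (intro sum.cong) (auto simp: fps_X_power_nth)
    then show ?thesis by auto
  qed
  have "P $ l = ecoef (\<lambda>j. if j \<le> x then c j else 0) l" for l
  proof (rule ecoef_unique)
    show "P $ 0 = 1"
      using fps_nth_fps_expansion[OF expF, of 0] by (simp add: F_def sum.neutral power_0_left)
    show "of_nat n * P $ n = (\<Sum>j=1..n. (if j \<le> x then c j else 0) * P $ (n - j))" if "1 \<le> n" for n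
    proof -
      have "of_nat n * P $ n = (fps_X * fps_deriv P) $ n" using that by simp
      also have "\<dots> = (\<Sum>j=0..n. Dp $ j * P $ (n - j))" by (simp add: eq fps_mult_nth)
      also have "\<dots> = (\<Sum>j=1..n. (if j \<le> x then c j else 0) * P $ (n - j))"
        by (intro sum.mono_neutral_cong_right) (auto simp: Dn)
      finally show ?thesis .
    qed
  qed
  moreover have "(\<lambda>n. fps_nth P n * z ^ n) sums F z"
    by (rule has_fps_expansion_imp_sums_complex[OF expF, of \<infinity>]) (auto intro: hol)
  ultimately show ?thesis by (simp add: F_def)
qed

lemma sum_cis_roots_of_unity:
  fixes m :: int
  assumes "\<bar>m\<bar> < int N"
  shows "(\<Sum>k<N. cis (2 * pi * real_of_int m / real N) ^ k) = (if m = 0 then of_nat N else 0)"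
proof (cases "m = 0")
  case False
  define r where "r = cis (2 * pi * real_of_int m / real N)"
  have N: "N > 0" using assms by linarith
  have "r \<noteq> 1"
  proof
    assume "r = 1"
    then have "cos (2 * pi * real_of_int m / real N) = 1"
      unfolding r_def by (metis cis.sel(1) one_complex.sel(1))
    then obtain i :: int where "2 * pi * real_of_int m / real N = of_int i * 2 * pi"
      unfolding cos_one_2pi_int by blast
    then have "real_of_int m = real_of_int (i * int N)" using N by (simp add: field_simps)
    then have "int N dvd m" unfolding of_int_eq_iff by simp
    then have "\<bar>int N\<bar> \<le> \<bar>m\<bar>" using False by (rule dvd_imp_le_int[rotated])
    then show False using assms by linarith
  qed
  moreover have "r ^ N = 1"
  proof -
    have "real N * (2 * pi * real_of_int m / real N) = 2 * pi * real_of_int m" using N by simp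
    then show ?thesis by (simp add: r_def Complex.DeMoivre)
  qed
  ultimately have "(\<Sum>k<N. r ^ k) = 0"
    by (simp add: geometric_sum)
  then show ?thesis using False by (simp add: r_def)
qed simp

text \<open>Sampling at the N-th roots of unity takes the place of integration over the circle: for
  polynomials of degree below N it is exact, since index differences are below N in absolute value
  and only the difference 0 survives.\<close>

lemma discrete_parseval:
  fixes q :: "nat \<Rightarrow> complex"
  shows "(\<Sum>k<N. (cmod (\<Sum>l<N. q l * cis (2 * pi * real k / real N) ^ l))\<^sup>2) = real N * (\<Sum>l<N. (cmod (q l))\<^sup>2)"
proof -
  let ?w = "\<lambda>k. cis (2 * pi * real k / real N)"
  have w: "?w k ^ l * cnj (?w k ^ l') = cis (2 * pi * real_of_int (int l - int l') / real N) ^ k" for k l l'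
    unfolding Complex.DeMoivre cis_cnj cis_mult
    by (rule arg_cong[where f=cis]) (simp add: algebra_simps diff_divide_distrib)
  have "complex_of_real (\<Sum>k<N. (cmod (\<Sum>l<N. q l * ?w k ^ l))\<^sup>2)
     = (\<Sum>k<N. (\<Sum>l<N. q l * ?w k ^ l) * cnj (\<Sum>l<N. q l * ?w k ^ l))"
    by (simp only: of_real_sum complex_norm_square)
  also have "\<dots> = (\<Sum>k<N. \<Sum>l<N. \<Sum>l'<N. q l * cnj (q l') * (?w k ^ l * cnj (?w k ^ l')))"
    by (simp add: sum_product algebra_simps)
  also have "\<dots> = (\<Sum>l<N. \<Sum>l'<N. \<Sum>k<N. q l * cnj (q l') * (?w k ^ l * cnj (?w k ^ l')))"
    by (subst sum.swap) (intro sum.cong refl sum.swap)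
  also have "\<dots> = (\<Sum>l<N. \<Sum>l'<N. q l * cnj (q l') * (\<Sum>k<N. cis (2 * pi * real_of_int (int l - int l') / real N) ^ k))"
    unfolding w sum_distrib_left ..
  also have "\<dots> = (\<Sum>l<N. \<Sum>l'<N. if l' = l then q l * cnj (q l') * of_nat N else 0)"
    by (intro sum.cong refl, subst sum_cis_roots_of_unity) auto
  also have "\<dots> = (\<Sum>l<N. q l * cnj (q l) * of_nat N)"
    by simp
  also have "\<dots> = complex_of_real (real N * (\<Sum>l<N. (cmod (q l))\<^sup>2))"
    by (simp add: sum_distrib_left mult.commute flip: complex_norm_square)
  finally show ?thesis by (simp only: of_real_eq_iff)
qed

lemma poly_eq_sum_coeff:
  fixes Q :: "complex poly"
  assumes "degree Q < N"
  shows "poly Q z = (\<Sum>l<N. coeff Q l * z ^ l)"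
  unfolding poly_altdef
  by (rule sum.mono_neutral_left) (use assms in \<open>auto simp: coeff_eq_0\<close>)

lemma discrete_parseval_poly:
  fixes Q :: "complex poly"
  assumes "degree Q < N"
  shows "(\<Sum>k<N. (cmod (poly Q (cis (2 * pi * real k / real N))))\<^sup>2) = real N * (\<Sum>l<N. (cmod (coeff Q l))\<^sup>2)"
  unfolding poly_eq_sum_coeff[OF assms] by (rule discrete_parseval)

text \<open>Multiplication by a function bounded by \<open>S\<close> on the unit circle has norm at most \<open>S\<close> on the
  Hardy space.\<close>

lemma sum_convolution_le_sup:
  fixes c e :: "nat \<Rightarrow> complex" and E :: "complex \<Rightarrow> complex"
  assumes summ: "summable (\<lambda>l. cmod (e l))"
    and sums: "\<And>z. cmod z = 1 \<Longrightarrow> (\<lambda>l. e l * z ^ l) sums E z"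
    and bd: "\<And>z. cmod z = 1 \<Longrightarrow> cmod (E z) \<le> S"
  shows "(\<Sum>l\<le>x. (cmod (\<Sum>j=1..l. c j * e (l - j)))\<^sup>2) \<le> S\<^sup>2 * (\<Sum>j=1..x. (cmod (c j))\<^sup>2)"
proof -
  have S: "S \<ge> 0" using bd[of 1] by (smt (verit) norm_ge_zero norm_one)
  have *: "(\<Sum>l\<le>x. (cmod (\<Sum>j=1..l. c j * e (l - j)))\<^sup>2) \<le> (S + \<epsilon>)\<^sup>2 * (\<Sum>j=1..x. (cmod (c j))\<^sup>2)"
    if \<epsilon>: "\<epsilon> > 0" for \<epsilon>
  proof -
    from suminf_exist_split[OF \<epsilon> summ] obtain M0 where M0: "\<And>n. n \<ge> M0 \<Longrightarrow> norm (\<Sum>i. cmod (e (i + n))) < \<epsilon>"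
      by auto
    \<comment> \<open>The series of \<open>E\<close> is cut where its tail is below \<epsilon>, but
      not before \<open>x\<close>, so the coefficients up to \<open>x\<close> are unaffected. The
      product then has degree below \<open>N\<close> and the discrete Parseval identity applies to
      it.\<close>
    define M where "M = max M0 x"
    define tau where "tau = (\<Sum>l\<le>M. monom (e l) l)"
    define Dp where "Dp = (\<Sum>j=1..x. monom (c j) j)"
    define N where "N = Suc (M + x)"
    have ctau: "coeff tau l = (if l \<le> M then e l else 0)" for l
      by (simp add: tau_def coeff_sum)
    have cD: "coeff Dp j = (if 1 \<le> j \<and> j \<le> x then c j else 0)" for j
      by (simp add: Dp_def coeff_sum)
    have dtau: "degree tau \<le> M" by (rule degree_le) (simp add: ctau)
    have dD: "degree Dp \<le> x" by (rule degree_le) (simp add: cD)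
    have dQ: "degree (Dp * tau) < N"
      using degree_mult_le[of Dp tau] dtau dD by (simp add: N_def)
    have tb: "cmod (poly tau z) \<le> S + \<epsilon>" if z: "cmod z = 1" for z
    proof -
      have st: "summable (\<lambda>l. cmod (e (l + Suc M)))" using summ by (subst summable_iff_shift)
      have sz: "summable (\<lambda>l. cmod (e (l + Suc M) * z ^ (l + Suc M)))"
        using st z by (simp add: norm_mult norm_power)
      have "poly tau z = (\<Sum>l<Suc M. e l * z ^ l)"
        unfolding tau_def by (simp add: poly_sum poly_monom lessThan_Suc_atMost)
      also have "\<dots> = E z - (\<Sum>l. e (l + Suc M) * z ^ (l + Suc M))"
        using suminf_minus_initial_segment[OF sums_summable[OF sums[OF z]], of "Suc M"] sums_unique[OF sums[OF z]] by simp
      finally have "cmod (poly tau z) \<le> cmod (E z) + cmod (\<Sum>l. e (l + Suc M) * z ^ (l + Suc M))"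
        by (metis norm_triangle_ineq4)
      also have "cmod (\<Sum>l. e (l + Suc M) * z ^ (l + Suc M)) \<le> (\<Sum>l. cmod (e (l + Suc M) * z ^ (l + Suc M)))"
        by (rule summable_norm[OF sz])
      also have "\<dots> = (\<Sum>l. cmod (e (l + Suc M)))"
        using z by (simp add: norm_mult norm_power)
      also have "\<dots> \<le> \<epsilon>"
      proof -
        have "M0 \<le> Suc M" by (simp add: M_def)
        from M0[OF this] show ?thesis by (simp add: abs_less_iff)
      qed
      finally show ?thesis using bd[OF z] by simp
    qed
    have "real N * (\<Sum>l\<le>x. (cmod (\<Sum>j=1..l. c j * e (l - j)))\<^sup>2) = real N * (\<Sum>l\<le>x. (cmod (coeff (Dp * tau) l))\<^sup>2)"
    proof -
      have "(\<Sum>j=1..l. c j * e (l - j)) = coeff (Dp * tau) l" if "l \<le> x" for l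
        unfolding coeff_mult using that
        by (intro sum.mono_neutral_cong_left) (auto simp: cD ctau M_def)
      then show ?thesis by simp
    qed
    also have "\<dots> \<le> real N * (\<Sum>l<N. (cmod (coeff (Dp * tau) l))\<^sup>2)"
      by (intro mult_left_mono sum_mono2) (auto simp: N_def)
    also have "\<dots> = (\<Sum>k<N. (cmod (poly (Dp * tau) (cis (2 * pi * real k / real N))))\<^sup>2)"
      by (rule discrete_parseval_poly[OF dQ, symmetric])
    also have "\<dots> \<le> (\<Sum>k<N. (S + \<epsilon>)\<^sup>2 * (cmod (poly Dp (cis (2 * pi * real k / real N))))\<^sup>2)"
    proof (rule sum_mono)
      fix k
      let ?w = "cis (2 * pi * real k / real N)"
      have "(cmod (poly Dp ?w) * cmod (poly tau ?w))\<^sup>2 \<le> (cmod (poly Dp ?w) * (S + \<epsilon>))\<^sup>2"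
        using tb[of ?w] by (intro power_mono mult_left_mono) auto
      then show "(cmod (poly (Dp * tau) ?w))\<^sup>2 \<le> (S + \<epsilon>)\<^sup>2 * (cmod (poly Dp ?w))\<^sup>2"
        by (simp add: norm_mult power_mult_distrib mult.commute)
    qed
    also have "\<dots> = (S + \<epsilon>)\<^sup>2 * (real N * (\<Sum>l<N. (cmod (coeff Dp l))\<^sup>2))"
    proof -
      have "degree Dp < N" using dD by (simp add: N_def)
      from discrete_parseval_poly[OF this] show ?thesis by (simp add: sum_distrib_left[symmetric])
    qed
    also have "(\<Sum>l<N. (cmod (coeff Dp l))\<^sup>2) = (\<Sum>j=1..x. (cmod (c j))\<^sup>2)"
      by (rule sum.mono_neutral_cong_right) (auto simp: cD N_def)
    finally show ?thesis by (simp add: N_def mult.left_commute)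
  qed
  have "((\<lambda>\<epsilon>. (S + \<epsilon>)\<^sup>2 * (\<Sum>j=1..x. (cmod (c j))\<^sup>2)) \<longlongrightarrow> (S + 0)\<^sup>2 * (\<Sum>j=1..x. (cmod (c j))\<^sup>2)) (at_right 0)"
    by (intro tendsto_intros)
  then have "(\<Sum>l\<le>x. (cmod (\<Sum>j=1..l. c j * e (l - j)))\<^sup>2) \<le> (S + 0)\<^sup>2 * (\<Sum>j=1..x. (cmod (c j))\<^sup>2)"
  proof (rule tendsto_lowerbound)
    show "\<forall>\<^sub>F \<epsilon> in at_right 0. (\<Sum>l\<le>x. (cmod (\<Sum>j=1..l. c j * e (l - j)))\<^sup>2)
        \<le> (S + \<epsilon>)\<^sup>2 * (\<Sum>j=1..x. (cmod (c j))\<^sup>2)"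
      by (rule eventually_at_rightI[of 0 1]) (use * in auto)
  qed simp
  then show ?thesis by simp
qed

section \<open>Decay of the generating function on the unit circle\<close>

lemma norm_one_minus_cis_le: "cmod (1 - cis t) \<le> \<bar>t\<bar>"
  using iexp_approx1[of t 0] by (simp add: cis_conv_exp norm_minus_commute)

lemma norm_one_minus_cis_sq: "(cmod (1 - cis t))\<^sup>2 = 2 - 2 * cos t"
proof -
  have "(cmod (1 - cis t))\<^sup>2 = (1 - cos t)\<^sup>2 + (sin t)\<^sup>2"
    by (simp add: cmod_power2)
  also have "\<dots> = 1 - 2 * cos t + ((cos t)\<^sup>2 + (sin t)\<^sup>2)"
    by (simp add: power2_eq_square algebra_simps)
  also have "\<dots> = 2 - 2 * cos t"
    by (simp only: sin_cos_squared_add2)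
  finally show ?thesis .
qed

text \<open>\<open>K\<close> is the first scale at which \<open>z ^ K\<close> is far from \<open>1\<close>; beyond it, whenever \<open>z ^ j\<close> is close
  to \<open>1\<close>, the power \<open>z ^ (j + K)\<close> is far from \<open>1\<close>.\<close>

lemma unit_powers_scale:
  assumes z: "cmod z = 1"
  obtains K :: nat where "K \<ge> 1"
    and "\<And>k. cmod (1 - z ^ k) \<le> 6 * real k / real K"
    and "(\<Sum>j\<in>{K<..x}. 1 / real j) \<le> 3 * (\<Sum>j | j \<in> {1..x} \<and> 1/2 \<le> cmod (1 - z ^ j). 1 / real j) + 1"
proof (cases "z = 1")
  case True
  show ?thesis
    \<comment> \<open>No power of 1 is ever far from 1; a scale beyond \<open>x\<close> makes the
      left-hand sum empty.\<close>
    by (rule that[of "Suc x"]) (use True in \<open>simp_all add: sum_nonneg\<close>)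
next
  case False
  define \<phi> where "\<phi> = Arg z"
  have zc: "z = cis \<phi>" using z by (metis \<phi>_def cis_Arg div_by_1 norm_eq_zero of_real_1 sgn_eq zero_neq_one)
  have \<phi>: "\<bar>\<phi>\<bar> \<le> pi" using Arg_bounded[of z] by (auto simp: \<phi>_def)
  have \<phi>0: "\<bar>\<phi>\<bar> > 0" using False zc by auto
  \<comment> \<open>The least integer with K |\<phi>| at least pi/2. As |\<phi>| is at most pi, the
    product lies between pi/2 and 3 pi/2, where the cosine is not positive; and 3 pi/2 < 6 is the
    origin of the constant 6.\<close>
  define K where "K = nat \<lceil>(pi/2) / \<bar>\<phi>\<bar>\<rceil>"
  define y where "y = real K * \<bar>\<phi>\<bar>"
  have pos: "(pi/2) / \<bar>\<phi>\<bar> > 0" using \<phi>0 by simp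
  have K1: "K \<ge> 1" using pos unfolding K_def by linarith
  have Klo: "(pi/2) / \<bar>\<phi>\<bar> \<le> real K" unfolding K_def by linarith
  have Kup: "real K < (pi/2) / \<bar>\<phi>\<bar> + 1" using pos unfolding K_def by linarith
  have ylo: "pi/2 \<le> y" using Klo \<phi>0 by (simp add: y_def field_simps)
  have "y \<le> pi/2 + \<bar>\<phi>\<bar>" using Kup \<phi>0 by (simp add: y_def field_simps)
  then have yup: "y \<le> 3 * pi / 2" using \<phi> by simp
  have pw: "z ^ k = cis (real k * \<phi>)" for k by (simp add: zc Complex.DeMoivre)
  have small: "cmod (1 - z ^ k) \<le> 6 * real k / real K" for k
  proof -
    have "cmod (1 - z ^ k) \<le> real k * \<bar>\<phi>\<bar>"
      using norm_one_minus_cis_le[of "real k * \<phi>"] by (simp add: pw abs_mult)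
    also have "\<dots> = real k * y / real K" using K1 by (simp add: y_def)
    also have "\<dots> \<le> real k * 6 / real K"
      using yup pi_less_4 by (intro divide_right_mono mult_left_mono) auto
    finally show ?thesis by (simp add: mult.commute)
  qed
  have big: "1 \<le> cmod (1 - z ^ K)"
  proof -
    have "0 \<le> cos (y - pi)" by (rule cos_ge_zero) (use ylo yup in auto)
    then have "cos y \<le> 0" by simp
    moreover have "cos (real K * \<phi>) = cos y" by (simp add: y_def abs_if)
    ultimately have "1\<^sup>2 \<le> (cmod (1 - z ^ K))\<^sup>2"
      by (simp add: pw norm_one_minus_cis_sq)
    then show ?thesis by (rule power2_le_imp_le) simp
  qed
  \<comment> \<open>Three classes cover the indices beyond \<open>K\<close>. Those in
    \<open>N1\<close> are shifted by \<open>K\<close> injectively into \<open>Far\<close>, with 1/j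
    at most 2/(j + K) because j > K. \<open>N2\<close> has at most \<open>K\<close> members, each
    contributing at most 1/K. This gives 3 times the sum over \<open>Far\<close>, plus 1.\<close>
  define Far where "Far = {j. j \<in> {1..x} \<and> 1/2 \<le> cmod (1 - z ^ j)}"
  define N1 where "N1 = {j\<in>{K<..x}. cmod (1 - z ^ j) < 1/2 \<and> j + K \<le> x}"
  define N2 where "N2 = {j\<in>{K<..x}. x < j + K}"
  have fin: "finite Far" "finite N1" "finite N2" by (auto simp: Far_def N1_def N2_def)
  have shift: "j + K \<in> Far" if "j \<in> N1" for j
  proof -
    have "1 - z ^ K = (1 - z ^ (j + K)) - z ^ K * (1 - z ^ j)"
      by (simp add: algebra_simps power_add)
    then have "cmod (1 - z ^ K) \<le> cmod (1 - z ^ (j + K)) + cmod (z ^ K * (1 - z ^ j))"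
      by (metis norm_triangle_ineq4)
    also have "cmod (z ^ K * (1 - z ^ j)) = cmod (1 - z ^ j)"
      using z by (simp add: norm_mult norm_power)
    finally show ?thesis using that big by (auto simp: N1_def Far_def)
  qed
  have n1: "(\<Sum>j\<in>N1. 1 / real j) \<le> 2 * (\<Sum>j\<in>Far. 1 / real j)"
  proof -
    have "(\<Sum>j\<in>N1. 1 / real j) \<le> (\<Sum>j\<in>N1. 2 * (1 / real (j + K)))"
    proof (rule sum_mono)
      fix j assume "j \<in> N1"
      then have "K < j" by (auto simp: N1_def)
      then have "1 / real j \<le> 1 / (real (j + K) / 2)"
        by (intro divide_left_mono) auto
      then show "1 / real j \<le> 2 * (1 / real (j + K))" by simp
    qed
    also have "\<dots> = 2 * (\<Sum>i\<in>(\<lambda>j. j + K) ` N1. 1 / real i)"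
      by (subst sum.reindex) (auto simp: sum_distrib_left)
    also have "\<dots> \<le> 2 * (\<Sum>i\<in>Far. 1 / real i)"
      using shift fin by (intro mult_left_mono sum_mono2) auto
    finally show ?thesis .
  qed
  have n2: "(\<Sum>j\<in>N2. 1 / real j) \<le> 1"
  proof -
    have "(\<Sum>j\<in>N2. 1 / real j) \<le> (\<Sum>j\<in>N2. 1 / real K)"
      using K1 by (intro sum_mono divide_left_mono) (auto simp: N2_def)
    also have "\<dots> = real (card N2) / real K" by simp
    also have "card N2 \<le> card {x - K<..x}"
      by (rule card_mono) (auto simp: N2_def)
    then have "real (card N2) / real K \<le> 1" using K1 by (simp add: divide_le_eq)
    finally show ?thesis by simp
  qed
  have "(\<Sum>j\<in>{K<..x}. 1 / real j) \<le> (\<Sum>j\<in>Far \<union> N1 \<union> N2. 1 / real j)"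
    using fin K1 by (intro sum_mono2) (auto simp: Far_def N1_def N2_def)
  also have "\<dots> \<le> (\<Sum>j\<in>Far \<union> N1. 1 / real j) + (\<Sum>j\<in>N2. 1 / real j)"
    using fin by (subst sum_Un) (auto intro!: sum_nonneg)
  also have "(\<Sum>j\<in>Far \<union> N1. 1 / real j) \<le> (\<Sum>j\<in>Far. 1 / real j) + (\<Sum>j\<in>N1. 1 / real j)"
    using fin by (subst sum_Un) (auto intro!: sum_nonneg)
  finally have "(\<Sum>j\<in>{K<..x}. 1 / real j) \<le> 3 * (\<Sum>j\<in>Far. 1 / real j) + 1"
    using n1 n2 by simp
  then show ?thesis using that[OF K1 small] by (simp add: Far_def)
qed

text \<open>The factor 868 is twice 434, the constant that collects the losses in the comparison of
  the exponent deficit with its quadratic lower bound; the factor two is that in 1 - Re w = |1 -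
  w|^2 / 2 for unimodular w.\<close>

locale tilted =
  fixes n :: nat and d :: "nat \<Rightarrow> real" and f :: "nat \<Rightarrow> complex" and a D \<kappa> :: real
  assumes kap_pos: "0 < \<kappa>" and kap_le: "868 * \<kappa> \<le> a" and a_le: "a \<le> 1"
    and D_ge: "1 \<le> D"
    and d_bounds: "\<And>j. 1 \<le> j \<Longrightarrow> j \<le> n \<Longrightarrow> a \<le> d j \<and> d j \<le> D"
    and f_unit: "\<And>j. cmod (f j) = 1"
begin

definition Lam :: "nat \<Rightarrow> real" where "Lam x = (\<Sum>j=1..x. d j / real j)"
text \<open>For unimodular w one has |1 - w|^2 = 2 (1 - Re w), so this is twice the squared distance
  between f and 1 familiar from pretentious multiplicative functions.\<close>

definition Tf :: "nat \<Rightarrow> real" where "Tf x = (\<Sum>j=1..x. (cmod (1 - f j))\<^sup>2 / real j)"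
text \<open>The harmonic mass of the indices at which f_j is far enough from 1 to be able to undo
  the rotation by z^j.\<close>

definition Wf :: real where "Wf = (\<Sum>j | j \<in> {1..n} \<and> 1/4 \<le> cmod (1 - f j). 1 / real j)"

lemma Wf_nonneg: "Wf \<ge> 0" unfolding Wf_def by (rule sum_nonneg) auto

text \<open>The exponent by which \<open>\<bar>exp (\<Sum>j\<le>x. d j * (1 + s * (f j - 1)) * z ^ j / j)\<bar>\<close> falls short of
  its trivial bound \<open>exp (Lam x)\<close>.\<close>

lemma exponent_deficit:
  assumes z: "cmod z = 1" and x: "x \<le> n" and s: "0 \<le> s" "s \<le> 1" and K1: "K \<ge> 1"
    and small: "\<And>k. cmod (1 - z ^ k) \<le> 6 * real k / real K"
    and far: "(\<Sum>j\<in>{K<..x}. 1 / real j) \<le> 3 * (\<Sum>j | j \<in> {1..x} \<and> 1/2 \<le> cmod (1 - z ^ j). 1 / real j) + 1"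
  shows "\<kappa> * (s * Tf x + (\<Sum>j\<in>{K<..x}. 1 / real j) - 81 - 27 * Wf)
     \<le> (\<Sum>j=1..x. d j * (1 - Re ((1 + of_real s * (f j - 1)) * z ^ j)) / real j)"
proof -
  define L where "L = (\<Sum>j\<in>{K<..x}. 1 / real j)"
  define Far where "Far = (\<Sum>j | j \<in> {1..x} \<and> 1/2 \<le> cmod (1 - z ^ j). 1 / real j)"
  \<comment> \<open>\<open>Y\<close> and \<open>Z\<close> measure how far f_j z^j and z^j are from
    1. The deficit at parameter \<open>s\<close> is at least a/2 times the convex combination (1 -
    s) Z + s Y, so everything is to be bounded by \<open>Y\<close> and \<open>Z\<close>.\<close>
  define Y where "Y = (\<Sum>j=1..x. (cmod (1 - f j * z ^ j))\<^sup>2 / real j)"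
  define Z where "Z = (\<Sum>j=1..x. (cmod (1 - z ^ j))\<^sup>2 / real j)"
  have zj: "cmod (z ^ j) = 1" for j using z by (simp add: norm_power)
  have Y0: "Y \<ge> 0" and Z0: "Z \<ge> 0" unfolding Y_def Z_def by (auto intro!: sum_nonneg)
  have FarE: "Far = (\<Sum>j=1..x. if 1/2 \<le> cmod (1 - z ^ j) then 1 / real j else 0)"
    unfolding Far_def by (rule sum.mono_neutral_cong_left) auto
  have WfE: "(\<Sum>j=1..x. if 1/4 \<le> cmod (1 - f j) then 1 / real j else 0) \<le> Wf"
  proof -
    have "(\<Sum>j=1..x. if 1/4 \<le> cmod (1 - f j) then 1 / real j else 0) \<le> (\<Sum>j=1..n. if 1/4 \<le> cmod (1 - f j) then 1 / real j else 0)"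
      using x by (intro sum_mono2) auto
    also have "\<dots> = Wf" unfolding Wf_def by (rule sum.mono_neutral_cong_right) auto
    finally show ?thesis .
  qed
  \<comment> \<open>If z^j is at distance at least 1/2 from 1, then f_j z^j or f_j is at distance at
    least 1/4; the former is paid by \<open>Y\<close>, the latter by \<open>Wf\<close>.\<close>
  have S1: "Far \<le> 16 * Y + Wf"
  proof -
    have "Far \<le> (\<Sum>j=1..x. 16 * ((cmod (1 - f j * z ^ j))\<^sup>2 / real j) + (if 1/4 \<le> cmod (1 - f j) then 1 / real j else 0))"
      unfolding FarE
    proof (rule sum_mono)
      fix j assume j: "j \<in> {1..x}"
      show "(if 1/2 \<le> cmod (1 - z ^ j) then 1 / real j else 0)
        \<le> 16 * ((cmod (1 - f j * z ^ j))\<^sup>2 / real j) + (if 1/4 \<le> cmod (1 - f j) then 1 / real j else 0)"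
      proof (cases "1/2 \<le> cmod (1 - z ^ j) \<and> \<not> 1/4 \<le> cmod (1 - f j)")
        case True
        have "1 - z ^ j = (1 - f j * z ^ j) - z ^ j * (1 - f j)" by (simp add: algebra_simps)
        then have "cmod (1 - z ^ j) \<le> cmod (1 - f j * z ^ j) + cmod (z ^ j * (1 - f j))"
          by (metis norm_triangle_ineq4)
        then have "1/4 \<le> cmod (1 - f j * z ^ j)" using True by (simp add: norm_mult zj)
        then have "(1/4)\<^sup>2 \<le> (cmod (1 - f j * z ^ j))\<^sup>2" by (intro power_mono) auto
        then have "1 / real j \<le> 16 * (cmod (1 - f j * z ^ j))\<^sup>2 / real j"
          by (intro divide_right_mono) (auto simp: power2_eq_square)
        then show ?thesis using True by simp
      qed auto
    qed
    also have "\<dots> \<le> 16 * Y + Wf" using WfE by (simp add: sum.distrib Y_def sum_distrib_left)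
    finally show ?thesis .
  qed
  have S2: "Tf x \<le> 2 * Y + 2 * Z"
  proof -
    have "Tf x \<le> (\<Sum>j=1..x. 2 * ((cmod (1 - f j * z ^ j))\<^sup>2 / real j) + 2 * ((cmod (1 - z ^ j))\<^sup>2 / real j))"
      unfolding Tf_def
    proof (rule sum_mono)
      fix j
      have "1 - f j = (1 - f j * z ^ j) - f j * (1 - z ^ j)" by (simp add: algebra_simps)
      then have "cmod (1 - f j) \<le> cmod (1 - f j * z ^ j) + cmod (f j * (1 - z ^ j))"
        by (metis norm_triangle_ineq4)
      then have "(cmod (1 - f j))\<^sup>2 \<le> (cmod (1 - f j * z ^ j) + cmod (1 - z ^ j))\<^sup>2"
        by (intro power_mono) (auto simp: norm_mult f_unit)
      also have "\<dots> \<le> 2 * (cmod (1 - f j * z ^ j))\<^sup>2 + 2 * (cmod (1 - z ^ j))\<^sup>2"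
        using sum_squares_ge_zero[of "cmod (1 - f j * z ^ j) - cmod (1 - z ^ j)" 0]
        by (simp add: power2_eq_square algebra_simps)
      finally have "(cmod (1 - f j))\<^sup>2 / real j \<le> (2 * (cmod (1 - f j * z ^ j))\<^sup>2 + 2 * (cmod (1 - z ^ j))\<^sup>2) / real j"
        by (rule divide_right_mono) simp
      then show "(cmod (1 - f j))\<^sup>2 / real j \<le> 2 * ((cmod (1 - f j * z ^ j))\<^sup>2 / real j) + 2 * ((cmod (1 - z ^ j))\<^sup>2 / real j)"
        by (simp add: add_divide_distrib)
    qed
    then show ?thesis by (simp add: sum.distrib Y_def Z_def sum_distrib_left)
  qed
  \<comment> \<open>Up to the scale \<open>K\<close> the linear bound 6 j / K is used, beyond it the
    trivial bound 2.\<close>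
  have S3: "Z \<le> 36 + 4 * L"
  proof -
    have "Z \<le> (\<Sum>j=1..x. (if j \<le> K then 36 / real K else 0) + (if K < j then 4 * (1 / real j) else 0))"
      unfolding Z_def
    proof (rule sum_mono)
      fix j assume j: "j \<in> {1..x}"
      show "(cmod (1 - z ^ j))\<^sup>2 / real j \<le> (if j \<le> K then 36 / real K else 0) + (if K < j then 4 * (1 / real j) else 0)"
      proof (cases "j \<le> K")
        case True
        have "(cmod (1 - z ^ j))\<^sup>2 / real j \<le> (6 * real j / real K)\<^sup>2 / real j"
          using small[of j] by (intro divide_right_mono power_mono) auto
        also have "\<dots> = 36 / real K * (real j / real K)"
          using j by (simp add: power2_eq_square)
        also have "\<dots> \<le> 36 / real K * 1" using True K1 by (intro mult_left_mono) auto
        finally show ?thesis using True by simp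
      next
        case False
        have "cmod (1 - z ^ j) \<le> 2" using norm_triangle_ineq4[of 1 "z ^ j"] zj[of j] by simp
        then have "(cmod (1 - z ^ j))\<^sup>2 \<le> 2\<^sup>2" by (intro power_mono) auto
        then show ?thesis using False by (simp add: divide_right_mono)
      qed
    qed
    also have "\<dots> = (\<Sum>j=1..x. if j \<le> K then 36 / real K else 0) + (\<Sum>j=1..x. if K < j then 4 * (1 / real j) else 0)"
      by (rule sum.distrib)
    also have "(\<Sum>j=1..x. if K < j then 4 * (1 / real j) else 0) = 4 * L"
      unfolding L_def sum_distrib_left by (rule sum.mono_neutral_cong_right) auto
    also have "(\<Sum>j=1..x. if j \<le> K then 36 / real K else 0) \<le> (\<Sum>j=1..K. 36 / real K)"
    proof -
      have "(\<Sum>j=1..x. if j \<le> K then 36 / real K else 0) = (\<Sum>j\<in>{1..x} \<inter> {j. j \<le> K}. 36 / real K)"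
        by (simp only: sum.If_cases[OF finite_atLeastAtMost] sum.neutral_const add_0_right)
      also have "\<dots> \<le> (\<Sum>j=1..K. 36 / real K)" by (intro sum_mono2) auto
      finally show ?thesis .
    qed
    also have "\<dots> = 36" using K1 by simp
    finally show ?thesis by simp
  qed
  have S4: "L \<le> 3 * Far + 1" using far by (simp add: L_def Far_def)
  have S5: "Far \<le> 4 * Z"
  proof -
    have "Far \<le> (\<Sum>j=1..x. 4 * ((cmod (1 - z ^ j))\<^sup>2 / real j))"
      unfolding FarE
    proof (rule sum_mono)
      fix j
      show "(if 1/2 \<le> cmod (1 - z ^ j) then 1 / real j else 0) \<le> 4 * ((cmod (1 - z ^ j))\<^sup>2 / real j)"
      proof (cases "1/2 \<le> cmod (1 - z ^ j)")
        case True
        then have "(1/2)\<^sup>2 \<le> (cmod (1 - z ^ j))\<^sup>2" by (intro power_mono) auto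
        then have "1 / real j \<le> 4 * (cmod (1 - z ^ j))\<^sup>2 / real j"
          by (intro divide_right_mono) (auto simp: power2_eq_square)
        then show ?thesis using True by simp
      qed auto
    qed
    then show ?thesis by (simp add: Z_def sum_distrib_left)
  qed
  define Q where "Q = (1 - s) * Z + s * Y"
  have Q0: "Q \<ge> 0" using Y0 Z0 s by (simp add: Q_def)
  have S6: "a / 2 * Q \<le> (\<Sum>j=1..x. d j * (1 - Re ((1 + of_real s * (f j - 1)) * z ^ j)) / real j)"
  proof -
    have re: "1 - Re w = (cmod (1 - w))\<^sup>2 / 2" if "cmod w = 1" for w
    proof -
      have "(Re w)\<^sup>2 + (Im w)\<^sup>2 = 1" using that cmod_power2[of w] by simp
      moreover have "(cmod (1 - w))\<^sup>2 = (1 - Re w)\<^sup>2 + (Im w)\<^sup>2" by (simp add: cmod_power2)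
      ultimately show ?thesis by (simp add: power2_eq_square algebra_simps)
    qed
    have "a / 2 * Q = (\<Sum>j=1..x. a * ((1 - s) * ((cmod (1 - z ^ j))\<^sup>2 / 2) + s * ((cmod (1 - f j * z ^ j))\<^sup>2 / 2)) / real j)"
      unfolding Q_def Y_def Z_def sum_distrib_left sum.distrib[symmetric]
      by (intro sum.cong refl) (simp add: field_simps)
    also have "\<dots> \<le> (\<Sum>j=1..x. d j * ((1 - s) * ((cmod (1 - z ^ j))\<^sup>2 / 2) + s * ((cmod (1 - f j * z ^ j))\<^sup>2 / 2)) / real j)"
      using s x d_bounds by (intro sum_mono divide_right_mono mult_right_mono) auto
    also have "\<dots> = (\<Sum>j=1..x. d j * (1 - Re ((1 + of_real s * (f j - 1)) * z ^ j)) / real j)"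
    proof (rule sum.cong[OF refl])
      fix j
      have "(1 - s) * ((cmod (1 - z ^ j))\<^sup>2 / 2) + s * ((cmod (1 - f j * z ^ j))\<^sup>2 / 2)
         = (1 - s) * (1 - Re (z ^ j)) + s * (1 - Re (f j * z ^ j))"
        by (subst (1 2) re) (simp_all add: norm_mult zj f_unit)
      also have "\<dots> = 1 - Re ((1 + of_real s * (f j - 1)) * z ^ j)"
        by (simp add: algebra_simps)
      finally show "d j * ((1 - s) * ((cmod (1 - z ^ j))\<^sup>2 / 2) + s * ((cmod (1 - f j * z ^ j))\<^sup>2 / 2)) / real j
        = d j * (1 - Re ((1 + of_real s * (f j - 1)) * z ^ j)) / real j" by simp
    qed
    finally show ?thesis .
  qed
  \<comment> \<open>Chaining S2, S3, S4, S1 gives 2 Y + 72 + 8 L with L at most 48 Y + 3 Wf + 1,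
    that is 386 Y + 80 + 24 Wf. The remaining L is split in the ratio 1 - s to s, the first share
    being bounded by \<open>Z\<close> and the second by \<open>Y\<close>; hence 434 = 386 + 48, 81 =
    80 + 1 and 27 = 24 + 3.\<close>
  have "s * Tf x \<le> s * (386 * Y + 80 + 24 * Wf)"
    using S1 S2 S3 S4 s by (intro mult_left_mono) linarith+
  moreover have "s * (80 + 24 * Wf) \<le> 1 * (80 + 24 * Wf)"
    using s Wf_nonneg by (intro mult_right_mono) auto
  moreover have "(1 - s) * L \<le> (1 - s) * (12 * Z + 1)"
    using S4 S5 s by (intro mult_left_mono) linarith+
  moreover have "s * L \<le> s * (48 * Y + 3 * Wf + 1)"
    using S4 S1 s by (intro mult_left_mono) linarith+
  moreover have "s * (3 * Wf) \<le> 1 * (3 * Wf)"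
    using s Wf_nonneg by (intro mult_right_mono) auto
  moreover have "0 \<le> (1 - s) * Z" "0 \<le> s * Y" using s Y0 Z0 by auto
  ultimately have "s * Tf x + L - 81 - 27 * Wf \<le> 434 * Q"
    unfolding Q_def by (simp add: algebra_simps)
  then have "\<kappa> * (s * Tf x + L - 81 - 27 * Wf) \<le> \<kappa> * (434 * Q)"
    using kap_pos by (intro mult_left_mono) auto
  also have "\<dots> \<le> a / 2 * Q"
    using mult_right_mono[OF kap_le Q0] by simp
  finally show ?thesis using S6 unfolding L_def by linarith
qed

end

section \<open>Mean-square bounds for coefficients and for their shifted differences\<close>

definition ecoef_int :: "(nat \<Rightarrow> complex) \<Rightarrow> int \<Rightarrow> complex" where
  "ecoef_int c i = (if i < 0 then 0 else ecoef c (nat i))"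

lemma ecoef_int_neg [simp]: "i < 0 \<Longrightarrow> ecoef_int c i = 0"
  by (simp add: ecoef_int_def)

lemma ecoef_int_of_nat [simp]: "ecoef_int c (int m) = ecoef c m"
  by (simp add: ecoef_int_def)

text \<open>Surplus terms have negative index and vanish, so the sum may run up to any
  \<open>m\<close> beyond \<open>i\<close>. This allows the recursions at \<open>i\<close> and at
  \<open>i - k\<close> to be subtracted over a common range of \<open>j\<close>.\<close>

lemma ecoef_int_rec:
  assumes "i \<le> int m"
  shows "of_int i * ecoef_int c i = (\<Sum>j=1..m. c j * ecoef_int c (i - int j))"
proof (cases "i \<le> 0")
  case True
  then have "(\<Sum>j=1..m. c j * ecoef_int c (i - int j)) = 0"
    by (intro sum.neutral) simp
  moreover have "of_int i * ecoef_int c i = 0" using True by (cases "i = 0") auto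
  ultimately show ?thesis by simp
next
  case False
  define l where "l = nat i"
  have l: "i = int l" "l \<noteq> 0" "l \<le> m" using False assms by (auto simp: l_def)
  have "(\<Sum>j=1..m. c j * ecoef_int c (i - int j)) = (\<Sum>j=1..l. c j * ecoef c (l - j))"
    using l by (intro sum.mono_neutral_cong_right) (auto simp: ecoef_int_def nat_diff_distrib)
  then show ?thesis using l ecoef_rec[of l c] by simp
qed

lemma summable_norm_ecoef_trunc:
  "summable (\<lambda>l. cmod (ecoef (\<lambda>j. if j \<le> x then c j else 0) l))"
  using powser_insidea[OF sums_summable[OF exp_sum_sums_ecoef[of x c 2]], of 1] by simp

text \<open>The numbers l e_l are the coefficients of the product of the sum of the c_j z^j with F.
  Cutting \<open>c\<close> off at \<open>x\<close> changes no coefficient of index at most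
  \<open>x\<close>.\<close>

lemma sum_sq_ecoef_le:
  assumes bd: "\<And>z. cmod z = 1 \<Longrightarrow> cmod (exp (\<Sum>j=1..x. c j * z ^ j / of_nat j)) \<le> S"
  shows "(\<Sum>l\<le>x. (cmod (of_nat l * ecoef c l))\<^sup>2) \<le> S\<^sup>2 * (\<Sum>j=1..x. (cmod (c j))\<^sup>2)"
proof -
  define e where "e = ecoef (\<lambda>j. if j \<le> x then c j else 0)"
  have e: "e l = ecoef c l" if "l \<le> x" for l
    unfolding e_def using that by (intro ecoef_cong) auto
  have "(\<Sum>l\<le>x. (cmod (\<Sum>j=1..l. c j * e (l - j)))\<^sup>2) \<le> S\<^sup>2 * (\<Sum>j=1..x. (cmod (c j))\<^sup>2)"
    unfolding e_def by (rule sum_convolution_le_sup[OF summable_norm_ecoef_trunc exp_sum_sums_ecoef bd])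
  moreover have "(\<Sum>j=1..l. c j * e (l - j)) = of_nat l * ecoef c l" if "l \<le> x" for l
    using that e by (simp add: ecoef_rec)
  ultimately show ?thesis by simp
qed

text \<open>Here F is replaced by (1 - z^k) F, whose product with the sum of the c_j z^j has the
  coefficients l e_l - (l - k) e_{l-k}. They are written as l times a difference plus a correction,
  which is removed later by the bound for single coefficients.\<close>

lemma sum_sq_ecoef_diff_le:
  assumes bd: "\<And>z. cmod z = 1 \<Longrightarrow> cmod (1 - z ^ k) * cmod (exp (\<Sum>j=1..x. c j * z ^ j / of_nat j)) \<le> S"
  shows "(\<Sum>l\<le>x. (cmod (of_nat l * (ecoef c l - ecoef_int c (int l - int k))
            + of_nat k * ecoef_int c (int l - int k)))\<^sup>2) \<le> S\<^sup>2 * (\<Sum>j=1..x. (cmod (c j))\<^sup>2)"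
proof -
  define e where "e = ecoef (\<lambda>j. if j \<le> x then c j else 0)"
  define g where "g = (\<lambda>l. if l < k then 0 else e (l - k))"
  let ?F = "\<lambda>z. exp (\<Sum>j=1..x. c j * z ^ j / of_nat j)"
  have e: "e l = ecoef c l" if "l \<le> x" for l
    unfolding e_def using that by (intro ecoef_cong) auto
  have e1: "(\<lambda>l. e l * z ^ l) sums ?F z" for z unfolding e_def by (rule exp_sum_sums_ecoef)
  have e2: "(\<lambda>l. g l * z ^ l) sums (z ^ k * ?F z)" for z
  proof -
    have "(\<lambda>i. g (i + k) * z ^ (i + k)) sums (z ^ k * ?F z)"
      using sums_mult[OF e1[of z], of "z ^ k"] by (simp add: g_def power_add mult_ac)
    then show ?thesis by (subst (asm) sums_iff_shift) (simp add: g_def)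
  qed
  have s1: "summable (\<lambda>l. cmod (e l))" unfolding e_def by (rule summable_norm_ecoef_trunc)
  have s2: "summable (\<lambda>l. cmod (g l))"
    by (subst summable_iff_shift[of _ k, symmetric]) (simp add: g_def s1)
  have s3: "summable (\<lambda>l. cmod (e l - g l))"
    by (rule summable_comparison_test'[OF summable_add[OF s1 s2], of 0]) (simp add: norm_triangle_ineq4)
  have e3: "(\<lambda>l. (e l - g l) * z ^ l) sums ((1 - z ^ k) * ?F z)" for z
    using sums_diff[OF e1[of z] e2[of z]] by (simp add: algebra_simps)
  have main: "(\<Sum>l\<le>x. (cmod (\<Sum>j=1..l. c j * (e (l - j) - g (l - j))))\<^sup>2) \<le> S\<^sup>2 * (\<Sum>j=1..x. (cmod (c j))\<^sup>2)"
    by (rule sum_convolution_le_sup[OF s3 e3]) (simp only: norm_mult bd)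
  have "(\<Sum>j=1..l. c j * (e (l - j) - g (l - j)))
      = of_nat l * (ecoef c l - ecoef_int c (int l - int k)) + of_nat k * ecoef_int c (int l - int k)"
    if l: "l \<le> x" for l
  proof -
    have "(\<Sum>j=1..l. c j * (e (l - j) - g (l - j)))
      = (\<Sum>j=1..l. c j * ecoef_int c (int l - int j)) - (\<Sum>j=1..l. c j * ecoef_int c ((int l - int k) - int j))"
      unfolding sum_subtractf[symmetric]
    proof (rule sum.cong[OF refl])
      fix j assume j: "j \<in> {1..l}"
      have "e (l - j) = ecoef_int c (int l - int j)"
        using j l e[of "l - j"] by (simp add: ecoef_int_def nat_diff_distrib)
      moreover have "g (l - j) = ecoef_int c (int l - int k - int j)"
      proof (cases "l - j < k")
        case True
        then show ?thesis using j by (auto simp: g_def)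
      next
        case False
        then have "int l - int k - int j = int (l - j - k)" using j by auto
        then have "ecoef_int c (int l - int k - int j) = ecoef c (l - j - k)"
          by (simp only: ecoef_int_of_nat)
        moreover have "e (l - j - k) = ecoef c (l - j - k)" using l by (intro e) auto
        ultimately show ?thesis using False by (simp add: g_def)
      qed
      ultimately show "c j * (e (l - j) - g (l - j)) = c j * ecoef_int c (int l - int j) - c j * ecoef_int c (int l - int k - int j)"
        by (simp add: algebra_simps)
    qed
    also have "\<dots> = of_int (int l) * ecoef_int c (int l) - of_int (int l - int k) * ecoef_int c (int l - int k)"
      by (subst (1 2) ecoef_int_rec[of _ l]) auto
    finally show ?thesis by (simp add: algebra_simps)
  qed
  then show ?thesis using main by simp
qed

text \<open>Cauchy-Schwarz on a dyadic block. The division by \<open>l\<close> costs the same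
  factor, up to two, throughout the block, so nothing is lost in passing from the mean square of l
  |F_l| to the sum of |F_l|.\<close>

lemma block_sum_le:
  fixes w :: "nat \<Rightarrow> real"
  assumes x: "x \<ge> 1" and nn: "S \<ge> 0" "D \<ge> 0"
    and le: "(\<Sum>l\<le>x. (w l)\<^sup>2) \<le> S\<^sup>2 * (real x * D\<^sup>2)" and w: "\<And>l. w l \<ge> 0"
  shows "(\<Sum>l\<in>{x div 2<..x}. w l / real l) \<le> 2 * (D * S)"
proof -
  have "(\<Sum>l\<in>{x div 2<..x}. w l / real l) \<le> (\<Sum>l\<in>{x div 2<..x}. w l / (real x / 2))"
    using w x by (intro sum_mono divide_left_mono) auto
  also have "\<dots> = 2 / real x * (\<Sum>l\<in>{x div 2<..x}. 1 * w l)"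
    by (simp add: sum_distrib_left field_simps)
  also have "(\<Sum>l\<in>{x div 2<..x}. 1 * w l) \<le> real x * (D * S)"
  proof (rule power2_le_imp_le)
    have "(\<Sum>l\<in>{x div 2<..x}. 1 * w l)\<^sup>2 \<le> (\<Sum>l\<in>{x div 2<..x}. 1\<^sup>2) * (\<Sum>l\<in>{x div 2<..x}. (w l)\<^sup>2)"
      by (rule Cauchy_Schwarz_ineq_sum)
    also have "\<dots> \<le> real x * (S\<^sup>2 * (real x * D\<^sup>2))"
    proof (rule mult_mono)
      have "(\<Sum>l\<in>{x div 2<..x}. (w l)\<^sup>2) \<le> (\<Sum>l\<le>x. (w l)\<^sup>2)" by (intro sum_mono2) auto
      then show "(\<Sum>l\<in>{x div 2<..x}. (w l)\<^sup>2) \<le> S\<^sup>2 * (real x * D\<^sup>2)" using le by linarith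
    qed (auto intro!: sum_nonneg)
    finally show "(\<Sum>l\<in>{x div 2<..x}. 1 * w l)\<^sup>2 \<le> (real x * (D * S))\<^sup>2"
      by (simp add: power2_eq_square mult_ac)
  qed (use nn in auto)
  finally show ?thesis using x by (simp add: mult_left_mono divide_right_mono)
qed

text \<open>The contributions of the dyadic blocks below \<open>x\<close> form a geometric series of
  ratio \<open>r\<close>, with sum 1 / (1 - r) times the top block.\<close>

lemma halving_bound:
  fixes A \<Psi> :: "nat \<Rightarrow> real"
  assumes l: "r < 1" and C: "C \<ge> 0" and E: "E \<ge> 0"
    and 0: "A 0 \<le> C * \<Psi> 0"
    and step: "\<And>x. 1 \<le> x \<Longrightarrow> x \<le> n \<Longrightarrow> A x \<le> A (x div 2) + E * \<Psi> x"
    and decay: "\<And>x. 1 \<le> x \<Longrightarrow> x \<le> n \<Longrightarrow> \<Psi> (x div 2) \<le> r * \<Psi> x"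
    and nn: "\<And>x. \<Psi> x \<ge> 0"
  shows "x \<le> n \<Longrightarrow> A x \<le> (C + E / (1 - r)) * \<Psi> x"
proof (induction x rule: less_induct)
  case (less x)
  show ?case
  proof (cases "x = 0")
    case True
    have "0 \<le> E / (1 - r) * \<Psi> 0" using l E nn[of 0] by simp
    then show ?thesis using True 0 by (simp add: distrib_right)
  next
    case False
    have C0: "C + E / (1 - r) \<ge> 0" using C E l by simp
    have "A x \<le> A (x div 2) + E * \<Psi> x" using False less.prems by (intro step) auto
    also have "A (x div 2) \<le> (C + E / (1 - r)) * \<Psi> (x div 2)"
      using False less.prems by (intro less.IH) auto
    also have "\<dots> \<le> (C + E / (1 - r)) * (r * \<Psi> x)"
      using False less.prems C0 by (intro mult_left_mono decay) auto
    also have "(C + E / (1 - r)) * (r * \<Psi> x) + E * \<Psi> x = (C * r + E / (1 - r)) * \<Psi> x"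
      using l by (simp add: field_simps)
    also have "\<dots> \<le> (C + E / (1 - r)) * \<Psi> x"
    proof (intro mult_right_mono nn add_right_mono)
      show "C * r \<le> C" using mult_left_mono[of r 1 C] l C by simp
    qed
    finally show ?thesis by simp
  qed
qed

lemma harmonic_block_ge: "x \<ge> 1 \<Longrightarrow> 1 / 2 \<le> (\<Sum>j\<in>{x div 2<..x}. 1 / real j)"
proof -
  assume x: "x \<ge> 1"
  have "1 / 2 \<le> real (x - x div 2) * (1 / real x)" using x by (simp add: field_simps)
  also have "\<dots> = (\<Sum>j\<in>{x div 2<..x}. 1 / real x)" by simp
  also have "\<dots> \<le> (\<Sum>j\<in>{x div 2<..x}. 1 / real j)"
    by (intro sum_mono divide_left_mono) auto
  finally show ?thesis .
qed

lemma harmonic_tail_le: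
  assumes "1 \<le> k" "k \<le> x"
  shows "(\<Sum>j\<in>{k<..x}. 1 / real j) \<le> ln (real x / real k)"
  using assms(2)
proof (induction x rule: dec_induct)
  case base
  then show ?case using assms by simp
next
  case (step x)
  have x: "x \<ge> 1" using step assms by simp
  have "{k<..Suc x} = insert (Suc x) {k<..x}" using step by auto
  then have "(\<Sum>j\<in>{k<..Suc x}. 1 / real j) = 1 / real (Suc x) + (\<Sum>j\<in>{k<..x}. 1 / real j)" by simp
  also have "1 / real (Suc x) \<le> ln (real (Suc x) / real x)"
    using ln_le_minus_one[of "real x / real (Suc x)"] x
    by (simp add: ln_div field_simps)
  also have "ln (real (Suc x) / real x) + (\<Sum>j\<in>{k<..x}. 1 / real j) \<le> ln (real (Suc x) / real x) + ln (real x / real k)"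
    using step by simp
  also have "\<dots> = ln (real (Suc x) / real k)"
    using x assms by (simp add: ln_div)
  finally show ?case by simp
qed

text \<open>The shift by one in both arguments keeps the bound meaningful at
  \<open>k = 0\<close>.\<close>

lemma harmonic_tail_ge:
  assumes "k \<le> x"
  shows "ln (real (x + 1) / real (k + 1)) \<le> (\<Sum>j\<in>{k<..x}. 1 / real j)"
  using assms
proof (induction x rule: dec_induct)
  case base
  then show ?case by simp
next
  case (step x)
  have "{k<..Suc x} = insert (Suc x) {k<..x}" using step by auto
  then have "(\<Sum>j\<in>{k<..Suc x}. 1 / real j) = 1 / real (Suc x) + (\<Sum>j\<in>{k<..x}. 1 / real j)" by simp
  moreover have "ln (real (Suc x + 1) / real (x + 1)) \<le> 1 / real (Suc x)"
    using ln_add_one_self_le_self[of "1 / real (Suc x)"] by (simp add: field_simps)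
  moreover have "ln (real (Suc x + 1) / real (k + 1)) = ln (real (Suc x + 1) / real (x + 1)) + ln (real (x + 1) / real (k + 1))"
    by (simp add: ln_div)
  ultimately show ?case using step by simp
qed

section \<open>Size and regularity of the coefficients\<close>

lemma sum_split_greaterThanAtMost:
  fixes g :: "nat \<Rightarrow> real"
  assumes "y \<le> x"
  shows "(\<Sum>j=1..x. g j) = (\<Sum>j=1..y. g j) + (\<Sum>j\<in>{y<..x}. g j)"
proof -
  have "{1..x} = {1..y} \<union> {y<..x}" using assms by auto
  then show ?thesis by (simp only:) (rule sum.union_disjoint; auto)
qed

lemma sum_atMost_split:
  fixes g :: "nat \<Rightarrow> real"
  assumes "y \<le> x"
  shows "(\<Sum>j\<le>x. g j) = (\<Sum>j\<le>y. g j) + (\<Sum>j\<in>{y<..x}. g j)"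
proof -
  have "{..x} = {..y} \<union> {y<..x}" using assms by auto
  then show ?thesis by (simp only:) (rule sum.union_disjoint; auto)
qed

text \<open>A discrete substitute for ln (x / k), additive in the same way and equal to 0 for k
  beyond x, so that no case distinction is required.\<close>

definition tail :: "nat \<Rightarrow> nat \<Rightarrow> real" where
  "tail k x = (\<Sum>j\<in>{k<..x}. 1 / real j)"

lemma tail_nonneg: "tail k x \<ge> 0" unfolding tail_def by (rule sum_nonneg) simp

lemma tail_le_add: "tail k x \<le> tail k y + tail y x"
proof -
  have "tail k x \<le> (\<Sum>j\<in>{k<..y} \<union> {y<..x}. 1 / real j)"
    unfolding tail_def by (intro sum_mono2) auto
  also have "\<dots> = tail k y + tail y x"
    unfolding tail_def by (rule sum.union_disjoint) auto
  finally show ?thesis .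
qed

lemma tail_antimono: "k \<le> l \<Longrightarrow> tail l x \<le> tail k x"
  unfolding tail_def by (intro sum_mono2) auto

section \<open>Bounds along the interpolation between d_j and d_j f_j\<close>

context tilted
begin

text \<open>At s = 0 this is d_j, at s = 1 it is d_j f_j. The parameter is complex because the
  coefficients are later differentiated in s and expanded by a complex Taylor theorem; all estimates
  concern real s between 0 and 1.\<close>

definition cs :: "complex \<Rightarrow> nat \<Rightarrow> complex" where
  "cs s j = complex_of_real (d j) * (1 + s * (f j - 1))"

abbreviation Nz :: "real \<Rightarrow> int \<Rightarrow> complex" where "Nz s \<equiv> ecoef_int (cs (complex_of_real s))"

text \<open>Up to the factor \<open>BB\<close>, this bounds the truncated generating function on the
  unit circle. \<open>Psi\<close> has an additional factor of order (k/x)^\<kappa>, the gain for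
  differences with step \<open>k\<close>; \<open>rr\<close> is the ratio by which both shrink when
  \<open>x\<close> is halved.\<close>

definition psi :: "real \<Rightarrow> nat \<Rightarrow> real" where "psi s x = exp (Lam x - \<kappa> * s * Tf x)"
definition Psi :: "real \<Rightarrow> nat \<Rightarrow> nat \<Rightarrow> real" where "Psi s k x = psi s x * exp (- \<kappa> * tail k x)"
definition BB :: real where "BB = exp (\<kappa> * (81 + 27 * Wf))"
definition rr :: real where "rr = exp (- (a - 5 * \<kappa>) / 2)"

lemma kap_le_1: "\<kappa> \<le> 1" using kap_le a_le kap_pos by linarith
lemma kap_a: "a - 5 * \<kappa> > 0" using kap_le kap_pos by linarith
lemma rr_less: "rr < 1" unfolding rr_def using kap_a by simp
lemma BB_ge_1: "BB \<ge> 1" unfolding BB_def using kap_pos Wf_nonneg by simp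
lemma psi_pos: "psi s x > 0" by (simp add: psi_def)
lemma Psi_pos: "Psi s k x > 0" by (simp add: Psi_def psi_pos)
lemma psi_nonneg: "psi s x \<ge> 0" by (simp add: psi_def)
lemma Psi_nonneg: "Psi s k x \<ge> 0" by (simp add: Psi_def psi_nonneg)
lemma psi_0 [simp]: "psi s 0 = 1" by (simp add: psi_def Lam_def Tf_def)
lemma Psi_0 [simp]: "Psi s k 0 = 1" by (simp add: Psi_def tail_def)

lemma d_nonneg: "1 \<le> j \<Longrightarrow> j \<le> n \<Longrightarrow> 0 \<le> d j"
  using d_bounds[of j] kap_le kap_pos by linarith

lemma norm_cs_le:
  assumes "1 \<le> j" "j \<le> n" "0 \<le> s" "s \<le> 1"
  shows "cmod (cs (of_real s) j) \<le> D"
proof -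
  have "1 + complex_of_real s * (f j - 1) = of_real (1 - s) + of_real s * f j"
    by (simp add: algebra_simps)
  then have "cmod (1 + complex_of_real s * (f j - 1)) \<le> cmod (of_real (1 - s)) + cmod (of_real s * f j)"
    by (metis norm_triangle_ineq)
  also have "\<dots> = 1" using assms by (simp only: norm_mult f_unit norm_of_real)
  finally have "cmod (cs (of_real s) j) \<le> \<bar>d j\<bar> * 1"
    unfolding cs_def norm_mult norm_of_real by (intro mult_left_mono) auto
  then show ?thesis using d_nonneg d_bounds assms by fastforce
qed

lemma sum_norm_cs_sq_le:
  assumes "x \<le> n" "0 \<le> s" "s \<le> 1"
  shows "(\<Sum>j=1..x. (cmod (cs (of_real s) j))\<^sup>2) \<le> real x * D\<^sup>2"
proof -
  have "(\<Sum>j=1..x. (cmod (cs (of_real s) j))\<^sup>2) \<le> (\<Sum>j=1..x. D\<^sup>2)"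
    using assms norm_cs_le by (intro sum_mono power_mono) auto
  then show ?thesis by simp
qed

text \<open>The exponent deficit, exponentiated. The scale \<open>K\<close> of \<open>z\<close> is
  kept in the bound because the estimate for differences plays it off against |1 - z^k|.\<close>

lemma generating_function_scale:
  assumes z: "cmod z = 1" and x: "x \<le> n" and s: "0 \<le> s" "s \<le> 1"
  obtains K :: nat where "K \<ge> 1" "\<And>k. cmod (1 - z ^ k) \<le> 6 * real k / real K"
    "cmod (exp (\<Sum>j=1..x. cs (of_real s) j * z ^ j / of_nat j)) \<le> BB * psi s x * exp (- \<kappa> * tail K x)"
proof -
  obtain K :: nat where K: "K \<ge> 1" "\<And>k. cmod (1 - z ^ k) \<le> 6 * real k / real K"
    "(\<Sum>j\<in>{K<..x}. 1 / real j) \<le> 3 * (\<Sum>j | j \<in> {1..x} \<and> 1/2 \<le> cmod (1 - z ^ j). 1 / real j) + 1"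
    by (rule unit_powers_scale[OF z, of x]) (rule that)
  note def = exponent_deficit[OF z x s K, folded tail_def]
  have "Re (\<Sum>j=1..x. cs (of_real s) j * z ^ j / of_nat j)
    = (\<Sum>j=1..x. d j * Re ((1 + of_real s * (f j - 1)) * z ^ j) / real j)"
    unfolding Re_sum cs_def by (intro sum.cong refl) (simp add: Re_divide_of_nat mult.assoc)
  also have "\<dots> = Lam x - (\<Sum>j=1..x. d j * (1 - Re ((1 + of_real s * (f j - 1)) * z ^ j)) / real j)"
    unfolding Lam_def sum_subtractf[symmetric]
    by (intro sum.cong refl) (simp add: right_diff_distrib diff_divide_distrib)
  also have "\<dots> \<le> (\<kappa> * (81 + 27 * Wf)) + (Lam x - \<kappa> * s * Tf x) + (- \<kappa> * tail K x)"
    using def by (simp add: algebra_simps)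
  finally have "cmod (exp (\<Sum>j=1..x. cs (of_real s) j * z ^ j / of_nat j)) \<le> BB * psi s x * exp (- \<kappa> * tail K x)"
    unfolding norm_exp_eq_Re BB_def psi_def mult_exp_exp by (simp only: exp_le_cancel_iff)
  then show ?thesis by (rule that[OF K(1,2)])
qed

lemma generating_function_le:
  assumes z: "cmod z = 1" and x: "x \<le> n" and s: "0 \<le> s" "s \<le> 1"
  shows "cmod (exp (\<Sum>j=1..x. cs (of_real s) j * z ^ j / of_nat j)) \<le> BB * psi s x"
proof -
  obtain K :: nat where K: "cmod (exp (\<Sum>j=1..x. cs (of_real s) j * z ^ j / of_nat j)) \<le> BB * psi s x * exp (- \<kappa> * tail K x)"
    by (rule generating_function_scale[OF assms]) (rule that)
  also have "\<dots> \<le> BB * psi s x * 1"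
    using kap_pos tail_nonneg psi_pos BB_ge_1 by (intro mult_left_mono) (auto simp: less_imp_le)
  finally show ?thesis by simp
qed

text \<open>If K is at most k, the factor with \<open>tail K x\<close> is already as small as
  required. If k < K, then z^k is within 6 k / K of 1, and this makes up for the missing tail
  between k and K, which costs at most (K/k)^\<kappa>, hence at most K/k.\<close>

lemma generating_function_diff_le:
  assumes z: "cmod z = 1" and x: "x \<le> n" and s: "0 \<le> s" "s \<le> 1" and k: "k \<ge> 1"
  shows "cmod (1 - z ^ k) * cmod (exp (\<Sum>j=1..x. cs (of_real s) j * z ^ j / of_nat j)) \<le> 6 * BB * Psi s k x"
proof -
  obtain K :: nat where K: "K \<ge> 1" "\<And>k. cmod (1 - z ^ k) \<le> 6 * real k / real K"
    "cmod (exp (\<Sum>j=1..x. cs (of_real s) j * z ^ j / of_nat j)) \<le> BB * psi s x * exp (- \<kappa> * tail K x)"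
    by (rule generating_function_scale[OF z x s]) (rule that)
  have key: "cmod (1 - z ^ k) * exp (- \<kappa> * tail K x) \<le> 6 * exp (- \<kappa> * tail k x)"
  proof (cases "K \<le> k")
    case True
    have "cmod (1 - z ^ k) \<le> 6" using norm_triangle_ineq4[of 1 "z ^ k"] z by (simp add: norm_power)
    moreover have "exp (- \<kappa> * tail K x) \<le> exp (- \<kappa> * tail k x)"
      using tail_antimono[OF True] kap_pos by simp
    ultimately show ?thesis by (intro mult_mono) auto
  next
    case False
    have "tail k x \<le> ln (real K / real k) + tail K x"
      using tail_le_add[of k x K] harmonic_tail_le[of k K] k False by (simp add: tail_def)
    then have "\<kappa> * tail k x \<le> \<kappa> * ln (real K / real k) + \<kappa> * tail K x"
      using kap_pos by (metis distrib_left less_imp_le mult_left_mono)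
    also have "\<kappa> * ln (real K / real k) \<le> 1 * ln (real K / real k)"
      using kap_le_1 k False by (intro mult_right_mono) auto
    finally have "exp (- \<kappa> * tail K x) \<le> exp (ln (real K / real k) + - \<kappa> * tail k x)"
      by simp
    also have "\<dots> = real K / real k * exp (- \<kappa> * tail k x)"
      unfolding exp_add using k K(1) by simp
    finally have "cmod (1 - z ^ k) * exp (- \<kappa> * tail K x)
       \<le> (6 * real k / real K) * (real K / real k * exp (- \<kappa> * tail k x))"
      using K(2)[of k] by (intro mult_mono) auto
    also have "\<dots> = 6 * exp (- \<kappa> * tail k x)" using k K(1) by simp
    finally show ?thesis .
  qed
  have "cmod (1 - z ^ k) * cmod (exp (\<Sum>j=1..x. cs (of_real s) j * z ^ j / of_nat j))
    \<le> cmod (1 - z ^ k) * (BB * psi s x * exp (- \<kappa> * tail K x))"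
    using K(3) by (intro mult_left_mono) auto
  also have "\<dots> = (BB * psi s x) * (cmod (1 - z ^ k) * exp (- \<kappa> * tail K x))" by (simp add: mult_ac)
  also have "\<dots> \<le> (BB * psi s x) * (6 * exp (- \<kappa> * tail k x))"
    using key psi_pos[of s x] BB_ge_1 by (intro mult_left_mono) auto
  finally show ?thesis by (simp add: Psi_def mult_ac)
qed

text \<open>Each j contributes at least a/j to \<open>Lam\<close> and at most 4/j to
  \<open>Tf\<close>, as |1 - f_j| is at most 2. The tail factor in \<open>Psi\<close> takes away one
  more \<kappa>, which leaves the rate a - 5\<kappa>.\<close>

lemma psi_growth:
  assumes "y \<le> x" "x \<le> n" "0 \<le> s" "s \<le> 1"
  shows "psi s y * exp ((a - 4 * \<kappa>) * tail y x) \<le> psi s x"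
proof -
  have "a * tail y x \<le> (\<Sum>j\<in>{y<..x}. d j / real j)"
    unfolding tail_def sum_distrib_left using assms d_bounds
    by (intro sum_mono) (auto intro!: divide_right_mono)
  then have L: "Lam y + a * tail y x \<le> Lam x"
    unfolding Lam_def using sum_split_greaterThanAtMost[OF assms(1), of "\<lambda>j. d j / real j"] by simp
  have "(\<Sum>j\<in>{y<..x}. (cmod (1 - f j))\<^sup>2 / real j) \<le> 4 * tail y x"
    unfolding tail_def sum_distrib_left
  proof (rule sum_mono)
    fix j
    have "cmod (1 - f j) \<le> 2" using norm_triangle_ineq4[of 1 "f j"] f_unit[of j] by simp
    then have "(cmod (1 - f j))\<^sup>2 \<le> 2\<^sup>2" by (intro power_mono) auto
    then show "(cmod (1 - f j))\<^sup>2 / real j \<le> 4 * (1 / real j)" by (simp add: divide_right_mono)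
  qed
  then have T: "Tf x \<le> Tf y + 4 * tail y x"
    unfolding Tf_def using sum_split_greaterThanAtMost[OF assms(1), of "\<lambda>j. (cmod (1 - f j))\<^sup>2 / real j"] by simp
  have "(\<kappa> * s) * Tf x \<le> (\<kappa> * s) * (Tf y + 4 * tail y x)"
    using T assms kap_pos by (intro mult_left_mono) auto
  moreover have "\<kappa> * s * (4 * tail y x) \<le> \<kappa> * 1 * (4 * tail y x)"
    using assms kap_pos tail_nonneg by (intro mult_right_mono mult_left_mono) auto
  ultimately have "Lam y - \<kappa> * s * Tf y + (a - 4 * \<kappa>) * tail y x \<le> Lam x - \<kappa> * s * Tf x"
    using L by (simp add: algebra_simps)
  then show ?thesis unfolding psi_def mult_exp_exp by simp
qed

lemma psi_mono:
  assumes "y \<le> x" "x \<le> n" "0 \<le> s" "s \<le> 1"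
  shows "psi s y \<le> psi s x"
proof -
  have "psi s y * 1 \<le> psi s y * exp ((a - 4 * \<kappa>) * tail y x)"
    using kap_a kap_pos tail_nonneg psi_pos[of s y] by (intro mult_left_mono) auto
  then show ?thesis using psi_growth[OF assms] by simp
qed

lemma Psi_growth:
  assumes "y \<le> x" "x \<le> n" "0 \<le> s" "s \<le> 1"
  shows "Psi s k y * exp ((a - 5 * \<kappa>) * tail y x) \<le> Psi s k x"
proof -
  have "Psi s k y * exp ((a - 5 * \<kappa>) * tail y x)
    = psi s y * exp ((a - 4 * \<kappa>) * tail y x) * exp (- \<kappa> * (tail k y + tail y x))"
    unfolding Psi_def mult.assoc mult_exp_exp by (simp add: algebra_simps)
  also have "\<dots> \<le> psi s x * exp (- \<kappa> * tail k x)"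
    using psi_growth[OF assms] tail_le_add[of k x y] kap_pos psi_pos[of s x] by (intro mult_mono) auto
  finally show ?thesis by (simp add: Psi_def)
qed

lemma Psi_halving:
  assumes "1 \<le> x" "x \<le> n" "0 \<le> s" "s \<le> 1"
  shows "Psi s k (x div 2) \<le> rr * Psi s k x"
proof -
  have "(a - 5 * \<kappa>) * (1/2) \<le> (a - 5 * \<kappa>) * tail (x div 2) x"
    using kap_a harmonic_block_ge[OF assms(1)] by (intro mult_left_mono) (auto simp: tail_def)
  then have "Psi s k (x div 2) * exp ((a - 5 * \<kappa>) / 2) \<le> Psi s k (x div 2) * exp ((a - 5 * \<kappa>) * tail (x div 2) x)"
    using Psi_pos[of s k "x div 2"] by (intro mult_left_mono) auto
  also have "\<dots> \<le> Psi s k x" using assms by (intro Psi_growth) auto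
  finally have "rr * (Psi s k (x div 2) * exp ((a - 5 * \<kappa>) / 2)) \<le> rr * Psi s k x"
    by (intro mult_left_mono) (auto simp: rr_def)
  moreover have "rr * exp ((a - 5 * \<kappa>) / 2) = 1" unfolding rr_def mult_exp_exp by (simp add: add_divide_distrib[symmetric])
  moreover have "rr * (Psi s k (x div 2) * exp ((a - 5 * \<kappa>) / 2)) = (rr * exp ((a - 5 * \<kappa>) / 2)) * Psi s k (x div 2)"
    by (simp only: mult_ac)
  ultimately show ?thesis by simp
qed

lemma psi_halving:
  assumes "1 \<le> x" "x \<le> n" "0 \<le> s" "s \<le> 1"
  shows "psi s (x div 2) \<le> rr * psi s x"
  using Psi_halving[OF assms, of x] by (simp add: Psi_def tail_def)

text \<open>\<open>C1\<close> and \<open>C2\<close> belong to sums of coefficients and of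
  differences, \<open>C3\<close> and \<open>C4\<close> to single ones. They depend only on
  \<open>a\<close>, \<open>D\<close> and \<kappa>, neither on n nor on f; the uniformity of the
  final constant rests on this.\<close>

definition C1 :: real where "C1 = 1 + 2 * D / (1 - rr)"
definition C2 :: real where "C2 = 1 + (12 * D + 2 * C1) / (1 - rr)"
definition C3 :: real where "C3 = 2 * D * C1 + 1"
definition C4 :: real where "C4 = 2 * C3 + D * C2"

lemma C1_ge: "C1 \<ge> 1" unfolding C1_def using rr_less D_ge by simp
lemma C2_ge: "C2 \<ge> 1" unfolding C2_def using rr_less D_ge C1_ge by simp
lemma C3_ge: "C3 \<ge> 1" unfolding C3_def using C1_ge D_ge by simp

text \<open>Parseval on each dyadic block, where the coefficients \<open>cs\<close> are bounded by
  \<open>D\<close>, followed by summation over the blocks.\<close>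

lemma sum_norm_Nz_le:
  assumes s: "0 \<le> s" "s \<le> 1" and x: "x \<le> n"
  shows "(\<Sum>l\<le>x. cmod (Nz s (int l))) \<le> BB * C1 * psi s x"
proof -
  have "(\<Sum>l\<le>x. cmod (Nz s (int l))) \<le> (BB + 2 * D * BB / (1 - rr)) * psi s x"
  proof (rule halving_bound[where A="\<lambda>x. \<Sum>l\<le>x. cmod (Nz s (int l))" and n=n and r=rr])
    fix x assume x: "1 \<le> x" "x \<le> n"
    have "(\<Sum>l\<in>{x div 2<..x}. cmod (Nz s (int l)))
        = (\<Sum>l\<in>{x div 2<..x}. cmod (of_nat l * ecoef (cs (of_real s)) l) / real l)"
      by (intro sum.cong) (auto simp: norm_mult)
    also have "\<dots> \<le> 2 * (D * (BB * psi s x))"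
    proof (rule block_sum_le[OF x(1)])
      have "(\<Sum>l\<le>x. (cmod (of_nat l * ecoef (cs (of_real s)) l))\<^sup>2)
        \<le> (BB * psi s x)\<^sup>2 * (\<Sum>j=1..x. (cmod (cs (of_real s) j))\<^sup>2)"
        by (rule sum_sq_ecoef_le) (rule generating_function_le[OF _ x(2) s])
      also have "\<dots> \<le> (BB * psi s x)\<^sup>2 * (real x * D\<^sup>2)"
        using sum_norm_cs_sq_le[OF x(2) s] by (intro mult_left_mono) auto
      finally show "(\<Sum>l\<le>x. (cmod (of_nat l * ecoef (cs (of_real s)) l))\<^sup>2) \<le> (BB * psi s x)\<^sup>2 * (real x * D\<^sup>2)" .
    qed (use BB_ge_1 psi_pos[of s x] D_ge in auto)
    finally show "(\<Sum>l\<le>x. cmod (Nz s (int l))) \<le> (\<Sum>l\<le>x div 2. cmod (Nz s (int l))) + 2 * D * BB * psi s x"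
      by (subst sum_atMost_split[of "x div 2" x]) (auto simp: mult_ac)
  next
    show "(\<Sum>l\<le>0. cmod (Nz s (int l))) \<le> BB * psi s 0" using BB_ge_1 by (simp add: ecoef_int_def)
  qed (use rr_less BB_ge_1 D_ge psi_halving s psi_nonneg x in auto)
  also have "BB + 2 * D * BB / (1 - rr) = BB * C1" by (simp add: C1_def algebra_simps)
  finally show ?thesis .
qed

lemma sum_norm_Nz_shift_le:
  "(\<Sum>l\<le>x. cmod (Nz s (int l - int k))) \<le> (\<Sum>l\<le>x. cmod (Nz s (int l)))"
proof -
  have "(\<Sum>l\<le>x. cmod (Nz s (int l - int k))) = (\<Sum>l\<in>{k..x}. cmod (Nz s (int l - int k)))"
    by (rule sum.mono_neutral_right) auto
  also have "\<dots> = (\<Sum>l\<in>{k..x}. cmod (Nz s (int (l - k))))"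
    by (rule sum.cong[OF refl]) (simp only: atLeastAtMost_iff of_nat_diff)
  also have "\<dots> = (\<Sum>l\<in>(\<lambda>l. l - k) ` {k..x}. cmod (Nz s (int l)))"
    by (subst sum.reindex, force simp: inj_on_def, simp only: comp_def)
  also have "\<dots> \<le> (\<Sum>l\<le>x. cmod (Nz s (int l)))" by (intro sum_mono2) auto
  finally show ?thesis .
qed

text \<open>A factor k/x is smaller than (k/x)^\<kappa>, because \<kappa> is at most 1.\<close>

lemma psi_le_Psi:
  assumes "1 \<le> k" "k \<le> x"
  shows "real k / real x * psi s x \<le> Psi s k x"
proof -
  have "\<kappa> * tail k x \<le> 1 * ln (real x / real k)"
    using harmonic_tail_le[OF assms] kap_le_1 kap_pos tail_nonneg unfolding tail_def[symmetric]
    by (intro mult_mono) auto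
  then have "exp (- ln (real x / real k)) \<le> exp (- \<kappa> * tail k x)" by simp
  moreover have "exp (- ln (real x / real k)) = real k / real x"
    using assms by (simp add: exp_minus)
  ultimately show ?thesis unfolding Psi_def using psi_pos[of s x]
    by (metis less_imp_le mult.commute mult_left_mono)
qed

text \<open>As for the coefficients themselves, with (1 - z^k) F in place of F. The correction k
  F_{l-k} has relative size k/x on the block and fits into \<open>Psi\<close>; for k > x it
  vanishes.\<close>

lemma sum_norm_Nz_diff_le:
  assumes s: "0 \<le> s" "s \<le> 1" and x: "x \<le> n" and k: "1 \<le> k"
  shows "(\<Sum>l\<le>x. cmod (Nz s (int l) - Nz s (int l - int k))) \<le> BB * C2 * Psi s k x"
proof -
  define A where "A = (\<lambda>x. \<Sum>l\<le>x. cmod (Nz s (int l) - Nz s (int l - int k)))"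
  have "A x \<le> (BB + BB * (12 * D + 2 * C1) / (1 - rr)) * Psi s k x"
  proof (rule halving_bound[where n=n and r=rr])
    fix x assume x: "1 \<le> x" "x \<le> n"
    define w where "w l = cmod (of_nat l * (ecoef (cs (of_real s)) l - Nz s (int l - int k)) + of_nat k * Nz s (int l - int k))" for l
    have "(\<Sum>l\<in>{x div 2<..x}. cmod (Nz s (int l) - Nz s (int l - int k)))
        \<le> (\<Sum>l\<in>{x div 2<..x}. w l / real l + real k * cmod (Nz s (int l - int k)) / real l)"
    proof (rule sum_mono)
      fix l assume l: "l \<in> {x div 2<..x}"
      have "cmod (of_nat l * (Nz s (int l) - Nz s (int l - int k))) \<le> w l + cmod (of_nat k * Nz s (int l - int k))"
        using norm_triangle_ineq4[of "of_nat l * (Nz s (int l) - Nz s (int l - int k)) + of_nat k * Nz s (int l - int k)" "of_nat k * Nz s (int l - int k)"]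
        by (simp add: w_def)
      then have "cmod (Nz s (int l) - Nz s (int l - int k)) * real l \<le> w l + real k * cmod (Nz s (int l - int k))"
        by (simp add: norm_mult mult.commute)
      then have "cmod (Nz s (int l) - Nz s (int l - int k)) \<le> (w l + real k * cmod (Nz s (int l - int k))) / real l"
        using l by (subst pos_le_divide_eq) auto
      then show "cmod (Nz s (int l) - Nz s (int l - int k)) \<le> w l / real l + real k * cmod (Nz s (int l - int k)) / real l"
        by (simp add: add_divide_distrib)
    qed
    also have "\<dots> = (\<Sum>l\<in>{x div 2<..x}. w l / real l) + (\<Sum>l\<in>{x div 2<..x}. real k * cmod (Nz s (int l - int k)) / real l)"
      by (rule sum.distrib)
    also have "(\<Sum>l\<in>{x div 2<..x}. w l / real l) \<le> 2 * (D * (6 * BB * Psi s k x))"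
    proof (rule block_sum_le[OF x(1)])
      have "(\<Sum>l\<le>x. (w l)\<^sup>2) \<le> (6 * BB * Psi s k x)\<^sup>2 * (\<Sum>j=1..x. (cmod (cs (of_real s) j))\<^sup>2)"
        unfolding w_def by (rule sum_sq_ecoef_diff_le) (rule generating_function_diff_le[OF _ x(2) s k])
      also have "\<dots> \<le> (6 * BB * Psi s k x)\<^sup>2 * (real x * D\<^sup>2)"
        using sum_norm_cs_sq_le[OF x(2) s] by (intro mult_left_mono) auto
      finally show "(\<Sum>l\<le>x. (w l)\<^sup>2) \<le> (6 * BB * Psi s k x)\<^sup>2 * (real x * D\<^sup>2)" .
    qed (use BB_ge_1 Psi_pos[of s k x] D_ge in \<open>auto simp: w_def\<close>)
    also have "(\<Sum>l\<in>{x div 2<..x}. real k * cmod (Nz s (int l - int k)) / real l) \<le> 2 * C1 * BB * Psi s k x"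
    proof (cases "k \<le> x")
      case True
      have "(\<Sum>l\<in>{x div 2<..x}. real k * cmod (Nz s (int l - int k)) / real l)
        \<le> (\<Sum>l\<in>{x div 2<..x}. real k * cmod (Nz s (int l - int k)) / (real x / 2))"
        using x by (intro sum_mono divide_left_mono) auto
      also have "\<dots> = 2 * real k / real x * (\<Sum>l\<in>{x div 2<..x}. cmod (Nz s (int l - int k)))"
        by (simp add: sum_distrib_left field_simps)
      also have "\<dots> \<le> 2 * real k / real x * (\<Sum>l\<le>x. cmod (Nz s (int l - int k)))"
        by (intro mult_left_mono sum_mono2) auto
      also have "\<dots> \<le> 2 * real k / real x * (BB * C1 * psi s x)"
        using sum_norm_Nz_shift_le[of s k x] sum_norm_Nz_le[OF s x(2)] by (intro mult_left_mono) auto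
      also have "\<dots> = 2 * BB * C1 * (real k / real x * psi s x)" by simp
      also have "\<dots> \<le> 2 * BB * C1 * Psi s k x"
        using BB_ge_1 C1_ge by (intro mult_left_mono psi_le_Psi k True) auto
      finally show ?thesis by (simp add: mult_ac)
    next
      case False
      then have "(\<Sum>l\<in>{x div 2<..x}. real k * cmod (Nz s (int l - int k)) / real l) = 0"
        by (intro sum.neutral) auto
      then show ?thesis using C1_ge BB_ge_1 Psi_pos[of s k x] by simp
    qed
    finally show "A x \<le> A (x div 2) + BB * (12 * D + 2 * C1) * Psi s k x"
      unfolding A_def by (subst sum_atMost_split[of "x div 2" x]) (auto simp: algebra_simps)
  next
    show "A 0 \<le> BB * Psi s k 0" using BB_ge_1 k by (simp add: A_def ecoef_int_def)
  qed (use rr_less BB_ge_1 D_ge C1_ge Psi_halving s Psi_nonneg x in auto)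
  also have "BB + BB * (12 * D + 2 * C1) / (1 - rr) = BB * C2" by (simp add: C2_def algebra_simps)
  finally show ?thesis by (simp add: A_def)
qed

text \<open>The passage from mean to pointwise bounds: by the recursion, m F_m is a convolution with
  coefficients of size at most \<open>D\<close>.\<close>

lemma conv_cs_le:
  assumes s: "0 \<le> s" "s \<le> 1" and m: "m \<le> n"
  shows "cmod (\<Sum>j=1..m. cs (of_real s) j * g (m - j)) \<le> D * (\<Sum>l\<le>m. cmod (g l))"
proof -
  have "cmod (\<Sum>j=1..m. cs (of_real s) j * g (m - j)) \<le> (\<Sum>j=1..m. D * cmod (g (m - j)))"
    using norm_cs_le s m by (intro sum_norm_le) (auto simp: norm_mult intro!: mult_right_mono)
  also have "\<dots> = D * (\<Sum>l\<in>(\<lambda>j. m - j) ` {1..m}. cmod (g l))"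
    by (subst sum.reindex) (auto simp: inj_on_def sum_distrib_left)
  also have "\<dots> \<le> D * (\<Sum>l\<le>m. cmod (g l))"
    using D_ge by (intro mult_left_mono sum_mono2) auto
  finally show ?thesis .
qed

lemma norm_Nz_le:
  assumes s: "0 \<le> s" "s \<le> 1" and m: "m \<le> n"
  shows "real (m + 1) * cmod (Nz s (int m)) \<le> C3 * BB * psi s m"
proof (cases "m = 0")
  case True
  then show ?thesis using mult_mono[of 1 C3 1 BB] C3_ge BB_ge_1 by (simp add: ecoef_int_def)
next
  case False
  have "of_nat m * Nz s (int m) = (\<Sum>j=1..m. cs (of_real s) j * ecoef (cs (of_real s)) (m - j))"
    using False by (simp add: ecoef_rec)
  then have "real m * cmod (Nz s (int m)) \<le> D * (\<Sum>l\<le>m. cmod (ecoef (cs (of_real s)) l))"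
    using conv_cs_le[OF s m, of "ecoef (cs (of_real s))"] by (metis norm_mult norm_of_nat)
  also have "\<dots> \<le> D * (BB * C1 * psi s m)"
    using sum_norm_Nz_le[OF s m] D_ge by (intro mult_left_mono) auto
  finally have "2 * (real m * cmod (Nz s (int m))) \<le> 2 * (D * (BB * C1 * psi s m))" by simp
  moreover have "real (m + 1) * cmod (Nz s (int m)) \<le> (2 * real m) * cmod (Nz s (int m))"
    using False by (intro mult_right_mono) auto
  moreover have "0 \<le> BB * psi s m" using BB_ge_1 psi_pos[of s m] by simp
  ultimately show ?thesis unfolding C3_def by (simp add: algebra_simps)
qed

text \<open>Subtracting the recursions at m and m - k writes m (F_m - F_{m-k}) as a convolution of
  differences minus k F_{m-k}. The condition \<open>2 * k \<le> m\<close> keeps m - k comparable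
  with m, so that the last term is of order (k/m) psi(m).\<close>

lemma norm_Nz_diff_le:
  assumes s: "0 \<le> s" "s \<le> 1" and m: "m \<le> n" and k: "1 \<le> k" "2 * k \<le> m"
  shows "real m * cmod (Nz s (int m) - Nz s (int m - int k)) \<le> C4 * BB * Psi s k m"
proof -
  define g where "g l = Nz s (int l) - Nz s (int l - int k)" for l
  have "(\<Sum>j=1..m. cs (of_real s) j * g (m - j)) = (\<Sum>j=1..m. cs (of_real s) j * Nz s (int m - int j))
     - (\<Sum>j=1..m. cs (of_real s) j * Nz s ((int m - int k) - int j))"
    unfolding g_def sum_subtractf[symmetric]
    by (intro sum.cong refl) (auto simp: of_nat_diff algebra_simps)
  also have "\<dots> = of_int (int m) * Nz s (int m) - of_int (int m - int k) * Nz s (int m - int k)"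
    by (subst (1 2) ecoef_int_rec[of _ m]) auto
  finally have "of_nat m * (Nz s (int m) - Nz s (int m - int k)) = (\<Sum>j=1..m. cs (of_real s) j * g (m - j)) - of_nat k * Nz s (int m - int k)"
    by (simp add: algebra_simps)
  then have "cmod (of_nat m * (Nz s (int m) - Nz s (int m - int k))) \<le> cmod (\<Sum>j=1..m. cs (of_real s) j * g (m - j)) + cmod (of_nat k * Nz s (int m - int k))"
    by (metis norm_triangle_ineq4)
  also have "cmod (\<Sum>j=1..m. cs (of_real s) j * g (m - j)) \<le> D * (BB * C2 * Psi s k m)"
    using conv_cs_le[OF s m, of g] sum_norm_Nz_diff_le[OF s m k(1)] D_ge unfolding g_def
    by (meson mult_left_mono order_trans zero_le_one)
  also have "cmod (of_nat k * Nz s (int m - int k)) \<le> 2 * C3 * BB * Psi s k m"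
  proof -
    have mk: "int m - int k = int (m - k)" using k by auto
    have "(real m / 2) * cmod (Nz s (int (m - k))) \<le> real (m - k + 1) * cmod (Nz s (int (m - k)))"
      using k by (intro mult_right_mono) (auto simp: of_nat_diff)
    also have "\<dots> \<le> C3 * BB * psi s (m - k)" using m by (intro norm_Nz_le s) auto
    also have "\<dots> \<le> C3 * BB * psi s m"
      using C3_ge BB_ge_1 m s by (intro mult_left_mono psi_mono) auto
    finally have "(real m / 2) * cmod (Nz s (int (m - k))) \<le> C3 * BB * psi s m" .
    then have "2 * (real k / real m) * ((real m / 2) * cmod (Nz s (int (m - k)))) \<le> 2 * (real k / real m) * (C3 * BB * psi s m)"
      by (intro mult_left_mono) auto
    also have "\<dots> = 2 * C3 * BB * (real k / real m * psi s m)" by simp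
    also have "\<dots> \<le> 2 * C3 * BB * Psi s k m"
      using C3_ge BB_ge_1 k by (intro mult_left_mono psi_le_Psi) auto
    finally show ?thesis using k unfolding mk by (simp add: norm_mult)
  qed
  finally have "cmod (of_nat m * (Nz s (int m) - Nz s (int m - int k)))
    \<le> D * (BB * C2 * Psi s k m) + 2 * C3 * BB * Psi s k m" by simp
  also have "\<dots> = C4 * BB * Psi s k m" by (simp add: C4_def algebra_simps)
  finally show ?thesis by (simp only: norm_mult norm_of_nat)
qed

end

section \<open>Expansion of the coefficients to second order\<close>

text \<open>The first factor is the Hoelder gain for small \<open>j\<close>. The second is the
  blow-up for \<open>j\<close> close to \<open>x\<close>, where the coefficient of small index x - j
  is relatively large; the shift to x + 1 keeps it finite at j = x.\<close>

definition wght :: "real \<Rightarrow> real \<Rightarrow> nat \<Rightarrow> nat \<Rightarrow> real" where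
  "wght \<kappa> \<gamma> x j = (real j / real (x + 1)) powr \<kappa> * (real (x + 1) / (real (x + 1) - real j)) powr \<gamma>"

context tilted
begin

text \<open>\<open>gam\<close> - \<kappa> = 1 - (a - 5\<kappa>) is the exponent with which a
  coefficient of index x may exceed the n-th one. The extra \<kappa> absorbs the shifts j > x, which
  have no Hoelder gain at scale x.\<close>

definition gam :: real where "gam = 1 - a + 6 * \<kappa>"
abbreviation wt :: "nat \<Rightarrow> nat \<Rightarrow> real" where "wt \<equiv> wght \<kappa> gam"
definition QQ :: "real \<Rightarrow> real" where "QQ s = psi s n / real (n + 1)"
definition qq :: "nat \<Rightarrow> real" where "qq x = real (n + 1) / real (x + 1)"
definition C5 :: real where "C5 = 4 * (C3 + C4)"

lemma gam_nonneg: "gam \<ge> 0" unfolding gam_def using kap_pos a_le by linarith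
lemma gam_le_1: "gam \<le> 1" unfolding gam_def using kap_pos kap_le by linarith
lemma QQ_nonneg: "QQ s \<ge> 0" unfolding QQ_def using psi_nonneg by simp
lemma C4_ge: "C4 \<ge> 1"
  unfolding C4_def using C3_ge C2_ge D_ge by (simp add: add_increasing2)
lemma qq_ge: "x \<le> n \<Longrightarrow> qq x \<ge> 1" unfolding qq_def by simp
lemma wt_nonneg: "wt x j \<ge> 0" unfolding wght_def by simp

lemma wt_factor_ge_1: "j \<le> x \<Longrightarrow> (real (x + 1) / (real (x + 1) - real j)) powr gam \<ge> 1"
  using gam_nonneg by (intro ge_one_powr_ge_zero) auto

lemma wt_ge_left: "j \<le> x \<Longrightarrow> (real j / real (x + 1)) powr \<kappa> \<le> wt x j"
  unfolding wght_def using mult_left_mono[OF wt_factor_ge_1, of j x "(real j / real (x + 1)) powr \<kappa>"] by simp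

lemma powr_kap_le: "c \<ge> 1 \<Longrightarrow> c powr \<kappa> \<le> c"
  using powr_mono[OF kap_le_1, of c] by simp

text \<open>Between x and n, psi grows at least like the power a - 5\<kappa> of (n + 1)/(x + 1),
  while the denominator x + 1 grows linearly.\<close>

lemma psi_div_le:
  assumes x: "x \<le> n" and s: "0 \<le> s" "s \<le> 1"
  shows "psi s x / real (x + 1) \<le> QQ s * qq x powr (gam - \<kappa>)"
proof -
  define b where "b = a - 5 * \<kappa>"
  have b: "b > 0" using kap_a by (simp add: b_def)
  have gb: "gam - \<kappa> = 1 - b" by (simp add: gam_def b_def)
  have q: "qq x \<ge> 1" using x by (rule qq_ge)
  have "b * ln (qq x) \<le> (a - 4 * \<kappa>) * tail x n"
    using harmonic_tail_ge[OF x] b kap_pos q unfolding tail_def[symmetric] qq_def[symmetric]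
    by (intro mult_mono) (auto simp: b_def)
  then have "qq x powr b \<le> exp ((a - 4 * \<kappa>) * tail x n)"
    using q by (simp add: powr_def)
  then have "psi s x * qq x powr b \<le> psi s x * exp ((a - 4 * \<kappa>) * tail x n)"
    using psi_nonneg by (intro mult_left_mono) auto
  also have "\<dots> \<le> psi s n" using x s by (intro psi_growth) auto
  finally have *: "psi s x * qq x powr b \<le> psi s n" .
  have "psi s x / real (x + 1) = (psi s x * qq x powr b) / real (n + 1) * (qq x / qq x powr b)"
    using q by (simp add: qq_def)
  also have "qq x / qq x powr b = qq x powr (1 - b)" using q by (simp add: powr_diff)
  also have "(psi s x * qq x powr b) / real (n + 1) * qq x powr (1 - b) \<le> QQ s * qq x powr (1 - b)"
    unfolding QQ_def using * by (intro mult_right_mono divide_right_mono) auto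
  finally show ?thesis by (simp only: gb)
qed

lemma norm_Nz_le_QQ:
  assumes x: "x \<le> n" and s: "0 \<le> s" "s \<le> 1"
  shows "cmod (Nz s (int x)) \<le> C3 * BB * QQ s * qq x powr (gam - \<kappa>)"
proof -
  have "cmod (Nz s (int x)) = real (x + 1) * cmod (Nz s (int x)) / real (x + 1)" by simp
  also have "\<dots> \<le> C3 * BB * psi s x / real (x + 1)"
    by (intro divide_right_mono norm_Nz_le s x) simp
  also have "\<dots> = C3 * BB * (psi s x / real (x + 1))" by simp
  also have "\<dots> \<le> C3 * BB * (QQ s * qq x powr (gam - \<kappa>))"
    using C3_ge BB_ge_1 by (intro mult_left_mono psi_div_le x s) auto
  finally show ?thesis by (simp add: mult_ac)
qed

text \<open>For 2 j at most x this is the Hoelder estimate. For larger j the factor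
  (j/(x+1))^\<kappa> is at least 1/2, so the two coefficients may be bounded separately; the one of
  index x - j produces the singular factor of the weight.\<close>

lemma norm_Nz_diff_le_wt:
  assumes j: "1 \<le> j" "j \<le> x" and x: "x \<le> n" and s: "0 \<le> s" "s \<le> 1"
  shows "cmod (Nz s (int x) - Nz s (int x - int j)) \<le> C5 * BB * QQ s * qq x powr (gam - \<kappa>) * wt x j"
proof (cases "2 * j \<le> x")
  case True
  define P where "P = QQ s * qq x powr (gam - \<kappa>)"
  have P: "P \<ge> 0" using QQ_nonneg by (simp add: P_def)
  have "\<kappa> * ln (real (x + 1) / real (j + 1)) \<le> \<kappa> * tail j x"
    using harmonic_tail_ge[OF j(2)] kap_pos by (intro mult_left_mono) (auto simp: tail_def)
  then have "exp (- \<kappa> * tail j x) \<le> exp (\<kappa> * - ln (real (x + 1) / real (j + 1)))" by simp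
  also have "\<dots> = (real (j + 1) / real (x + 1)) powr \<kappa>"
    by (simp add: powr_def ln_div)
  also have "\<dots> \<le> (2 * (real j / real (x + 1))) powr \<kappa>"
    using j kap_pos by (intro powr_mono2) (auto simp: divide_right_mono)
  also have "\<dots> = 2 powr \<kappa> * (real j / real (x + 1)) powr \<kappa>" by (rule powr_mult)
  also have "\<dots> \<le> 2 * wt x j"
    using wt_ge_left[OF j(2)] powr_kap_le[of 2] by (intro mult_mono) auto
  finally have e: "exp (- \<kappa> * tail j x) \<le> 2 * wt x j" .
  have "real x * cmod (Nz s (int x) - Nz s (int x - int j)) \<le> C4 * BB * Psi s j x"
    by (rule norm_Nz_diff_le[OF s x j(1) True])
  then have "cmod (Nz s (int x) - Nz s (int x - int j)) \<le> C4 * BB * Psi s j x / real x"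
    using j by (subst pos_le_divide_eq) (auto simp: mult.commute)
  also have "\<dots> \<le> C4 * BB * Psi s j x / (real (x + 1) / 2)"
    using j C4_ge BB_ge_1 Psi_nonneg by (intro divide_left_mono) auto
  also have "\<dots> = 2 * C4 * BB * ((psi s x / real (x + 1)) * exp (- \<kappa> * tail j x))" by (simp add: Psi_def)
  also have "\<dots> \<le> 2 * C4 * BB * (P * (2 * wt x j))"
    unfolding P_def using C4_ge BB_ge_1 e psi_div_le[OF x s] QQ_nonneg
    by (intro mult_left_mono mult_mono) auto
  also have "\<dots> = (4 * C4) * (BB * P * wt x j)" by simp
  also have "\<dots> \<le> C5 * (BB * P * wt x j)"
    unfolding C5_def using C3_ge BB_ge_1 P wt_nonneg by (intro mult_right_mono) auto
  finally show ?thesis by (simp add: P_def mult_ac)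
next
  case False
  define P where "P = QQ s * qq x powr (gam - \<kappa>)"
  have P: "P \<ge> 0" using QQ_nonneg by (simp add: P_def)
  have gk: "gam - \<kappa> \<ge> 0" unfolding gam_def using kap_pos a_le by linarith
  define y where "y = x - j"
  have y: "int x - int j = int y" "y \<le> n" using j x by (auto simp: y_def)
  have ry: "real (y + 1) = real (x + 1) - real j" using j by (simp add: y_def of_nat_diff)
  define g where "g = (real (x + 1) / (real (x + 1) - real j)) powr gam"
  have g1: "g \<ge> 1" unfolding g_def using j(2) by (rule wt_factor_ge_1)
  have "qq y = qq x * (real (x + 1) / real (y + 1))" by (simp add: qq_def)
  then have "qq y powr (gam - \<kappa>) = qq x powr (gam - \<kappa>) * (real (x + 1) / real (y + 1)) powr (gam - \<kappa>)"
    using qq_ge[OF x] by (simp only: powr_mult)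
  also have "(real (x + 1) / real (y + 1)) powr (gam - \<kappa>) \<le> (real (x + 1) / real (y + 1)) powr gam"
    using kap_pos by (intro powr_mono) (auto simp: y_def)
  also have "\<dots> = g" unfolding g_def ry ..
  finally have qy: "qq y powr (gam - \<kappa>) \<le> qq x powr (gam - \<kappa>) * g"
    by (simp add: mult_left_mono)
  have half: "1 / 2 \<le> (real j / real (x + 1)) powr \<kappa>"
  proof -
    have "1 / 2 = (1 / 2 :: real) powr 1" by simp
    also have "\<dots> \<le> (1 / 2) powr \<kappa>" using kap_le_1 by (intro powr_mono') auto
    also have "\<dots> \<le> (real j / real (x + 1)) powr \<kappa>"
      using False kap_pos by (intro powr_mono2) (auto simp: field_simps)
    finally show ?thesis .
  qed
  then have gw: "g \<le> 2 * wt x j"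
    using mult_right_mono[OF half, of g] g1 by (simp add: wght_def g_def)
  have "cmod (Nz s (int x) - Nz s (int x - int j)) \<le> cmod (Nz s (int x)) + cmod (Nz s (int y))"
    unfolding y(1) by (rule norm_triangle_ineq4)
  also have "\<dots> \<le> C3 * BB * QQ s * qq x powr (gam - \<kappa>) + C3 * BB * QQ s * qq y powr (gam - \<kappa>)"
    by (intro add_mono norm_Nz_le_QQ x s y)
  also have "\<dots> \<le> C3 * BB * QQ s * (qq x powr (gam - \<kappa>) * g) + C3 * BB * QQ s * (qq x powr (gam - \<kappa>) * g)"
    using qy g1 C3_ge BB_ge_1 QQ_nonneg mult_left_mono[OF g1, of "qq x powr (gam - \<kappa>)"]
    by (intro add_mono mult_left_mono) auto
  also have "\<dots> = 2 * C3 * BB * P * g" by (simp add: P_def)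
  also have "\<dots> \<le> 2 * C3 * BB * P * (2 * wt x j)"
    using gw C3_ge BB_ge_1 P by (intro mult_left_mono) auto
  also have "\<dots> = (4 * C3) * (BB * P * wt x j)" by simp
  also have "\<dots> \<le> C5 * (BB * P * wt x j)"
    unfolding C5_def using C4_ge BB_ge_1 P wt_nonneg by (intro mult_right_mono) auto
  finally show ?thesis by (simp add: P_def mult_ac)
qed

lemma C5_ge: "C5 \<ge> C3" unfolding C5_def using C3_ge C4_ge by simp

text \<open>The only way in which the size of the additive function enters the estimates below;
  Hoelder's inequality will provide an \<open>R\<close> of the order of the \<open>p\<close>-th root of \<open>L_sum n ht p\<close>.\<close>

definition rcond :: "(nat \<Rightarrow> real) \<Rightarrow> real \<Rightarrow> bool" where
  "rcond v R \<longleftrightarrow> (\<forall>j. v j \<ge> 0) \<and> R \<ge> 0 \<and> (\<forall>x. 1 \<le> x \<longrightarrow> x \<le> n \<longrightarrow> (\<Sum>j=1..x. v j * wt x j) \<le> R)"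

text \<open>For j > x the shifted coefficient vanishes and |F_x| remains. There the product of
  \<open>qq x powr \<kappa>\<close> with the weight at scale n is at least 1, so the hypothesis on
  \<open>v\<close> at scale n pays for these terms, raising the exponent from \<open>gam\<close> -
  \<kappa> to \<open>gam\<close>.\<close>

lemma sum_diff_all_le:
  assumes R: "rcond v R" and x: "x \<le> n" and s: "0 \<le> s" "s \<le> 1"
  shows "(\<Sum>j=1..n. v j * cmod (Nz s (int x) - Nz s (int x - int j))) \<le> 2 * C5 * BB * QQ s * R * qq x powr gam"
proof (cases "n = 0")
  case True
  have "0 \<le> 2 * C5 * BB * QQ s * R * qq x powr gam"
    using R C5_ge C3_ge BB_ge_1 QQ_nonneg by (auto simp: rcond_def)
  then show ?thesis using True by simp
next
  case False
  define P where "P = C5 * BB * QQ s * qq x powr (gam - \<kappa>)"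
  have P: "P \<ge> 0" using C5_ge C3_ge BB_ge_1 QQ_nonneg by (simp add: P_def)
  have v: "v j \<ge> 0" for j using R by (simp add: rcond_def)
  have q: "qq x \<ge> 1" using x by (rule qq_ge)
  have "(\<Sum>j=1..n. v j * cmod (Nz s (int x) - Nz s (int x - int j)))
     = (\<Sum>j=1..x. v j * cmod (Nz s (int x) - Nz s (int x - int j))) + (\<Sum>j\<in>{x<..n}. v j * cmod (Nz s (int x) - Nz s (int x - int j)))"
    by (rule sum_split_greaterThanAtMost[OF x])
  also have "(\<Sum>j=1..x. v j * cmod (Nz s (int x) - Nz s (int x - int j))) \<le> P * R"
  proof -
    have "(\<Sum>j=1..x. v j * cmod (Nz s (int x) - Nz s (int x - int j))) \<le> (\<Sum>j=1..x. v j * (P * wt x j))"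
      unfolding P_def using v by (intro sum_mono mult_left_mono norm_Nz_diff_le_wt x s) auto
    also have "\<dots> = P * (\<Sum>j=1..x. v j * wt x j)" by (simp add: sum_distrib_left mult_ac)
    also have "\<dots> \<le> P * R" using R x P by (cases "x = 0") (auto simp: rcond_def intro!: mult_left_mono)
    finally show ?thesis .
  qed
  also have "(\<Sum>j\<in>{x<..n}. v j * cmod (Nz s (int x) - Nz s (int x - int j))) \<le> P * (qq x powr \<kappa> * R)"
  proof -
    have "(\<Sum>j\<in>{x<..n}. v j * cmod (Nz s (int x) - Nz s (int x - int j))) \<le> (\<Sum>j\<in>{x<..n}. v j * (P * (qq x powr \<kappa> * wt n j)))"
    proof (intro sum_mono mult_left_mono v)
      fix j assume j: "j \<in> {x<..n}"
      have "cmod (Nz s (int x) - Nz s (int x - int j)) = cmod (Nz s (int x))" using j by simp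
      also have "\<dots> \<le> C3 * BB * QQ s * qq x powr (gam - \<kappa>)" by (rule norm_Nz_le_QQ[OF x s])
      also have "\<dots> \<le> P * 1"
        unfolding P_def mult_1_right using C5_ge BB_ge_1 QQ_nonneg by (intro mult_right_mono) auto
      also have "1 \<le> qq x powr \<kappa> * wt n j"
      proof -
        have "1 \<le> (qq x * (real j / real (n + 1))) powr \<kappa>"
          using j kap_pos by (intro ge_one_powr_ge_zero) (auto simp: qq_def)
        also have "\<dots> = qq x powr \<kappa> * (real j / real (n + 1)) powr \<kappa>"
          by (rule powr_mult)
        also have "\<dots> \<le> qq x powr \<kappa> * wt n j"
          using j by (intro mult_left_mono wt_ge_left) auto
        finally show ?thesis .
      qed
      finally show "cmod (Nz s (int x) - Nz s (int x - int j)) \<le> P * (qq x powr \<kappa> * wt n j)"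
        using P by (simp add: mult_left_mono)
    qed
    also have "\<dots> = P * (qq x powr \<kappa> * (\<Sum>j\<in>{x<..n}. v j * wt n j))" by (simp add: sum_distrib_left mult_ac)
    also have "(\<Sum>j\<in>{x<..n}. v j * wt n j) \<le> (\<Sum>j=1..n. v j * wt n j)"
      using v wt_nonneg by (intro sum_mono2) auto
    also have "\<dots> \<le> R" using R False by (auto simp: rcond_def)
    finally show ?thesis using P by (simp add: mult_left_mono)
  qed
  also have "P * R + P * (qq x powr \<kappa> * R) \<le> P * (qq x powr \<kappa> * R) + P * (qq x powr \<kappa> * R)"
  proof -
    have "1 \<le> qq x powr \<kappa>" using q kap_pos by (intro ge_one_powr_ge_zero) auto
    then have "R \<le> qq x powr \<kappa> * R" using R mult_right_mono[of 1 "qq x powr \<kappa>" R] by (simp add: rcond_def)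
    from mult_left_mono[OF this P] show ?thesis by linarith
  qed
  also have "\<dots> = 2 * C5 * BB * QQ s * R * (qq x powr (gam - \<kappa>) * qq x powr \<kappa>)" by (simp add: P_def)
  also have "qq x powr (gam - \<kappa>) * qq x powr \<kappa> = qq x powr gam" by (simp flip: powr_add)
  finally show ?thesis by simp
qed

text \<open>Now x is comparable with n and only shifts up to k occur. Comparing the weight at scale
  x with the one at scale k extracts the factor (k/n)^\<kappa>, the gain due to the second shift,
  and the hypothesis on \<open>v\<close> is then used at scale k.\<close>

lemma sum_diff_small_le:
  assumes R: "rcond v R" and k: "1 \<le> k" "3 * k \<le> n" and x: "n - k \<le> x" "x \<le> n" and s: "0 \<le> s" "s \<le> 1"
  shows "(\<Sum>j=1..k. v j * cmod (Nz s (int x) - Nz s (int x - int j)))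
     \<le> 24 * C5 * BB * QQ s * R * (real k / real (n + 1)) powr \<kappa>"
proof -
  define P where "P = C5 * BB * QQ s"
  have P: "P \<ge> 0" using C5_ge C3_ge BB_ge_1 QQ_nonneg by (simp add: P_def)
  have v: "v j \<ge> 0" for j using R by (simp add: rcond_def)
  have gk: "gam - \<kappa> \<ge> 0" "gam - \<kappa> \<le> 1" unfolding gam_def using kap_pos a_le kap_le by linarith+
  have q1: "qq x \<ge> 1" using x by (intro qq_ge)
  have q2: "qq x \<le> 2" using k x by (simp add: qq_def divide_le_eq)
  have qp: "qq x powr (gam - \<kappa>) \<le> 2"
    using powr_mono[OF gk(2) q1] q2 q1 by simp
  define E where "E = (real k / real (n + 1)) powr \<kappa>"
  have w: "wt x j \<le> 12 * E * wt k j" if j: "j \<in> {1..k}" for j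
  proof -
    have rj: "real (x + 1) - real j > 0" using j k x by auto
    have "(real (x + 1) / (real (x + 1) - real j)) powr gam \<le> 3 powr gam"
    proof (rule powr_mono2[OF gam_nonneg])
      have "real (x + 1) \<le> 3 * (real (x + 1) - real j)" using j k x by auto
      then show "real (x + 1) / (real (x + 1) - real j) \<le> 3" using rj by (simp add: divide_le_eq)
    qed (use rj in auto)
    also have "\<dots> \<le> 3" using powr_mono[OF gam_le_1, of 3] by simp
    finally have g: "(real (x + 1) / (real (x + 1) - real j)) powr gam \<le> 3" .
    have "real j / real (x + 1) = (real (k + 1) / real (x + 1)) * (real j / real (k + 1))" by simp
    then have "(real j / real (x + 1)) powr \<kappa> = (real (k + 1) / real (x + 1)) powr \<kappa> * (real j / real (k + 1)) powr \<kappa>"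
      by (simp only: powr_mult)
    also have "(real (k + 1) / real (x + 1)) powr \<kappa> \<le> (4 * (real k / real (n + 1))) powr \<kappa>"
    proof (rule powr_mono2)
      have "real (k + 1) * real (n + 1) \<le> (2 * real k) * (2 * real (x + 1))"
        using k x by (intro mult_mono) auto
      then show "real (k + 1) / real (x + 1) \<le> 4 * (real k / real (n + 1))"
        by (simp add: field_simps)
    qed (use kap_pos in auto)
    also have "\<dots> = 4 powr \<kappa> * E" unfolding E_def by (rule powr_mult)
    also have "\<dots> \<le> 4 * E" using powr_kap_le[of 4] by (intro mult_right_mono) (auto simp: E_def)
    finally have "(real j / real (x + 1)) powr \<kappa> \<le> 4 * E * (real j / real (k + 1)) powr \<kappa>"
      by (simp add: mult_right_mono)
    also have "\<dots> \<le> 4 * E * wt k j" using j by (intro mult_left_mono wt_ge_left) (auto simp: E_def)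
    finally have "wt x j \<le> (4 * E * wt k j) * 3"
      unfolding wght_def[of \<kappa> gam x j] using g wt_nonneg by (intro mult_mono) (auto simp: E_def)
    then show ?thesis by simp
  qed
  have "(\<Sum>j=1..k. v j * cmod (Nz s (int x) - Nz s (int x - int j))) \<le> (\<Sum>j=1..k. v j * (24 * P * E * wt k j))"
  proof (intro sum_mono mult_left_mono v)
    fix j assume j: "j \<in> {1..k}"
    have "cmod (Nz s (int x) - Nz s (int x - int j)) \<le> C5 * BB * QQ s * qq x powr (gam - \<kappa>) * wt x j"
      using j k x by (intro norm_Nz_diff_le_wt s) auto
    also have "\<dots> \<le> P * 2 * (12 * E * wt k j)"
      unfolding P_def[symmetric] using qp w[OF j] P wt_nonneg by (intro mult_mono) (auto simp: E_def)
    finally show "cmod (Nz s (int x) - Nz s (int x - int j)) \<le> 24 * P * E * wt k j" by simp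
  qed
  also have "\<dots> = 24 * P * E * (\<Sum>j=1..k. v j * wt k j)" by (simp add: sum_distrib_left mult_ac)
  also have "\<dots> \<le> 24 * P * E * R"
    using R P k by (intro mult_left_mono) (auto simp: rcond_def E_def)
  finally show ?thesis by (simp add: P_def E_def mult_ac)
qed

text \<open>The n-th coefficient of (1 - z^j)(1 - z^k) F. These products arise from the second
  derivative in s, which multiplies F by the square of U(z) - U(1).\<close>

definition SD :: "real \<Rightarrow> nat \<Rightarrow> nat \<Rightarrow> complex" where
  "SD s j k = Nz s (int n - int j - int k) - Nz s (int n - int j) - Nz s (int n - int k) + Nz s (int n)"

lemma SD_sym: "SD s j k = SD s k j" by (simp add: SD_def algebra_simps)

lemma double_sum_sym_le:
  fixes F :: "nat \<Rightarrow> nat \<Rightarrow> real"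
  assumes "\<And>j k. F j k = F k j" "\<And>j k. F j k \<ge> 0"
  shows "(\<Sum>k=1..n. \<Sum>j=1..n. F j k) \<le> 2 * (\<Sum>k=1..n. \<Sum>j=1..k. F j k)"
proof -
  have "(\<Sum>k=1..n. \<Sum>j=1..n. F j k) \<le> (\<Sum>k=1..n. \<Sum>j=1..n. (if j \<le> k then F j k else 0) + (if k \<le> j then F j k else 0))"
    using assms by (intro sum_mono) auto
  also have "\<dots> = (\<Sum>k=1..n. \<Sum>j=1..n. if j \<le> k then F j k else 0) + (\<Sum>k=1..n. \<Sum>j=1..n. if k \<le> j then F j k else 0)"
    by (simp add: sum.distrib)
  also have "(\<Sum>k=1..n. \<Sum>j=1..n. if k \<le> j then F j k else 0) = (\<Sum>j=1..n. \<Sum>k=1..n. if k \<le> j then F k j else 0)"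
    using assms(1) by (subst sum.swap) (intro sum.cong refl, auto)
  also have "(\<Sum>k=1..n. \<Sum>j=1..n. if j \<le> k then F j k else 0) = (\<Sum>k=1..n. \<Sum>j=1..k. F j k)"
    by (intro sum.cong refl sum.mono_neutral_cong_right) auto
  finally show ?thesis by simp
qed

text \<open>By symmetry j may be at most k. \<open>SD\<close> is a difference with step j, taken at
  n and at n - k, and its sum over j is at most a multiple of \<open>R * wt n k\<close>: for 3 k at
  most n through the factor (k/n)^\<kappa>, otherwise through the blow-up
  \<open>qq (n - k) powr gam\<close>. The sum over k then yields a second factor
  \<open>R\<close>.\<close>

lemma second_difference_sum_le:
  assumes R: "rcond v R" and s: "0 \<le> s" "s \<le> 1"
  shows "(\<Sum>k=1..n. \<Sum>j=1..n. v j * v k * cmod (SD s j k)) \<le> 96 * C5 * BB * QQ s * R\<^sup>2"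
proof (cases "n = 0")
  case True
  then show ?thesis using R C5_ge C3_ge BB_ge_1 QQ_nonneg by (simp add: rcond_def)
next
  case False
  define P where "P = C5 * BB * QQ s * R"
  have P: "P \<ge> 0" using C5_ge C3_ge BB_ge_1 QQ_nonneg R by (simp add: P_def rcond_def)
  have v: "v j \<ge> 0" for j using R by (simp add: rcond_def)
  let ?\<Delta> = "\<lambda>x j. cmod (Nz s (int x) - Nz s (int x - int j))"
  have G: "(\<Sum>j=1..k. v j * cmod (SD s j k)) \<le> 48 * P * wt n k" if k: "k \<in> {1..n}" for k
  proof -
    have sd: "cmod (SD s j k) \<le> ?\<Delta> n j + ?\<Delta> (n - k) j" for j
    proof -
      have "SD s j k = (Nz s (int n) - Nz s (int n - int j)) - (Nz s (int (n - k)) - Nz s (int (n - k) - int j))"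
        using k by (simp add: SD_def of_nat_diff algebra_simps del: ecoef_int_of_nat)
      then show ?thesis by (metis norm_triangle_ineq4)
    qed
    have "(\<Sum>j=1..k. v j * cmod (SD s j k)) \<le> (\<Sum>j=1..k. v j * (?\<Delta> n j + ?\<Delta> (n - k) j))"
      using sd v by (intro sum_mono mult_left_mono) auto
    also have "\<dots> = (\<Sum>j=1..k. v j * ?\<Delta> n j) + (\<Sum>j=1..k. v j * ?\<Delta> (n - k) j)"
      by (simp add: distrib_left sum.distrib)
    also have "\<dots> \<le> 48 * P * wt n k"
    proof (cases "3 * k \<le> n")
      case True
      have "(\<Sum>j=1..k. v j * ?\<Delta> n j) + (\<Sum>j=1..k. v j * ?\<Delta> (n - k) j)
        \<le> 24 * C5 * BB * QQ s * R * (real k / real (n + 1)) powr \<kappa> + 24 * C5 * BB * QQ s * R * (real k / real (n + 1)) powr \<kappa>"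
        using k True by (intro add_mono sum_diff_small_le[OF R] s) auto
      also have "\<dots> = 48 * P * (real k / real (n + 1)) powr \<kappa>" by (simp add: P_def)
      also have "\<dots> \<le> 48 * P * wt n k" using P k by (intro mult_left_mono wt_ge_left) auto
      finally show ?thesis .
    next
      case False
      define g where "g = (real (n + 1) / (real (n + 1) - real k)) powr gam"
      have g1: "g \<ge> 1" unfolding g_def using k by (intro wt_factor_ge_1) auto
      have ext: "(\<Sum>j=1..k. v j * ?\<Delta> x j) \<le> (\<Sum>j=1..n. v j * ?\<Delta> x j)" for x
        using k v by (intro sum_mono2) auto
      have q: "qq n powr gam = 1" "qq (n - k) powr gam = g"
        using k by (simp_all add: qq_def g_def of_nat_diff algebra_simps)
      have "(\<Sum>j=1..k. v j * ?\<Delta> n j) + (\<Sum>j=1..k. v j * ?\<Delta> (n - k) j)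
        \<le> 2 * C5 * BB * QQ s * R * qq n powr gam + 2 * C5 * BB * QQ s * R * qq (n - k) powr gam"
        by (intro add_mono order_trans[OF ext] sum_diff_all_le[OF R] s) auto
      also have "\<dots> = 2 * P * 1 + 2 * P * g" by (simp add: q P_def)
      also have "\<dots> \<le> 2 * P * g + 2 * P * g" using g1 P by (intro add_mono mult_left_mono) auto
      also have "\<dots> = 4 * P * g" by simp
      also have "\<dots> \<le> 4 * P * (3 * wt n k)"
      proof (intro mult_left_mono)
        have "1 / 3 = (1 / 3 :: real) powr 1" by simp
        also have "\<dots> \<le> (1 / 3) powr \<kappa>" using kap_le_1 by (intro powr_mono') auto
        also have "\<dots> \<le> (real k / real (n + 1)) powr \<kappa>"
          using False kap_pos by (intro powr_mono2) (auto simp: field_simps)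
        finally have "1 / 3 * g \<le> (real k / real (n + 1)) powr \<kappa> * g" using g1 by (intro mult_right_mono) auto
        then show "g \<le> 3 * wt n k" by (simp add: wght_def g_def)
      qed (use P in auto)
      also have "\<dots> \<le> 48 * P * wt n k" using P wt_nonneg by (simp add: mult_right_mono)
      finally show ?thesis .
    qed
    finally show ?thesis .
  qed
  have "(\<Sum>k=1..n. \<Sum>j=1..n. v j * v k * cmod (SD s j k)) \<le> 2 * (\<Sum>k=1..n. \<Sum>j=1..k. v j * v k * cmod (SD s j k))"
    using v by (intro double_sum_sym_le) (auto simp: SD_sym mult_ac)
  also have "(\<Sum>k=1..n. \<Sum>j=1..k. v j * v k * cmod (SD s j k)) = (\<Sum>k=1..n. v k * (\<Sum>j=1..k. v j * cmod (SD s j k)))"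
    by (simp add: sum_distrib_left mult_ac)
  also have "\<dots> \<le> (\<Sum>k=1..n. v k * (48 * P * wt n k))"
    using G v by (intro sum_mono mult_left_mono) auto
  also have "\<dots> = 48 * P * (\<Sum>k=1..n. v k * wt n k)" by (simp add: sum_distrib_left mult_ac)
  also have "\<dots> \<le> 48 * P * R" using R P False by (intro mult_left_mono) (auto simp: rcond_def)
  finally show ?thesis by (simp add: P_def power2_eq_square mult_ac)
qed

end

section \<open>Differentiation in s and Taylor expansion\<close>

context tilted
begin

definition uu :: "nat \<Rightarrow> complex" where "uu j = of_real (d j) * (f j - 1) / of_nat j"
definition UU :: complex where "UU = (\<Sum>j=1..n. uu j)"

text \<open>Coefficientwise form of the fact that the derivative of P exp (s U) in s is U P exp (s
  U). Induction through the recursion: differentiating c_j gives weight i to the i-th term,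
  differentiating the earlier coefficients gives weight m - i, and the weights add up to m.\<close>

lemma ecoef_int_cs_deriv:
  assumes "i \<le> int n"
  shows "((\<lambda>s. ecoef_int (cs s) i) has_field_derivative (\<Sum>j=1..n. uu j * ecoef_int (cs s) (i - int j))) (at s within A)"
proof -
  have main: "((\<lambda>s. ecoef (cs s) m) has_field_derivative (\<Sum>j=1..n. uu j * ecoef_int (cs s) (int m - int j))) (at s within A)"
    if "m \<le> n" for m
    using that
  proof (induction m rule: less_induct)
    case (less m)
    show ?case
    proof (cases "m = 0")
      case True
      then show ?thesis by simp
    next
      case False
      define w where "w j = of_real (d j) * (f j - 1)" for j
      have w: "w j = of_nat j * uu j" if "j \<ge> 1" for j using that by (simp add: w_def uu_def)
      have dcs: "((\<lambda>s. cs s j) has_field_derivative w j) (at s within A)" for j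
        unfolding cs_def w_def by (auto intro!: derivative_eq_intros)
      have eq: "(\<lambda>s. ecoef (cs s) m) = (\<lambda>s. (\<Sum>j=1..m. cs s j * ecoef (cs s) (m - j)) / of_nat m)"
        by (subst ecoef.simps) (use False in simp)
      have D: "((\<lambda>s. (\<Sum>j=1..m. cs s j * ecoef (cs s) (m - j)) / of_nat m) has_field_derivative
         (\<Sum>j=1..m. w j * ecoef (cs s) (m - j)
            + (\<Sum>i=1..n. uu i * ecoef_int (cs s) (int (m - j) - int i)) * cs s j) / of_nat m) (at s within A)"
        using False less.prems by (intro DERIV_cdivide DERIV_sum DERIV_mult dcs less.IH) auto
      have t1: "(\<Sum>j=1..m. w j * ecoef (cs s) (m - j)) = (\<Sum>i=1..n. of_nat i * (uu i * ecoef_int (cs s) (int m - int i)))"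
      proof (rule sum.mono_neutral_cong_left)
        show "\<forall>i\<in>{1..n} - {1..m}. of_nat i * (uu i * ecoef_int (cs s) (int m - int i)) = 0"
        proof
          fix i assume "i \<in> {1..n} - {1..m}"
          then have "int m - int i < 0" by auto
          then show "of_nat i * (uu i * ecoef_int (cs s) (int m - int i)) = 0" by simp
        qed
        fix j assume j: "j \<in> {1..m}"
        then have "int m - int j = int (m - j)" by auto
        then have "ecoef_int (cs s) (int m - int j) = ecoef (cs s) (m - j)" by (simp only: ecoef_int_of_nat)
        then show "w j * ecoef (cs s) (m - j) = of_nat j * (uu j * ecoef_int (cs s) (int m - int j))"
          using j by (simp add: w)
      qed (use less.prems in auto)
      have t2: "(\<Sum>j=1..m. (\<Sum>i=1..n. uu i * ecoef_int (cs s) (int (m - j) - int i)) * cs s j)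
         = (\<Sum>i=1..n. uu i * (of_int (int m - int i) * ecoef_int (cs s) (int m - int i)))"
      proof -
        have "(\<Sum>j=1..m. (\<Sum>i=1..n. uu i * ecoef_int (cs s) (int (m - j) - int i)) * cs s j)
          = (\<Sum>j=1..m. \<Sum>i=1..n. uu i * (cs s j * ecoef_int (cs s) ((int m - int i) - int j)))"
          unfolding sum_distrib_right
        proof (intro sum.cong refl)
          fix j i assume "j \<in> {1..m}"
          then have "int (m - j) - int i = (int m - int i) - int j" by auto
          then show "uu i * ecoef_int (cs s) (int (m - j) - int i) * cs s j
             = uu i * (cs s j * ecoef_int (cs s) ((int m - int i) - int j))" by (simp only: mult_ac)
        qed
        also have "\<dots> = (\<Sum>i=1..n. uu i * (\<Sum>j=1..m. cs s j * ecoef_int (cs s) ((int m - int i) - int j)))"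
          unfolding sum_distrib_left by (rule sum.swap)
        also have "\<dots> = (\<Sum>i=1..n. uu i * (of_int (int m - int i) * ecoef_int (cs s) (int m - int i)))"
          by (intro sum.cong refl arg_cong2[where f="(*)"] ecoef_int_rec[symmetric]) simp
        finally show ?thesis .
      qed
      have t3: "(\<Sum>j=1..m. w j * ecoef (cs s) (m - j) + (\<Sum>i=1..n. uu i * ecoef_int (cs s) (int (m - j) - int i)) * cs s j)
        = of_nat m * (\<Sum>i=1..n. uu i * ecoef_int (cs s) (int m - int i))"
        unfolding sum.distrib t1 t2 unfolding sum.distrib[symmetric] sum_distrib_left
        by (intro sum.cong refl) (simp add: algebra_simps)
      show ?thesis unfolding eq using D[unfolded t3] False by simp
    qed
  qed
  show ?thesis
  proof (cases "i < 0")
    case True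
    then show ?thesis by simp
  next
    case False
    then obtain m where m: "i = int m" "m \<le> n" using assms by (metis nonneg_int_cases not_le of_nat_le_iff)
    show ?thesis unfolding m(1) ecoef_int_of_nat by (rule main[OF m(2)])
  qed
qed

lemma Re_UU: "Re UU = - (\<Sum>j=1..n. d j * (cmod (1 - f j))\<^sup>2 / (2 * real j))"
  unfolding UU_def Re_sum sum_negf[symmetric]
proof (rule sum.cong[OF refl])
  fix j
  have "(Re (f j))\<^sup>2 + (Im (f j))\<^sup>2 = 1" using f_unit[of j] cmod_power2[of "f j"] by simp
  moreover have "(cmod (1 - f j))\<^sup>2 = (1 - Re (f j))\<^sup>2 + (Im (f j))\<^sup>2" by (simp add: cmod_power2)
  ultimately have sq: "(cmod (1 - f j))\<^sup>2 = 2 * (1 - Re (f j))" by (simp add: power2_eq_square algebra_simps)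
  have e: "d j * (cmod (1 - f j))\<^sup>2 / (2 * real j) = d j * (1 - Re (f j)) / real j"
    unfolding sq by (cases "j = 0") (simp_all add: field_simps)
  show "Re (uu j) = - (d j * (cmod (1 - f j))\<^sup>2 / (2 * real j))"
    unfolding e by (cases "j = 0") (simp_all add: uu_def Re_divide_of_nat field_simps)
qed

text \<open>\<open>psi s n\<close> contains only the share s of the exponent \<kappa>
  \<open>Tf n\<close>. The factor exp ((1 - s) UU) supplies the rest, so the bound for the second
  derivative is uniform in s.\<close>

lemma Re_UU_le: "Re UU \<le> - \<kappa> * Tf n"
proof -
  have "\<kappa> * Tf n \<le> (\<Sum>j=1..n. d j * (cmod (1 - f j))\<^sup>2 / (2 * real j))"
    unfolding Tf_def sum_distrib_left
  proof (rule sum_mono)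
    fix j assume "j \<in> {1..n}"
    then have "2 * \<kappa> \<le> d j" using d_bounds[of j] kap_le kap_pos by auto
    then have "2 * \<kappa> * ((cmod (1 - f j))\<^sup>2 / (2 * real j)) \<le> d j * ((cmod (1 - f j))\<^sup>2 / (2 * real j))"
      by (intro mult_right_mono) auto
    then show "\<kappa> * ((cmod (1 - f j))\<^sup>2 / real j) \<le> d j * (cmod (1 - f j))\<^sup>2 / (2 * real j)" by simp
  qed
  then show ?thesis by (simp add: Re_UU)
qed

theorem ecoef_expansion:
  assumes R: "rcond (\<lambda>j. cmod (uu j)) R"
  shows "cmod (ecoef (\<lambda>j. of_real (d j) * f j) n
           - exp UU * (ecoef (\<lambda>j. of_real (d j)) n
               + (\<Sum>j=1..n. uu j * (ecoef (\<lambda>j. of_real (d j)) (n - j) - ecoef (\<lambda>j. of_real (d j)) n))))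
      \<le> 96 * C5 * BB * R\<^sup>2 * (exp (Lam n - \<kappa> * Tf n) / real (n + 1))"
proof -
  define E where "E z = exp ((1 - z) * UU)" for z
  let ?N = "\<lambda>z. ecoef_int (cs z)"
  \<comment> \<open>\<open>F i\<close> is the i-th derivative of the n-th coefficient multiplied by
    \<open>E\<close>. The derivative of \<open>E\<close> brings in -UU, which replaces each z^j by
    z^j - 1; hence differences appear.\<close>
  define F where "F i z = (if i = 0 then E z * ?N z (int n)
     else if i = Suc 0 then E z * (\<Sum>j=1..n. uu j * (?N z (int n - int j) - ?N z (int n)))
     else E z * (\<Sum>k=1..n. \<Sum>j=1..n. uu j * uu k * (?N z (int n - int j - int k) - ?N z (int n - int j) - ?N z (int n - int k) + ?N z (int n))))"
    for i :: nat and z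
  define B where "B = 96 * C5 * BB * R\<^sup>2 * (exp (Lam n - \<kappa> * Tf n) / real (n + 1))"
  have dE: "(E has_field_derivative (- UU) * E z) (at z within A)" for z A
    unfolding E_def by (auto intro!: derivative_eq_intros)
  note dN = ecoef_int_cs_deriv
  have Un: "UU * g = (\<Sum>k=1..n. uu k * g)" for g by (simp add: UU_def sum_distrib_right)
  have d0: "(F 0 has_field_derivative F (Suc 0) z) (at z within A)" for z A
  proof -
    have *: "((\<lambda>z. E z * ?N z (int n)) has_field_derivative
        (- UU) * E z * ?N z (int n) + (\<Sum>j=1..n. uu j * ?N z (int n - int j)) * E z) (at z within A)"
      by (intro DERIV_mult dE dN) simp
    have "(- UU) * E z * ?N z (int n) + (\<Sum>j=1..n. uu j * ?N z (int n - int j)) * E z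
      = E z * ((\<Sum>j=1..n. uu j * ?N z (int n - int j)) - UU * ?N z (int n))" by (simp add: algebra_simps)
    also have "\<dots> = F (Suc 0) z" unfolding Un F_def by (simp add: right_diff_distrib sum_subtractf)
    finally have **: "(- UU) * E z * ?N z (int n) + (\<Sum>j=1..n. uu j * ?N z (int n - int j)) * E z = F (Suc 0) z" .
    have "F 0 = (\<lambda>z. E z * ?N z (int n))" by (simp add: F_def fun_eq_iff)
    then show ?thesis using *[unfolded **] by simp
  qed
  have d1: "(F (Suc 0) has_field_derivative F (Suc (Suc 0)) z) (at z within A)" for z A
  proof -
    define G where "G z = (\<Sum>j=1..n. uu j * (?N z (int n - int j) - ?N z (int n)))" for z
    define G' where "G' = (\<Sum>j=1..n. uu j * ((\<Sum>k=1..n. uu k * ?N z (int n - int j - int k)) - (\<Sum>k=1..n. uu k * ?N z (int n - int k))))"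
    have "(G has_field_derivative G') (at z within A)"
      unfolding G_def G'_def by (intro DERIV_sum DERIV_cmult DERIV_diff dN) auto
    then have *: "((\<lambda>z. E z * G z) has_field_derivative (- UU) * E z * G z + G' * E z) (at z within A)"
      by (intro DERIV_mult dE)
    have "(- UU) * E z * G z + G' * E z = E z * (G' - UU * G z)" by (simp add: algebra_simps)
    also have "G' - UU * G z = (\<Sum>k=1..n. \<Sum>j=1..n. uu j * uu k * (?N z (int n - int j - int k) - ?N z (int n - int j) - ?N z (int n - int k) + ?N z (int n)))"
    proof -
      have g1: "G' = (\<Sum>k=1..n. \<Sum>j=1..n. uu j * uu k * (?N z (int n - int j - int k) - ?N z (int n - int k)))"
        unfolding G'_def sum_subtractf[symmetric] sum_distrib_left
        by (subst sum.swap) (simp add: algebra_simps)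
      have g2: "UU * G z = (\<Sum>k=1..n. \<Sum>j=1..n. uu j * uu k * (?N z (int n - int j) - ?N z (int n)))"
        unfolding Un unfolding G_def sum_distrib_left by (intro sum.cong refl) (simp only: mult_ac)
      show ?thesis
        unfolding g1 g2 sum_subtractf[symmetric] by (intro sum.cong refl) (simp add: algebra_simps)
    qed
    also have "E z * \<dots> = F (Suc (Suc 0)) z" by (simp only: F_def) simp
    finally have **: "(- UU) * E z * G z + G' * E z = F (Suc (Suc 0)) z" .
    have "F (Suc 0) = (\<lambda>z. E z * G z)" by (simp add: F_def G_def fun_eq_iff)
    then show ?thesis using *[unfolded **] by simp
  qed
  have bound: "cmod (F (Suc (Suc 0)) z) \<le> B" if z: "z \<in> closed_segment 0 1" for z
  proof -
    obtain s where s: "z = of_real s" "0 \<le> s" "s \<le> 1"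
      using z by (auto simp: closed_segment_def scaleR_conv_of_real)
    have QE: "QQ s * exp ((1 - s) * Re UU) \<le> exp (Lam n - \<kappa> * Tf n) / real (n + 1)"
    proof -
      have "(1 - s) * Re UU \<le> (1 - s) * (- \<kappa> * Tf n)"
        using Re_UU_le s by (intro mult_left_mono) auto
      then have "Lam n - \<kappa> * s * Tf n + (1 - s) * Re UU \<le> Lam n - \<kappa> * Tf n"
        by (simp add: algebra_simps)
      then have "exp (Lam n - \<kappa> * s * Tf n) * exp ((1 - s) * Re UU) \<le> exp (Lam n - \<kappa> * Tf n)"
        unfolding mult_exp_exp by simp
      then show ?thesis unfolding QQ_def psi_def by (simp add: divide_right_mono)
    qed
    have "cmod (\<Sum>k=1..n. \<Sum>j=1..n. uu j * uu k * SD s j k) \<le> (\<Sum>k=1..n. \<Sum>j=1..n. cmod (uu j) * cmod (uu k) * cmod (SD s j k))"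
      by (intro sum_norm_le) (auto simp: norm_mult)
    also have "\<dots> \<le> 96 * C5 * BB * QQ s * R\<^sup>2"
      by (rule second_difference_sum_le[OF R s(2,3)])
    finally have S: "cmod (\<Sum>k=1..n. \<Sum>j=1..n. uu j * uu k * SD s j k) \<le> 96 * C5 * BB * QQ s * R\<^sup>2" .
    have "F (Suc (Suc 0)) z = E z * (\<Sum>k=1..n. \<Sum>j=1..n. uu j * uu k * SD s j k)"
      by (simp add: F_def SD_def s)
    then have "cmod (F (Suc (Suc 0)) z) = cmod (E z) * cmod (\<Sum>k=1..n. \<Sum>j=1..n. uu j * uu k * SD s j k)"
      by (simp only: norm_mult)
    also have "\<dots> \<le> cmod (E z) * (96 * C5 * BB * QQ s * R\<^sup>2)"
      using S by (rule mult_left_mono) simp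
    also have "cmod (E z) = exp ((1 - s) * Re UU)"
      by (simp add: E_def s)
    also have "exp ((1 - s) * Re UU) * (96 * C5 * BB * QQ s * R\<^sup>2) = 96 * C5 * BB * R\<^sup>2 * (QQ s * exp ((1 - s) * Re UU))"
      by (simp only: mult_ac)
    also have "\<dots> \<le> B" unfolding B_def
      using QE C5_ge C3_ge BB_ge_1 by (intro mult_left_mono) auto
    finally show ?thesis .
  qed
  have "cmod (F 0 1 - (\<Sum>i\<le>1. F i 0 * (1 - 0) ^ i / fact i)) \<le> B * cmod (1 - 0 :: complex) ^ Suc 1 / fact 1"
  proof (rule complex_Taylor[where S="closed_segment 0 1"])
    fix i :: nat and x :: complex assume "i \<le> 1"
    then show "(F i has_field_derivative F (Suc i) x) (at x within closed_segment 0 1)"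
      using d0 d1 by (cases i) auto
  qed (use bound in auto)
  then have T: "cmod (F 0 1 - (F 0 0 + F (Suc 0) 0)) \<le> B" by simp
  have c0: "cs 0 = (\<lambda>j. of_real (d j))" and c1: "cs 1 = (\<lambda>j. of_real (d j) * f j)"
    by (auto simp: cs_def)
  have "F 0 1 = ecoef (\<lambda>j. of_real (d j) * f j) n"
    by (simp add: F_def E_def c1)
  moreover have "F 0 0 + F (Suc 0) 0 = exp UU * (ecoef (\<lambda>j. of_real (d j)) n
               + (\<Sum>j=1..n. uu j * (ecoef (\<lambda>j. of_real (d j)) (n - j) - ecoef (\<lambda>j. of_real (d j)) n)))"
  proof -
    have "ecoef_int (cs 0) (int n - int j) = ecoef (\<lambda>j. of_real (d j)) (n - j)" if "j \<in> {1..n}" for j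
      using that unfolding c0 by (simp add: ecoef_int_def nat_diff_distrib)
    then show ?thesis by (simp add: F_def E_def c0 distrib_left)
  qed
  ultimately show ?thesis using T unfolding B_def by simp
qed

end

section \<open>A lower bound for the total weight\<close>

lemma p_avg_0 [simp]: "p_avg d 0 = 1"
  using p_avg_eq_ecoef[of d 0] by (metis ecoef_0 of_real_eq_1_iff)

lemma p_avg_rec: "real m * p_avg d m = (if m = 0 then 0 else (\<Sum>j=1..m. d j * p_avg d (m - j)))"
proof -
  have "complex_of_real (real m * p_avg d m) = of_nat m * ecoef (\<lambda>j. complex_of_real (d j)) m"
    by (simp add: p_avg_eq_ecoef)
  also have "\<dots> = complex_of_real (if m = 0 then 0 else (\<Sum>j=1..m. d j * p_avg d (m - j)))"
    unfolding ecoef_rec by (simp add: p_avg_eq_ecoef)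
  finally show ?thesis by (simp only: of_real_eq_iff)
qed

lemma p_avg_nonneg:
  assumes "\<And>j. 1 \<le> j \<Longrightarrow> j \<le> m \<Longrightarrow> 0 \<le> d j"
  shows "0 \<le> p_avg d m"
  using assms
proof (induction m rule: less_induct)
  case (less m)
  show ?case
  proof (cases "m = 0")
    case False
    have "0 \<le> real m * p_avg d m"
      unfolding p_avg_rec using False less by (auto intro!: sum_nonneg mult_nonneg_nonneg)
    then show ?thesis using False by (simp add: zero_le_mult_iff)
  qed simp
qed

lemma p_avg_mono:
  assumes "\<And>j. 1 \<le> j \<Longrightarrow> j \<le> m \<Longrightarrow> 0 \<le> d j \<and> d j \<le> d' j"
  shows "p_avg d m \<le> p_avg d' m"
  using assms
proof (induction m rule: less_induct)
  case (less m)
  show ?case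
  proof (cases "m = 0")
    case False
    have "real m * p_avg d m \<le> real m * p_avg d' m"
      unfolding p_avg_rec using False
    proof (simp, intro sum_mono mult_mono)
      fix j assume j: "j \<in> {Suc 0..m}"
      show "d j \<le> d' j" "0 \<le> d' j" using less.prems[of j] j by auto
      show "p_avg d (m - j) \<le> p_avg d' (m - j)" using j less.prems by (intro less.IH) auto
      show "0 \<le> p_avg d (m - j)" using less.prems by (intro p_avg_nonneg) auto
    qed
    then show ?thesis using False by simp
  qed simp
qed

lemma exp_sum_sums_p_avg:
  "(\<lambda>l. p_avg (\<lambda>j. if j \<le> x then d j else 0) l) sums exp (\<Sum>j=1..x. d j / real j)"
proof -
  have "(\<lambda>l. ecoef (\<lambda>j. if j \<le> x then complex_of_real (d j) else 0) l * 1 ^ l) sums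
      exp (\<Sum>j=1..x. complex_of_real (d j) * 1 ^ j / of_nat j)"
    by (rule exp_sum_sums_ecoef)
  also have "(\<lambda>j. if j \<le> x then complex_of_real (d j) else 0) = (\<lambda>j. complex_of_real (if j \<le> x then d j else 0))"
    by auto
  also have "exp (\<Sum>j=1..x. complex_of_real (d j) * 1 ^ j / of_nat j) = complex_of_real (exp (\<Sum>j=1..x. d j / real j))"
    by (simp add: exp_of_real[symmetric])
  finally show ?thesis by (simp add: p_avg_eq_ecoef[symmetric] sums_of_real_iff)
qed

text \<open>Markov's inequality: the weights \<open>e l\<close> below have total mass \<open>exp (\<Sum>j\<le>x. d j / j)\<close>
  and mean at most \<open>D * x\<close>, so half of the mass lies on \<open>l \<le> 2 * D * x\<close>.\<close>

lemma p_avg_lower_bound: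
  assumes a: "0 < a" and d: "\<And>j. 1 \<le> j \<Longrightarrow> j \<le> n \<Longrightarrow> a \<le> d j \<and> d j \<le> D" and D: "1 \<le> D"
    and L: "2 * D \<le> real L" and n: "n \<ge> 1"
  shows "a / 2 * exp (- (D * real L)) * (exp (\<Sum>j=1..n. d j / real j) / real n) \<le> p_avg d n"
proof -
  define M where "M = n - 1"
  \<comment> \<open>The weights are truncated at this x, so that l has mean at most D x under
    \<open>e\<close>. As L is at least 2 D, the mean is at most n/2, and at least half of the mass
    lies on l < n.\<close>
  define x where "x = M div L"
  define e where "e = p_avg (\<lambda>j. if j \<le> x then d j else 0)"
  define tot where "tot = exp (\<Sum>j=1..x. d j / real j)"
  have L0: "L > 0" using L D by (cases L) auto
  have xM: "x * L \<le> M" unfolding x_def by simp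
  have Mx: "n \<le> (x + 1) * L"
    using L0 n by (auto simp: x_def M_def) (metis Suc_pred add.commute dividend_less_div_times less_eq_Suc_le mult.commute n not_less_eq_eq One_nat_def mult_Suc)
  have xle: "x \<le> M" using xM L0 by (metis div_le_dividend x_def)
  have xn: "x < n" using xle n by (simp add: M_def)
  have d0: "0 \<le> d j" if "1 \<le> j" "j \<le> n" for j using d[OF that] a by linarith
  have e0: "e l \<ge> 0" for l unfolding e_def using d0 xn by (intro p_avg_nonneg) auto
  have es: "e sums tot" unfolding e_def tot_def by (rule exp_sum_sums_p_avg)
  have part: "(\<Sum>l\<le>m. e l) \<le> tot" for m
    using sum_le_suminf[OF sums_summable[OF es], of "{..m}"] e0 sums_unique[OF es] by simp
  have mean: "(\<Sum>l\<le>m. real l * e l) \<le> real x * D * tot" for m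
  proof -
    have "(\<Sum>l\<le>m. real l * e l) = (\<Sum>l\<le>m. \<Sum>j=1..x. if j \<le> l then d j * e (l - j) else 0)"
    proof (rule sum.cong[OF refl])
      fix l
      have "real l * e l = (\<Sum>j=1..l. (if j \<le> x then d j else 0) * e (l - j))"
        unfolding e_def p_avg_rec by simp
      also have "\<dots> = (\<Sum>j=1..x. if j \<le> l then d j * e (l - j) else 0)"
        by (rule sum.mono_neutral_cong) auto
      finally show "real l * e l = (\<Sum>j=1..x. if j \<le> l then d j * e (l - j) else 0)" .
    qed
    also have "\<dots> = (\<Sum>j=1..x. \<Sum>l\<le>m. if j \<le> l then d j * e (l - j) else 0)" by (rule sum.swap)
    also have "\<dots> \<le> (\<Sum>j=1..x. D * tot)"
    proof (rule sum_mono)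
      fix j assume j: "j \<in> {1..x}"
      have "(\<Sum>l\<le>m. if j \<le> l then d j * e (l - j) else 0) = d j * (\<Sum>l\<in>{j..m}. e (l - j))"
        unfolding sum_distrib_left by (rule sum.mono_neutral_cong_right) auto
      also have "(\<Sum>l\<in>{j..m}. e (l - j)) = (\<Sum>l\<in>(\<lambda>l. l - j) ` {j..m}. e l)"
        by (subst sum.reindex) (auto simp: inj_on_def)
      also have "\<dots> \<le> (\<Sum>l\<le>m. e l)" using e0 by (intro sum_mono2) auto
      also have "\<dots> \<le> tot" by (rule part)
      finally have "(\<Sum>l\<le>m. if j \<le> l then d j * e (l - j) else 0) \<le> d j * tot"
        using d0[of j] j xn by (simp add: mult_left_mono)
      also have "\<dots> \<le> D * tot" using d[of j] j xn by (intro mult_right_mono) (auto simp: tot_def)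
      finally show "(\<Sum>l\<le>m. if j \<le> l then d j * e (l - j) else 0) \<le> D * tot" .
    qed
    finally show ?thesis by simp
  qed
  have half: "tot / 2 \<le> (\<Sum>l\<le>M. e l)"
  proof -
    have "real n * ((\<Sum>l\<le>m. e l) - (\<Sum>l\<le>M. e l)) \<le> real x * D * tot" if m: "m \<ge> M" for m
    proof -
      have "{..m} = {..M} \<union> {M<..m}" using m by auto
      then have "(\<Sum>l\<le>m. e l) = (\<Sum>l\<le>M. e l) + (\<Sum>l\<in>{M<..m}. e l)"
        by (simp only:) (rule sum.union_disjoint; auto)
      then have "real n * ((\<Sum>l\<le>m. e l) - (\<Sum>l\<le>M. e l)) = (\<Sum>l\<in>{M<..m}. real n * e l)"
        by (simp add: sum_distrib_left)
      also have "\<dots> \<le> (\<Sum>l\<in>{M<..m}. real l * e l)"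
        using e0 n by (intro sum_mono mult_right_mono) (auto simp: M_def)
      also have "\<dots> \<le> (\<Sum>l\<le>m. real l * e l)" using e0 by (intro sum_mono2) auto
      finally show ?thesis using mean[of m] by linarith
    qed
    moreover have "(\<lambda>m. real n * ((\<Sum>l\<le>m. e l) - (\<Sum>l\<le>M. e l))) \<longlonglongrightarrow> real n * (tot - (\<Sum>l\<le>M. e l))"
      using es unfolding sums_def_le by (intro tendsto_intros)
    ultimately have "real n * (tot - (\<Sum>l\<le>M. e l)) \<le> real x * D * tot"
      by (intro LIMSEQ_le_const2) auto
    also have "real x * D * tot \<le> real n / 2 * tot"
    proof (rule mult_right_mono)
      have "real x * (2 * D) \<le> real x * real L" using L by (intro mult_left_mono) auto
      also have "\<dots> \<le> real n" using xM n unfolding M_def by (metis diff_le_self le_trans of_nat_le_iff of_nat_mult)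
      finally show "real x * D \<le> real n / 2" by simp
    qed (simp add: tot_def)
    finally have "real n * (tot - (\<Sum>l\<le>M. e l)) \<le> real n * (tot / 2)" by simp
    then have "tot - (\<Sum>l\<le>M. e l) \<le> tot / 2" using n by (subst (asm) mult_le_cancel_left_pos) auto
    then show ?thesis by simp
  qed
  \<comment> \<open>Truncation costs only a constant: n - x is at most (x + 1) L, and each omitted
    term is at most D / (x + 1).\<close>
  have "exp (\<Sum>j=1..n. d j / real j) \<le> tot * exp (D * real L)"
  proof -
    have "{1..n} = {1..x} \<union> {x<..n}" using xn by auto
    then have "(\<Sum>j=1..n. d j / real j) = (\<Sum>j=1..x. d j / real j) + (\<Sum>j\<in>{x<..n}. d j / real j)"
      by (simp only:) (rule sum.union_disjoint; auto)
    also have "(\<Sum>j\<in>{x<..n}. d j / real j) \<le> (\<Sum>j\<in>{x<..n}. D / real (x + 1))"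
      using d d0 D by (intro sum_mono frac_le) auto
    also have "\<dots> = real (n - x) * (D / real (x + 1))" by simp
    also have "\<dots> \<le> (real (x + 1) * real L) * (D / real (x + 1))"
    proof (rule mult_right_mono)
      have "n - x \<le> (x + 1) * L" using Mx by linarith
      then show "real (n - x) \<le> real (x + 1) * real L" by (metis of_nat_le_iff of_nat_mult)
    qed (use D in auto)
    also have "\<dots> = D * real L" by simp
    finally show ?thesis unfolding tot_def mult_exp_exp by simp
  qed
  then have t: "exp (\<Sum>j=1..n. d j / real j) * exp (- (D * real L)) \<le> tot"
    by (simp add: exp_minus field_simps)
  have "a / 2 * exp (- (D * real L)) * exp (\<Sum>j=1..n. d j / real j) \<le> a / 2 * tot"
    using t a by (simp add: mult_ac)
  \<comment> \<open>The recursion expresses n p_n as the sum of the d_j p_{n-j}, which is at least a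
    times the sum of all p_l with l < n; and p_l dominates its truncated version
    \<open>e l\<close>.\<close>
  also have "\<dots> \<le> a * (\<Sum>l\<le>M. e l)" using half a by simp
  also have "\<dots> \<le> a * (\<Sum>l\<le>M. p_avg d l)"
  proof (intro mult_left_mono sum_mono)
    fix l assume "l \<in> {..M}"
    then show "e l \<le> p_avg d l" unfolding e_def using d0 xn
      by (intro p_avg_mono) (auto simp: M_def)
  qed (use a in auto)
  also have "(\<Sum>l\<le>M. p_avg d l) = (\<Sum>j=1..n. p_avg d (n - j))"
    by (rule sum.reindex_bij_witness[where i="\<lambda>j. n - j" and j="\<lambda>l. n - l"]) (use n in \<open>auto simp: M_def\<close>)
  also have "a * \<dots> \<le> (\<Sum>j=1..n. d j * p_avg d (n - j))"
    unfolding sum_distrib_left using d d0 by (intro sum_mono mult_right_mono p_avg_nonneg) auto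
  also have "\<dots> = real n * p_avg d n" using n by (simp add: p_avg_rec)
  finally show ?thesis using n by (simp add: field_simps)
qed

section \<open>Esseen's smoothing inequality\<close>

lemma integral_deriv_lessThan:
  fixes f F :: "real \<Rightarrow> real"
  assumes F: "\<And>u. (F has_real_derivative f u) (at u)" and f: "\<And>u. isCont f u"
    and int: "integrable lborel f" and lim: "(F \<longlongrightarrow> 0) at_bot"
  shows "(LINT u|lborel. indicator {..<x} u * f u) = F x"
proof -
  have "(LBINT u=-\<infinity>..ereal x. f u) = F x - 0"
  proof (rule interval_integral_FTC_integrable)
    have "integrable lborel (\<lambda>u. indicator {..<x} u *\<^sub>R f u)"
      by (rule integrable_mult_indicator[OF _ int]) simp
    moreover have "einterval (-\<infinity>) (ereal x) = {..<x}" by (auto simp: einterval_def)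
    ultimately show "set_integrable lborel (einterval (-\<infinity>) (ereal x)) f" by (simp add: set_integrable_def)
    show "((F \<circ> real_of_ereal) \<longlongrightarrow> 0) (at_right (-\<infinity>))"
      using lim by (simp add: ereal_tendsto_simps1)
    have "(F \<longlongrightarrow> F x) (at_left x)"
      using DERIV_isCont[OF F[of x]] by (auto simp: isCont_def intro: filterlim_mono at_le)
    then show "((F \<circ> real_of_ereal) \<longlongrightarrow> F x) (at_left (ereal x))"
      by (simp add: ereal_tendsto_simps1)
  qed (use F f in \<open>auto simp: has_real_derivative_iff_has_vector_derivative\<close>)
  moreover have "einterval (-\<infinity>) (ereal x) = {..<x}" by (auto simp: einterval_def)
  ultimately show ?thesis
    by (simp add: interval_lebesgue_integral_def set_lebesgue_integral_def)
qed

lemma integral_deriv_UNIV: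
  fixes f F :: "real \<Rightarrow> real"
  assumes F: "\<And>u. (F has_real_derivative f u) (at u)" and f: "\<And>u. isCont f u"
    and int: "integrable lborel f" and lim: "(F \<longlongrightarrow> 0) at_bot" "(F \<longlongrightarrow> 0) at_top"
  shows "(LINT u|lborel. f u) = 0"
proof -
  have "(LBINT u=-\<infinity>..\<infinity>. f u) = 0 - 0"
  proof (rule interval_integral_FTC_integrable)
    show "set_integrable lborel (einterval (-\<infinity>) \<infinity>) f" using int by (simp add: set_integrable_def)
  qed (use F f lim in \<open>auto simp: has_real_derivative_iff_has_vector_derivative ereal_tendsto_simps1\<close>)
  then show ?thesis
    by (simp add: interval_lebesgue_integral_def set_lebesgue_integral_def)
qed

lemma has_bochner_integral_inverse_quadratic:
  fixes h :: real
  assumes h: "h > 0"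
  shows "has_bochner_integral lborel (\<lambda>y. 1 / (h\<^sup>2 + y\<^sup>2)) (pi / h)"
proof -
  have "has_bochner_integral lborel (\<lambda>y. inverse (1 + y\<^sup>2) :: real) pi"
    using integrable_inverse_1_plus_square LBINT_inverse_1_plus_square
    by (simp add: has_bochner_integral_iff set_integrable_def interval_lebesgue_integral_def set_lebesgue_integral_def)
  then have "has_bochner_integral lborel (\<lambda>y. inverse (1 + (0 + (1/h) * y)\<^sup>2) :: real) (pi /\<^sub>R \<bar>1/h\<bar>)"
    using h by (subst (asm) lborel_has_bochner_integral_real_affine_iff[where c="1/h" and t=0]) auto
  then have "has_bochner_integral lborel (\<lambda>y. (1 / h\<^sup>2) * inverse (1 + (0 + (1/h) * y)\<^sup>2) :: real) ((1 / h\<^sup>2) * (pi /\<^sub>R \<bar>1/h\<bar>))"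
    by (rule has_bochner_integral_mult_right)
  moreover have "(1 / h\<^sup>2) * inverse (1 + (0 + (1/h) * y)\<^sup>2) = 1 / (h\<^sup>2 + y\<^sup>2)" for y
    using h by (simp add: field_simps power2_eq_square add_pos_nonneg)
  moreover have "(1 / h\<^sup>2) * (pi /\<^sub>R \<bar>1/h\<bar>) = pi / h" using h by (simp add: field_simps power2_eq_square)
  ultimately show ?thesis by simp
qed

section \<open>The Fejer kernel: size, tail, mass and smoothing\<close>

definition fejer :: "real \<Rightarrow> real \<Rightarrow> real" where
  "fejer T y = T / (2 * pi) * (sinc (T * y / 2))\<^sup>2"

lemma abs_sinc_le_1: "\<bar>sinc x\<bar> \<le> 1"
  using abs_sin_x_le_abs_x[of x] by (simp add: abs_divide divide_le_eq)

context
  fixes T :: real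
  assumes T: "T > 0"
begin

lemma fejer_nonneg: "fejer T y \<ge> 0" unfolding fejer_def using T by simp

lemma fejer_le: "fejer T y \<le> T / (2 * pi)"
proof -
  have "(sinc (T * y / 2))\<^sup>2 \<le> 1" using abs_sinc_le_1[of "T * y / 2"] by (simp only: abs_square_le_1)
  then have "T / (2 * pi) * (sinc (T * y / 2))\<^sup>2 \<le> T / (2 * pi) * 1"
    using T by (intro mult_left_mono) auto
  then show ?thesis by (simp add: fejer_def)
qed

lemma fejer_sq_le: "fejer T y * y\<^sup>2 \<le> 2 / (pi * T)"
proof (cases "y = 0")
  case False
  have "fejer T y * y\<^sup>2 = 2 / (pi * T) * (sin (T * y / 2))\<^sup>2"
    using T False by (simp add: fejer_def power_divide) (simp add: field_simps power2_eq_square)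
  also have "\<dots> \<le> 2 / (pi * T) * 1"
    using T by (intro mult_left_mono) (auto simp: abs_square_le_1)
  finally show ?thesis by simp
qed (use T in simp)

lemma fejer_minus [simp]: "fejer T (- y) = fejer T y"
  using sinc_neg[of "T * y / 2"] by (simp add: fejer_def del: sinc_neg)

lemma fejer_measurable [measurable]: "fejer T \<in> borel_measurable borel"
  unfolding fejer_def[abs_def] by measurable

lemma fejer_integrable: "integrable lborel (fejer T)"
proof (rule Bochner_Integration.integrable_bound)
  show "integrable lborel (\<lambda>y. (T / (2 * pi) + 2 / (pi * T)) * (1 / (1\<^sup>2 + y\<^sup>2)))"
    using has_bochner_integral_inverse_quadratic[of 1] by (intro integrable_mult_right) (auto simp: has_bochner_integral_iff)
  have "fejer T y \<le> (T / (2 * pi) + 2 / (pi * T)) * (1 / (1\<^sup>2 + y\<^sup>2))" for y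
  proof -
    have "fejer T y * (1 + y\<^sup>2) \<le> T / (2 * pi) + 2 / (pi * T)"
      using fejer_le[of y] fejer_sq_le[of y] by (simp add: distrib_left)
    then have "fejer T y \<le> (T / (2 * pi) + 2 / (pi * T)) / (1 + y\<^sup>2)"
      by (subst pos_le_divide_eq) (auto simp: add_pos_nonneg)
    then show ?thesis by simp
  qed
  then show "AE y in lborel. norm (fejer T y) \<le> norm ((T / (2 * pi) + 2 / (pi * T)) * (1 / (1\<^sup>2 + y\<^sup>2)))"
    using fejer_nonneg T by (intro AE_I2) (smt (verit) real_norm_def)
qed simp

text \<open>Where |y| > h, y^2 is at least half of h^2 + y^2, which reduces the tail to the integral
  of the Cauchy density.\<close>

lemma fejer_tail:
  assumes h: "h > 0"
  shows "(LINT y|lborel. indicator {y. h < \<bar>y\<bar>} y * fejer T y) \<le> 4 / (T * h)"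
proof -
  have i: "integrable lborel (\<lambda>y. (4 / (pi * T)) * (1 / (h\<^sup>2 + y\<^sup>2)))"
    using has_bochner_integral_inverse_quadratic[OF h] by (intro integrable_mult_right) (auto simp: has_bochner_integral_iff)
  have "(LINT y|lborel. indicator {y. h < \<bar>y\<bar>} y * fejer T y) \<le> (LINT y|lborel. (4 / (pi * T)) * (1 / (h\<^sup>2 + y\<^sup>2)))"
  proof (rule integral_mono)
    show "integrable lborel (\<lambda>y. indicator {y. h < \<bar>y\<bar>} y * fejer T y)"
      using integrable_mult_indicator[OF _ fejer_integrable, of "{y. h < \<bar>y\<bar>}"] by simp
    fix y
    show "indicator {y. h < \<bar>y\<bar>} y * fejer T y \<le> (4 / (pi * T)) * (1 / (h\<^sup>2 + y\<^sup>2))"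
    proof (cases "h < \<bar>y\<bar>")
      case True
      then have "h\<^sup>2 \<le> y\<^sup>2" using h by (metis abs_le_square_iff abs_of_pos less_imp_le)
      then have "fejer T y * (h\<^sup>2 + y\<^sup>2) \<le> fejer T y * (2 * y\<^sup>2)"
        using fejer_nonneg by (intro mult_left_mono) auto
      also have "\<dots> \<le> 4 / (pi * T)" using fejer_sq_le[of y] by simp
      finally have "fejer T y \<le> 4 / (pi * T) / (h\<^sup>2 + y\<^sup>2)"
        using h by (subst pos_le_divide_eq) (auto simp: add_pos_nonneg)
      then show ?thesis using True by simp
    next
      case False
      then show ?thesis using T by simp
    qed
  qed (rule i)
  also have "\<dots> = (4 / (pi * T)) * (pi / h)"
    unfolding integral_mult_right_zero has_bochner_integral_integral_eq[OF has_bochner_integral_inverse_quadratic[OF h]] ..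
  finally show ?thesis by simp
qed

text \<open>The true mass is 1, but a positive lower bound independent of T is enough. On the
  interval of length 2/T around 0 the kernel is at least T / (8 pi), since sinc is at least 1/2 on
  [-1/2, 1/2].\<close>

lemma fejer_mass_ge: "1 / (4 * pi) \<le> (LINT y|lborel. fejer T y)"
proof -
  have "1 / (4 * pi) = (LINT y|lborel. indicator {-1/T..1/T} y * (T / (8 * pi)))"
    using T by (simp add: field_simps)
  also have "\<dots> \<le> (LINT y|lborel. fejer T y)"
  proof (rule integral_mono)
    show "integrable lborel (\<lambda>y. indicator {-1/T..1/T} y * (T / (8 * pi)))"
      using T by (intro integrable_mult_left integrable_real_indicator) (auto simp: emeasure_lborel_Icc_eq)
    show "integrable lborel (fejer T)" by (rule fejer_integrable)
    fix y
    show "indicator {-1/T..1/T} y * (T / (8 * pi)) \<le> fejer T y"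
    proof (cases "y \<in> {-1/T..1/T}")
      case True
      define u where "u = T * y / 2"
      have "\<bar>T * y\<bar> \<le> 1" using True T by (auto simp: abs_le_iff field_simps)
      then have u: "\<bar>u\<bar> \<le> 1/2" by (simp add: u_def abs_mult)
      have s: "1/2 \<le> sinc u"
      proof (cases "u = 0")
        case False
        have "\<bar>Im (iexp u - (\<Sum>k\<le>2. (\<i> * u) ^ k / fact k))\<bar> \<le> \<bar>u\<bar> ^ 3 / 6"
          using abs_Im_le_cmod[of "iexp u - (\<Sum>k\<le>2. (\<i> * u) ^ k / fact k)"] iexp_approx1[of u 2]
          by (simp add: fact_numeral numeral_3_eq_3)
        then have "\<bar>sin u - u\<bar> \<le> \<bar>u\<bar> ^ 3 / 6"
          by (simp add: numeral_2_eq_2 cis_conv_exp[symmetric] power2_eq_square)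
        also have "\<dots> = \<bar>u\<bar> * (\<bar>u\<bar> * \<bar>u\<bar>) / 6" by (simp add: power3_eq_cube mult_ac)
        also have "\<dots> \<le> \<bar>u\<bar> * ((1/2) * (1/2)) / 6"
          using u by (intro divide_right_mono mult_left_mono mult_mono) auto
        finally have *: "\<bar>sin u - u\<bar> \<le> \<bar>u\<bar> / 2" by simp
        have "\<bar>sin u / u - 1\<bar> = \<bar>sin u - u\<bar> / \<bar>u\<bar>" using False by (simp add: abs_divide[symmetric] diff_divide_distrib)
        also have "\<dots> \<le> 1/2" using * False by (simp add: divide_le_eq)
        finally have "1/2 \<le> sin u / u" unfolding abs_le_iff by linarith
        then show ?thesis using False by simp
      qed simp
      have "(1/2)\<^sup>2 \<le> (sinc u)\<^sup>2" by (intro power_mono s) simp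
      then have le: "T / (2 * pi) * (1/4) \<le> T / (2 * pi) * (sinc u)\<^sup>2"
        using T by (intro mult_left_mono) (auto simp: power2_eq_square)
      have ind: "indicator {-1/T..1/T} y * (T / (8 * pi)) = T / (2 * pi) * (1/4)" using True by simp
      have fv: "fejer T y = T / (2 * pi) * (sinc u)\<^sup>2" by (simp only: fejer_def u_def)
      show ?thesis unfolding ind fv by (rule le)
    next
      case False
      then show ?thesis using fejer_nonneg by simp
    qed
  qed
  finally show ?thesis .
qed

text \<open>\<open>c\<close> is the sign that the difference keeps on an interval of half-length
  \<open>h\<close> about \<open>t\<close>. Averaging there retains \<delta>/2 times the mass of the
  kernel, and the tail can destroy no more than its own mass times \<delta>/2 + \<eta>.\<close>

lemma smoothing_onesided:
  fixes \<Delta> :: "real \<Rightarrow> real"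
  assumes [measurable]: "\<Delta> \<in> borel_measurable borel" and bd: "\<And>x. \<bar>\<Delta> x\<bar> \<le> \<eta>"
    and h: "h > 0" and c: "c = 1 \<or> c = -1" and \<delta>: "\<delta> \<ge> 0"
    and near: "\<And>y. \<bar>y\<bar> \<le> h \<Longrightarrow> \<delta> / 2 \<le> c * \<Delta> (t - y)"
    and E: "\<bar>LINT y|lborel. \<Delta> (t - y) * fejer T y\<bar> \<le> E"
  shows "\<delta> / 2 * (1 / (4 * pi)) \<le> E + (\<delta> / 2 + \<eta>) * (4 / (T * h))"
proof -
  have \<eta>: "\<eta> \<ge> 0" using bd[of 0] by linarith
  have i1: "integrable lborel (\<lambda>y. \<Delta> (t - y) * fejer T y)"
  proof (rule Bochner_Integration.integrable_bound)
    show "integrable lborel (\<lambda>y. \<eta> * fejer T y)" using fejer_integrable by simp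
    show "AE y in lborel. norm (\<Delta> (t - y) * fejer T y) \<le> norm (\<eta> * fejer T y)"
      using bd \<eta> fejer_nonneg by (intro AE_I2) (auto simp: abs_mult intro!: mult_right_mono)
  qed simp
  have i2: "integrable lborel (\<lambda>y. indicator {y. h < \<bar>y\<bar>} y * fejer T y)"
    using integrable_mult_indicator[OF _ fejer_integrable, of "{y. h < \<bar>y\<bar>}"] by simp
  have "(LINT y|lborel. \<delta> / 2 * fejer T y - (\<delta> / 2 + \<eta>) * (indicator {y. h < \<bar>y\<bar>} y * fejer T y))
     \<le> (LINT y|lborel. c * (\<Delta> (t - y) * fejer T y))"
  proof (rule integral_mono)
    fix y
    show "\<delta> / 2 * fejer T y - (\<delta> / 2 + \<eta>) * (indicator {y. h < \<bar>y\<bar>} y * fejer T y) \<le> c * (\<Delta> (t - y) * fejer T y)"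
    proof (cases "h < \<bar>y\<bar>")
      case True
      have "- \<eta> \<le> c * \<Delta> (t - y)" using bd[of "t - y"] c by auto
      then have "- \<eta> * fejer T y \<le> c * \<Delta> (t - y) * fejer T y" using fejer_nonneg by (intro mult_right_mono) auto
      then show ?thesis using True by (simp add: algebra_simps)
    next
      case False
      then have "\<delta> / 2 * fejer T y \<le> c * \<Delta> (t - y) * fejer T y"
        using near[of y] fejer_nonneg by (intro mult_right_mono) auto
      then show ?thesis using False by (simp add: algebra_simps)
    qed
  qed (use i1 i2 fejer_integrable in auto)
  also have "\<dots> = c * (LINT y|lborel. \<Delta> (t - y) * fejer T y)" by simp
  also have "\<dots> \<le> E" using E c by auto
  finally have *: "\<delta> / 2 * (LINT y|lborel. fejer T y) - (\<delta> / 2 + \<eta>) * (LINT y|lborel. indicator {y. h < \<bar>y\<bar>} y * fejer T y) \<le> E"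
    using i2 fejer_integrable by simp
  have "(\<delta> / 2 + \<eta>) * (LINT y|lborel. indicator {y. h < \<bar>y\<bar>} y * fejer T y) \<le> (\<delta> / 2 + \<eta>) * (4 / (T * h))"
    using fejer_tail[OF h] \<delta> \<eta> by (intro mult_left_mono) auto
  moreover have "\<delta> / 2 * (1 / (4 * pi)) \<le> \<delta> / 2 * (LINT y|lborel. fejer T y)"
    using fejer_mass_ge \<delta> by (intro mult_left_mono) auto
  ultimately show ?thesis using * by linarith
qed

text \<open>At a point with |\<Delta>| = \<delta> above half the supremum, the one-sided growth
  bound keeps |\<Delta>| at least \<delta>/2 on an interval of length 2 h = \<delta>/(2 m), to the
  right if the sign is positive and to the left otherwise. With the supremum below 2 \<delta>, the
  tail costs (5 \<delta>/2) 4/(T h) = 40 m / T, independently of \<delta>.\<close>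

lemma smoothing_inequality:
  fixes \<Delta> :: "real \<Rightarrow> real"
  assumes meas: "\<Delta> \<in> borel_measurable borel" and bdd: "\<And>x. \<bar>\<Delta> x\<bar> \<le> B"
    and m: "m > 0" and mono: "\<And>x s. s \<ge> 0 \<Longrightarrow> \<Delta> x - m * s \<le> \<Delta> (x + s)"
    and E: "\<And>t. \<bar>LINT y|lborel. \<Delta> (t - y) * fejer T y\<bar> \<le> E"
  shows "\<bar>\<Delta> x\<bar> \<le> 16 * pi * (E + 40 * m / T)"
proof -
  define \<eta> where "\<eta> = (SUP x. \<bar>\<Delta> x\<bar>)"
  have ba: "bdd_above (range (\<lambda>x. \<bar>\<Delta> x\<bar>))" using bdd by (intro bdd_aboveI) auto
  have le: "\<bar>\<Delta> x\<bar> \<le> \<eta>" for x unfolding \<eta>_def by (intro cSUP_upper ba) auto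
  have E0: "E \<ge> 0" using E[of 0] by linarith
  have "\<eta> \<le> 16 * pi * (E + 40 * m / T)"
  proof (cases "\<eta> \<le> 0")
    case True
    have "0 \<le> 16 * pi * (E + 40 * m / T)" using E0 m T by simp
    then show ?thesis using True by linarith
  next
    case False
    then have "\<eta> / 2 < \<eta>" by simp
    then obtain x0 where x0: "\<eta> / 2 < \<bar>\<Delta> x0\<bar>" unfolding \<eta>_def by (subst (asm) less_cSUP_iff[OF _ ba]) auto
    define \<delta> where "\<delta> = \<bar>\<Delta> x0\<bar>"
    have \<delta>: "\<delta> > 0" using x0 False by (simp add: \<delta>_def)
    define c :: real where "c = (if \<Delta> x0 \<ge> 0 then 1 else -1)"
    define h where "h = \<delta> / (4 * m)"
    have h: "h > 0" using \<delta> m by (simp add: h_def)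
    have mh: "m * h = \<delta> / 4" using m by (simp add: h_def)
    have near: "\<delta> / 2 \<le> c * \<Delta> (x0 + c * h - y)" if y: "\<bar>y\<bar> \<le> h" for y
    proof (cases "\<Delta> x0 \<ge> 0")
      case True
      have "\<Delta> x0 - m * (h - y) \<le> \<Delta> (x0 + (h - y))" using y by (intro mono) auto
      moreover have "m * (h - y) \<le> m * (2 * h)" using y m by (intro mult_left_mono) auto
      ultimately show ?thesis using True mh by (simp add: c_def \<delta>_def add_diff_eq)
    next
      case False
      have "\<Delta> (x0 - h - y) - m * (h + y) \<le> \<Delta> (x0 - h - y + (h + y))" using y by (intro mono) auto
      moreover have "m * (h + y) \<le> m * (2 * h)" using y m by (intro mult_left_mono) auto
      ultimately show ?thesis using False mh by (simp add: c_def \<delta>_def)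
    qed
    have "\<delta> / 2 * (1 / (4 * pi)) \<le> E + (\<delta> / 2 + \<eta>) * (4 / (T * h))"
      by (rule smoothing_onesided[OF meas le h _ _ near E]) (use \<delta> in \<open>auto simp: c_def\<close>)
    also have "(\<delta> / 2 + \<eta>) * (4 / (T * h)) \<le> (\<delta> / 2 + 2 * \<delta>) * (4 / (T * h))"
      using x0 T h by (intro mult_right_mono) (auto simp: \<delta>_def)
    also have "\<dots> = 40 * m / T" using \<delta> m T by (simp add: h_def field_simps)
    finally have "\<delta> * (1 / (8 * pi)) \<le> E + 40 * m / T" by simp
    then have "8 * pi * (\<delta> * (1 / (8 * pi))) \<le> 8 * pi * (E + 40 * m / T)" by (intro mult_left_mono) auto
    then have "\<delta> \<le> 8 * pi * (E + 40 * m / T)" by simp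
    then show ?thesis using x0 by (simp add: \<delta>_def)
  qed
  then show ?thesis using le[of x] by linarith
qed

end

section \<open>The smoothed step as a Fourier sine integral\<close>

definition sincr :: "real \<Rightarrow> real" where "sincr x = sinc x"

lemma sincr_minus: "sincr (- x) = sincr x" by (simp add: sincr_def)

lemma abs_sincr_le_1: "\<bar>sincr x\<bar> \<le> 1" unfolding sincr_def by (rule abs_sinc_le_1)

lemma continuous_on_sincr [continuous_intros]:
  "continuous_on S f \<Longrightarrow> continuous_on S (\<lambda>x. sincr (f x))"
  unfolding sincr_def by (rule continuous_on_sinc)

lemma sincr_measurable [measurable]: "sincr \<in> borel_measurable borel"
  unfolding sincr_def[abs_def] by (rule borel_measurable_sinc)

context
  fixes T :: real
  assumes T: "T > 0"
begin

text \<open>The Fourier transform of the kernel is the triangle function on [-T, T]; so only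
  frequencies up to T enter the smoothed difference. The primitive comes from one integration by
  parts.\<close>

lemma fejer_eq_integral: "fejer T y = integral {0..T} (\<lambda>\<tau>. (1 - \<tau> / T) * cos (\<tau> * y)) / pi"
proof (cases "y = 0")
  case True
  have "((\<lambda>\<tau>. (1 - \<tau> / T) * cos (\<tau> * y)) has_integral (T - T\<^sup>2 / (2 * T)) - (0 - 0\<^sup>2 / (2 * T))) {0..T}"
    using T True by (intro fundamental_theorem_of_calculus)
      (auto intro!: derivative_eq_intros simp: has_real_derivative_iff_has_vector_derivative[symmetric])
  then have eq: "integral {0..T} (\<lambda>\<tau>. (1 - \<tau> / T) * cos (\<tau> * y)) = T / 2"
    using T by (simp add: integral_unique power2_eq_square)
  have "fejer T y = T / (2 * pi)" using True by (simp add: fejer_def)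
  then show ?thesis unfolding eq by simp
next
  case False
  define P where "P \<tau> = (1 - \<tau> / T) * (sin (\<tau> * y) / y) - cos (\<tau> * y) / (T * y\<^sup>2)" for \<tau>
  have "((\<lambda>\<tau>. (1 - \<tau> / T) * cos (\<tau> * y)) has_integral P T - P 0) {0..T}"
    using T False unfolding P_def by (intro fundamental_theorem_of_calculus)
      (auto intro!: derivative_eq_intros simp: has_real_derivative_iff_has_vector_derivative[symmetric] field_simps power2_eq_square)
  then have "integral {0..T} (\<lambda>\<tau>. (1 - \<tau> / T) * cos (\<tau> * y)) = (1 - cos (T * y)) / (T * y\<^sup>2)"
    using T by (simp add: integral_unique P_def diff_divide_distrib)
  also have "cos (T * y) = 1 - 2 * (sin (T * y / 2))\<^sup>2"
    using cos_double_sin[of "T * y / 2"] by simp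
  finally have "integral {0..T} (\<lambda>\<tau>. (1 - \<tau> / T) * cos (\<tau> * y)) = 2 * (sin (T * y / 2))\<^sup>2 / (T * y\<^sup>2)"
    by simp
  then show ?thesis using False T by (simp add: fejer_def power_divide) (simp add: field_simps power2_eq_square)
qed

lemma integral_cos_sinc:
  assumes "a \<ge> 0"
  shows "integral {0..a} (\<lambda>y. cos (\<tau> * y)) = a * sincr (\<tau> * a)"
proof (cases "\<tau> = 0")
  case False
  have "((\<lambda>y. cos (\<tau> * y)) has_integral sin (\<tau> * a) / \<tau> - sin (\<tau> * 0) / \<tau>) {0..a}"
    using assms False by (intro fundamental_theorem_of_calculus)
      (auto intro!: derivative_eq_intros simp: has_real_derivative_iff_has_vector_derivative[symmetric])
  then show ?thesis using False by (auto simp: integral_unique sincr_def)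
qed (use assms in \<open>simp add: sincr_def\<close>)

definition fstep :: "real \<Rightarrow> real" where
  "fstep a = (LINT y|lborel. indicator {..<a} y * fejer T y)"

text \<open>The factor a sinc (\<tau> a) is sin (\<tau> a) / \<tau> continued to \<tau> = 0. The
  integral of the kernel from 0 to \<open>a\<close> thus becomes a sine integral over frequencies,
  without a singularity at the origin.\<close>

definition cosk :: "real \<Rightarrow> real" where
  "cosk a = (LINT \<tau>|lborel. indicator {0..T} \<tau> * ((1 - \<tau> / T) * (a * sincr (\<tau> * a)))) / pi"

lemma set_integral_eq_HK:
  fixes f :: "real \<Rightarrow> real"
  assumes "continuous_on {l..u} f"
  shows "(LINT y|lborel. indicator {l..u} y * f y) = integral {l..u} f"
proof -
  have "set_integrable lborel {l..u} f"
    unfolding set_integrable_def using borel_integrable_compact[of "{l..u}" f] assms by simp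
  from set_borel_integral_eq_integral(2)[OF this] show ?thesis
    by (simp add: set_lebesgue_integral_def)
qed

lemma fejer_continuous: "continuous_on S (fejer T)"
  unfolding fejer_def[abs_def] by (intro continuous_intros) auto

lemma fejer_integral_Icc:
  assumes a: "a \<ge> 0"
  shows "(LINT y|lborel. indicator {0..a} y * fejer T y) = cosk a"
proof -
  have "(LINT y|lborel. indicator {0..a} y * fejer T y) = integral {0..a} (fejer T)"
    by (rule set_integral_eq_HK[OF fejer_continuous])
  also have "\<dots> = integral (cbox 0 a) (\<lambda>y. integral (cbox 0 T) (\<lambda>\<tau>. (1 - \<tau> / T) * cos (\<tau> * y) / pi))"
    by (simp add: fejer_eq_integral[abs_def])
  also have "\<dots> = integral (cbox 0 T) (\<lambda>\<tau>. integral (cbox 0 a) (\<lambda>y. (1 - \<tau> / T) * cos (\<tau> * y) / pi))"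
    by (rule integral_swap_continuous) (use T in \<open>auto intro!: continuous_intros simp: split_beta\<close>)
  also have "\<dots> = integral {0..T} (\<lambda>\<tau>. (1 - \<tau> / T) * (a * sincr (\<tau> * a)) / pi)"
    by (simp only: integral_divide integral_mult_right integral_cos_sinc[OF a] cbox_interval)
  also have "\<dots> = integral {0..T} (\<lambda>\<tau>. (1 - \<tau> / T) * (a * sincr (\<tau> * a))) / pi"
    by simp
  also have "\<dots> = cosk a"
    unfolding cosk_def using T by (subst set_integral_eq_HK) (auto intro!: continuous_intros)
  finally show ?thesis .
qed

lemma indicator_fejer_integrable: "A \<in> sets borel \<Longrightarrow> integrable lborel (\<lambda>y. indicator A y * fejer T y)"
  using integrable_mult_indicator[OF _ fejer_integrable[OF T], of A] by simp

lemma fstep_reflect: "fstep a + fstep (- a) = (LINT y|lborel. fejer T y)"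
proof -
  have "fstep (- a) = (LINT y|lborel. indicator {..<- a} (0 + (-1) * y) * fejer T (0 + (-1) * y))"
    unfolding fstep_def by (subst lborel_integral_real_affine[where c="-1" and t=0]) simp_all
  also have "\<dots> = (LINT y|lborel. indicator {a<..} y * fejer T y)"
    using T by (intro Bochner_Integration.integral_cong) (auto simp: indicator_def)
  finally have "fstep a + fstep (- a) = (LINT y|lborel. indicator {..<a} y * fejer T y + indicator {a<..} y * fejer T y)"
    unfolding fstep_def by (subst Bochner_Integration.integral_add) (auto intro!: indicator_fejer_integrable)
  also have "\<dots> = (LINT y|lborel. fejer T y)"
  proof (rule integral_cong_AE)
    show "AE y in lborel. indicator {..<a} y * fejer T y + indicator {a<..} y * fejer T y = fejer T y"
      using AE_lborel_singleton[of a] by eventually_elim (auto simp: indicator_def)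
  qed (use T in measurable)
  finally show ?thesis .
qed

lemma cosk_minus: "cosk (- a) = - cosk a"
  unfolding cosk_def by (simp add: sincr_minus)

text \<open>By symmetry of the kernel the smoothed step is half of the total mass plus an odd
  function. Only the odd part survives when two distributions of equal mass are compared.\<close>

lemma fstep_eq: "fstep a = (LINT y|lborel. fejer T y) / 2 + cosk a"
proof -
  have 0: "fstep 0 = (LINT y|lborel. fejer T y) / 2" using fstep_reflect[of 0] by simp
  have pos: "fstep a = (LINT y|lborel. fejer T y) / 2 + cosk a" if a: "a \<ge> 0" for a
  proof -
    have "fstep a = (LINT y|lborel. indicator {..<0} y * fejer T y + indicator {0..a} y * fejer T y)"
      unfolding fstep_def
    proof (rule integral_cong_AE)
      show "AE y in lborel. indicator {..<a} y * fejer T y = indicator {..<0} y * fejer T y + indicator {0..a} y * fejer T y"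
        using AE_lborel_singleton[of a] by eventually_elim (use a in \<open>auto simp: indicator_def\<close>)
    qed (use T in measurable)
    also have "\<dots> = fstep 0 + cosk a"
      unfolding fstep_def fejer_integral_Icc[OF a, symmetric]
      by (intro Bochner_Integration.integral_add indicator_fejer_integrable) auto
    finally show ?thesis using 0 by simp
  qed
  show ?thesis
  proof (cases "a \<ge> 0")
    case False
    then show ?thesis using pos[of "- a"] fstep_reflect[of a] cosk_minus[of a] by simp
  qed (rule pos)
qed

end

section \<open>The comparison density and its Fourier transform\<close>

definition edgeworth_density :: "real \<Rightarrow> real \<Rightarrow> real" where
  "edgeworth_density C u = std_normal_density u * (1 + C * u)"

lemma edgeworth_density_measurable [measurable]: "edgeworth_density C \<in> borel_measurable borel"
  unfolding edgeworth_density_def[abs_def] by measurable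

lemma edgeworth_density_moment:
  "integrable lborel (\<lambda>u. edgeworth_density C u * \<bar>u\<bar> ^ k)"
  "integrable lborel (\<lambda>u. \<bar>edgeworth_density C u\<bar> * \<bar>u\<bar> ^ k)"
proof -
  have i: "integrable lborel (\<lambda>u. std_normal_density u * \<bar>u\<bar> ^ k + \<bar>C\<bar> * (std_normal_density u * \<bar>u\<bar> ^ Suc k))"
    by (intro Bochner_Integration.integrable_add integrable_mult_right integrable_std_normal_moment_abs)
  have b: "\<bar>edgeworth_density C u\<bar> * \<bar>u\<bar> ^ k \<le> std_normal_density u * \<bar>u\<bar> ^ k + \<bar>C\<bar> * (std_normal_density u * \<bar>u\<bar> ^ Suc k)" for u
  proof -
    have "\<bar>edgeworth_density C u\<bar> \<le> std_normal_density u * (1 + \<bar>C\<bar> * \<bar>u\<bar>)"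
      unfolding edgeworth_density_def abs_mult
      by (intro mult_mono) (auto simp: abs_mult[symmetric] intro!: order_trans[OF abs_triangle_ineq])
    then have "\<bar>edgeworth_density C u\<bar> * \<bar>u\<bar> ^ k \<le> std_normal_density u * (1 + \<bar>C\<bar> * \<bar>u\<bar>) * \<bar>u\<bar> ^ k"
      by (rule mult_right_mono) simp
    then show ?thesis by (simp add: algebra_simps)
  qed
  show "integrable lborel (\<lambda>u. edgeworth_density C u * \<bar>u\<bar> ^ k)"
    by (rule Bochner_Integration.integrable_bound[OF i]) (auto intro!: AE_I2 order_trans[OF b] simp: abs_mult)
  show "integrable lborel (\<lambda>u. \<bar>edgeworth_density C u\<bar> * \<bar>u\<bar> ^ k)"
    by (rule Bochner_Integration.integrable_bound[OF i]) (auto intro!: AE_I2 order_trans[OF b] simp: abs_mult)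
qed

lemma edgeworth_density_integrable: "integrable lborel (edgeworth_density C)"
  using edgeworth_density_moment(1)[of C 0] by simp

lemma std_normal_density_DERIV:
  "(std_normal_density has_real_derivative (- u * std_normal_density u)) (at u)"
proof -
  have "((\<lambda>x. exp (- x\<^sup>2 / 2)) has_real_derivative exp (- u\<^sup>2 / 2) * (- u)) (at u)"
    by (auto intro!: derivative_eq_intros)
  from DERIV_cmult[OF this, of "1 / sqrt (2 * pi)"] show ?thesis
    by (simp add: std_normal_density_def[abs_def] mult_ac)
qed

lemma std_normal_density_tendsto_0:
  "(std_normal_density \<longlongrightarrow> 0) at_top" "(std_normal_density \<longlongrightarrow> 0) at_bot"
  unfolding std_normal_density_def[abs_def] by real_asymp+

lemma isCont_std_normal_density: "isCont std_normal_density u"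
  by (rule DERIV_isCont[OF std_normal_density_DERIV])

lemma Phi_eq_integral: "Phi x = (LINT u|lborel. indicator {..<x} u * std_normal_density u)"
proof -
  interpret prob_space std_normal_distribution by (rule prob_space_normal_density) simp
  have "Phi x = (LINT u|std_normal_distribution. indicator {..x} u)"
    unfolding Phi_def cdf_def by simp
  also have "\<dots> = (LINT u|lborel. std_normal_density u *\<^sub>R indicator {..x} u)"
    by (rule integral_density) (auto intro!: AE_I2)
  also have "\<dots> = (LINT u|lborel. indicator {..<x} u * std_normal_density u)"
  proof (rule integral_cong_AE)
    show "AE u in lborel. std_normal_density u *\<^sub>R indicator {..x} u = indicator {..<x} u * std_normal_density u"
      using AE_lborel_singleton[of x] by eventually_elim (auto simp: indicator_def)
  qed measurable
  finally show ?thesis .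
qed

text \<open>The standard normal density has derivative -u times itself, so the factor 1 + C u
  integrates to the correction term in the theorem. The density may take negative values.\<close>

lemma edgeworth_integral:
  "(LINT u|lborel. indicator {..<x} u * edgeworth_density C u) = Phi x - C * std_normal_density x"
proof -
  have i1: "integrable lborel (\<lambda>u. indicator {..<x} u * std_normal_density u)"
    using integrable_mult_indicator[of "{..<x}" lborel std_normal_density] by (simp add: integrable_normal_density)
  have u: "integrable lborel (\<lambda>u. u * std_normal_density u)"
    using integrable_std_normal_moment[of 1] by (simp add: mult.commute)
  have i2: "integrable lborel (\<lambda>u. indicator {..<x} u * (u * std_normal_density u))"
    using integrable_mult_indicator[OF _ u, of "{..<x}"] by simp
  have "(LINT u|lborel. indicator {..<x} u * (u * std_normal_density u)) = - std_normal_density x"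
  proof (rule integral_deriv_lessThan)
    show "((\<lambda>u. - std_normal_density u) has_real_derivative v * std_normal_density v) (at v)" for v
      using DERIV_minus[OF std_normal_density_DERIV[of v]] by simp
    show "isCont (\<lambda>u. u * std_normal_density u) v" for v
      by (intro continuous_intros isCont_std_normal_density)
    show "((\<lambda>u. - std_normal_density u) \<longlongrightarrow> 0) at_bot"
      using tendsto_minus[OF std_normal_density_tendsto_0(2)] by simp
  qed (rule u)
  moreover have "(LINT u|lborel. indicator {..<x} u * edgeworth_density C u)
     = (LINT u|lborel. indicator {..<x} u * std_normal_density u + C * (indicator {..<x} u * (u * std_normal_density u)))"
    by (intro Bochner_Integration.integral_cong refl) (simp add: edgeworth_density_def algebra_simps)
  ultimately show ?thesis
    using i1 i2 by (simp add: Phi_eq_integral)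
qed

lemma std_normal_trig:
  "(LINT u|lborel. std_normal_density u * cos (\<tau> * u)) = exp (- \<tau>\<^sup>2 / 2)"
  "(LINT u|lborel. std_normal_density u * sin (\<tau> * u)) = 0"
proof -
  have "char std_normal_distribution \<tau> = (LINT u|lborel. std_normal_density u *\<^sub>R iexp (\<tau> * u))"
    unfolding char_def by (subst integral_density) (auto intro!: AE_I2)
  then have e: "(LINT u|lborel. std_normal_density u *\<^sub>R cis (\<tau> * u)) = complex_of_real (exp (- \<tau>\<^sup>2 / 2))"
    by (simp add: char_std_normal_distribution cis_conv_exp)
  have i: "integrable lborel (\<lambda>u. std_normal_density u *\<^sub>R cis (\<tau> * u))"
  proof (rule Bochner_Integration.integrable_bound[of _ std_normal_density])
    have "(\<lambda>u. cis (\<tau> * u)) \<in> borel_measurable borel"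
      unfolding cis_conv_exp by measurable
    then show "(\<lambda>u. std_normal_density u *\<^sub>R cis (\<tau> * u)) \<in> borel_measurable lborel" by measurable
  qed (auto intro!: AE_I2 simp: integrable_normal_density)
  show "(LINT u|lborel. std_normal_density u * cos (\<tau> * u)) = exp (- \<tau>\<^sup>2 / 2)"
    using arg_cong[OF e, of Re] integral_Re[OF i] by simp
  show "(LINT u|lborel. std_normal_density u * sin (\<tau> * u)) = 0"
    using arg_cong[OF e, of Im] integral_Im[OF i] by simp
qed

text \<open>The derivatives of the normal density times sin (\<tau> u) and times cos (\<tau> u)
  integrate to zero over the line, which reduces the first moments to the plain integrals.\<close>

lemma std_normal_trig_moment:
  "(LINT u|lborel. std_normal_density u * u * cos (\<tau> * u)) = 0"
  "(LINT u|lborel. std_normal_density u * u * sin (\<tau> * u)) = \<tau> * exp (- \<tau>\<^sup>2 / 2)"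
  "integrable lborel (\<lambda>u. std_normal_density u * u * cos (\<tau> * u))"
  "integrable lborel (\<lambda>u. std_normal_density u * u * sin (\<tau> * u))"
  "integrable lborel (\<lambda>u. std_normal_density u * cos (\<tau> * u))"
  "integrable lborel (\<lambda>u. std_normal_density u * sin (\<tau> * u))"
proof -
  have i0: "integrable lborel std_normal_density" by (simp add: integrable_normal_density)
  have i1: "integrable lborel (\<lambda>u. std_normal_density u * \<bar>u\<bar>)"
    using integrable_std_normal_moment_abs[of 1] by simp
  show ic: "integrable lborel (\<lambda>u. std_normal_density u * u * cos (\<tau> * u))"
    by (rule Bochner_Integration.integrable_bound[OF i1]) (auto intro!: AE_I2 mult_left_le simp: abs_mult)
  show isn: "integrable lborel (\<lambda>u. std_normal_density u * u * sin (\<tau> * u))"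
    by (rule Bochner_Integration.integrable_bound[OF i1]) (auto intro!: AE_I2 mult_left_le simp: abs_mult)
  show ic0: "integrable lborel (\<lambda>u. std_normal_density u * cos (\<tau> * u))"
    by (rule Bochner_Integration.integrable_bound[OF i0]) (auto intro!: AE_I2 mult_left_le simp: abs_mult)
  show isn0: "integrable lborel (\<lambda>u. std_normal_density u * sin (\<tau> * u))"
    by (rule Bochner_Integration.integrable_bound[OF i0]) (auto intro!: AE_I2 mult_left_le simp: abs_mult)
  have lim: "((\<lambda>u. std_normal_density u * k u) \<longlongrightarrow> 0) F" if k: "\<And>u::real. \<bar>k u\<bar> \<le> 1" and F: "(std_normal_density \<longlongrightarrow> 0) F" for k F
  proof (rule Lim_null_comparison[OF _ F])
    show "\<forall>\<^sub>F u in F. norm (std_normal_density u * k u) \<le> std_normal_density u"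
      using k by (intro always_eventually allI) (auto simp: abs_mult intro!: mult_left_le)
  qed
  have "(LINT u|lborel. \<tau> * (std_normal_density u * cos (\<tau> * u)) - std_normal_density u * u * sin (\<tau> * u)) = 0"
  proof (rule integral_deriv_UNIV)
    show "((\<lambda>u. std_normal_density u * sin (\<tau> * u)) has_real_derivative
      \<tau> * (std_normal_density v * cos (\<tau> * v)) - std_normal_density v * v * sin (\<tau> * v)) (at v)" for v
      by (rule DERIV_cong, rule DERIV_mult[OF std_normal_density_DERIV])
         (auto intro!: derivative_eq_intros simp: algebra_simps)
    show "isCont (\<lambda>v. \<tau> * (std_normal_density v * cos (\<tau> * v)) - std_normal_density v * v * sin (\<tau> * v)) u" for u
      by (intro continuous_intros isCont_std_normal_density)
  qed (use isn ic0 lim std_normal_density_tendsto_0 in auto)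
  then show "(LINT u|lborel. std_normal_density u * u * sin (\<tau> * u)) = \<tau> * exp (- \<tau>\<^sup>2 / 2)"
    using isn ic0 std_normal_trig(1)[of \<tau>] by simp
  have "(LINT u|lborel. - \<tau> * (std_normal_density u * sin (\<tau> * u)) - std_normal_density u * u * cos (\<tau> * u)) = 0"
  proof (rule integral_deriv_UNIV)
    show "((\<lambda>u. std_normal_density u * cos (\<tau> * u)) has_real_derivative
      - \<tau> * (std_normal_density v * sin (\<tau> * v)) - std_normal_density v * v * cos (\<tau> * v)) (at v)" for v
      by (rule DERIV_cong, rule DERIV_mult[OF std_normal_density_DERIV])
         (auto intro!: derivative_eq_intros simp: algebra_simps)
    show "isCont (\<lambda>v. - \<tau> * (std_normal_density v * sin (\<tau> * v)) - std_normal_density v * v * cos (\<tau> * v)) u" for u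
      by (intro continuous_intros isCont_std_normal_density)
  qed (use ic isn0 lim std_normal_density_tendsto_0 in auto)
  then show "(LINT u|lborel. std_normal_density u * u * cos (\<tau> * u)) = 0"
    using ic isn0 std_normal_trig(2)[of \<tau>] by simp
qed

text \<open>In complex form: the Fourier transform of the comparison density is exp (-\<tau>^2/2) (1
  + i C \<tau>), whence \<open>Complex 1 (\<tau> * C)\<close> in the following inequality.\<close>

lemma edgeworth_sin:
  "(LINT u|lborel. edgeworth_density C u * sin (\<tau> * (t - u)))
     = sin (\<tau> * t) * exp (- \<tau>\<^sup>2 / 2) - cos (\<tau> * t) * (C * \<tau> * exp (- \<tau>\<^sup>2 / 2))"
proof -
  have "edgeworth_density C u * sin (\<tau> * (t - u)) =
     (sin (\<tau> * t) * (std_normal_density u * cos (\<tau> * u)) - cos (\<tau> * t) * (std_normal_density u * sin (\<tau> * u)))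
     + (C * sin (\<tau> * t) * (std_normal_density u * u * cos (\<tau> * u)) - C * cos (\<tau> * t) * (std_normal_density u * u * sin (\<tau> * u)))" for u
    unfolding right_diff_distrib sin_diff edgeworth_density_def by (simp add: algebra_simps)
  then show ?thesis
    using std_normal_trig_moment[of \<tau>] std_normal_trig[of \<tau>] by simp
qed

lemma integrable_product_lborel:
  fixes f g :: "real \<Rightarrow> real"
  assumes f: "integrable lborel f" and g: "integrable lborel g"
  shows "integrable (lborel \<Otimes>\<^sub>M lborel) (\<lambda>(x, y). f x * g y)"
proof (rule lborel_pair.Fubini_integrable)
  have [measurable]: "f \<in> borel_measurable borel" "g \<in> borel_measurable borel"
    using borel_measurable_integrable[OF f] borel_measurable_integrable[OF g] by simp_all
  show "(\<lambda>(x, y). f x * g y) \<in> borel_measurable (lborel \<Otimes>\<^sub>M lborel)" by measurable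
  show "integrable lborel (\<lambda>x. LINT y|lborel. norm (case (x, y) of (x, y) \<Rightarrow> f x * g y))"
    using f by (simp add: abs_mult)
qed (use g in auto)

text \<open>Both distribution functions are mixtures of steps, and each smoothed step is a constant
  plus a sine integral. The difference becomes an integral over [0, T] of the triangle function
  against the difference of the characteristic functions divided by \<tau>; stating the hypothesis
  with \<tau> b(\<tau>) cancels this division. The density is bounded from above only, as one-sided
  growth of the difference suffices for the smoothing.\<close>

lemma esseen_inequality:
  fixes q w :: "'i \<Rightarrow> real" and b :: "real \<Rightarrow> real"
  assumes I: "finite I" and q: "\<And>i. i \<in> I \<Longrightarrow> q i \<ge> 0" "(\<Sum>i\<in>I. q i) = 1" and T: "T > 0"
    and b: "\<And>\<tau>. 0 < \<tau> \<Longrightarrow> \<tau> \<le> T \<Longrightarrow>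
       cmod ((\<Sum>i\<in>I. of_real (q i) * cis (\<tau> * w i)) - of_real (exp (- \<tau>\<^sup>2 / 2)) * Complex 1 (\<tau> * C)) \<le> \<tau> * b \<tau>"
    and bi: "integrable lborel (\<lambda>\<tau>. indicator {0..T} \<tau> * b \<tau>)"
    and m: "m > 0" "\<And>u. edgeworth_density C u \<le> m"
  shows "\<bar>(\<Sum>i | i \<in> I \<and> w i < x. q i) - (Phi x - C * std_normal_density x)\<bar>
     \<le> 16 * pi * ((LINT \<tau>|lborel. indicator {0..T} \<tau> * b \<tau>) / pi + 40 * m / T)"
proof -
  let ?g = "edgeworth_density C"
  let ?V = "fejer T"
  note gi = edgeworth_density_integrable[of C]
  note Vi = fejer_integrable[OF T]
  note Vm [measurable] = fejer_measurable[OF T]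
  define F where "F x = (\<Sum>i\<in>I. q i * indicator {..<x} (w i))" for x :: real
  define G where "G x = (LINT u|lborel. indicator {..<x} u * ?g u)" for x
  define \<Delta> where "\<Delta> x = F x - G x" for x
  have igx: "integrable lborel (\<lambda>u. indicator A u * ?g u)" if "A \<in> sets borel" for A
    using integrable_mult_indicator[OF _ gi, of A] that by simp
  have Fm [measurable]: "F \<in> borel_measurable borel"
  proof -
    have "F = (\<lambda>x. \<Sum>i\<in>I. q i * (if w i < x then 1 else 0))"
      by (simp add: F_def fun_eq_iff indicator_def of_bool_def)
    also have "\<dots> \<in> borel_measurable borel" by measurable
    finally show ?thesis .
  qed
  have Gm [measurable]: "G \<in> borel_measurable borel"
  proof -
    have "mono Phi" unfolding Phi_def[abs_def]
      by (intro monoI finite_borel_measure.cdf_nondecreasing)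
        (auto intro!: finite_borel_measure.intro prob_space.finite_measure prob_space_normal_density simp: finite_borel_measure_axioms_def)
    then have "Phi \<in> borel_measurable borel" by (rule borel_measurable_mono)
    then show ?thesis unfolding G_def[abs_def] edgeworth_integral by measurable
  qed
  have F01: "0 \<le> F x" "F x \<le> 1" for x
  proof -
    show "0 \<le> F x" unfolding F_def using q by (intro sum_nonneg) auto
    have "F x \<le> (\<Sum>i\<in>I. q i * 1)" unfolding F_def using q by (intro sum_mono mult_left_mono) (auto simp: indicator_def)
    then show "F x \<le> 1" using q by simp
  qed
  define B where "B = (LINT u|lborel. \<bar>?g u\<bar>)"
  have GB: "\<bar>G x\<bar> \<le> B" for x
  proof -
    have "\<bar>G x\<bar> \<le> (LINT u|lborel. \<bar>indicator {..<x} u * ?g u\<bar>)" unfolding G_def by (rule integral_abs_bound)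
    also have "\<dots> \<le> B" unfolding B_def
      by (intro integral_mono integrable_abs gi igx) (auto simp: indicator_def)
    finally show ?thesis .
  qed
  have mono: "\<Delta> x - m * s \<le> \<Delta> (x + s)" if s: "s \<ge> 0" for x s
  proof -
    have "F x \<le> F (x + s)" unfolding F_def using q s by (intro sum_mono mult_left_mono) (auto simp: indicator_def)
    moreover have "G (x + s) - G x \<le> m * s"
    proof -
      have "G (x + s) - G x = (LINT u|lborel. indicator {..<x + s} u * ?g u - indicator {..<x} u * ?g u)"
        unfolding G_def by (intro Bochner_Integration.integral_diff[symmetric] igx) auto
      also have "\<dots> = (LINT u|lborel. indicator {x..<x + s} u * ?g u)"
        using s by (intro Bochner_Integration.integral_cong refl) (auto simp: indicator_def)
      also have "\<dots> \<le> (LINT u|lborel. indicator {x..<x + s} u * m)"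
        using s m by (intro integral_mono igx integrable_mult_left integrable_real_indicator) (auto simp: indicator_def)
      also have "\<dots> = m * s" using s by simp
      finally show ?thesis .
    qed
    ultimately show ?thesis by (simp add: \<Delta>_def)
  qed
  have E: "\<bar>LINT y|lborel. \<Delta> (t - y) * ?V y\<bar> \<le> (LINT \<tau>|lborel. indicator {0..T} \<tau> * b \<tau>) / pi" for t
  proof -
    define cV where "cV = (LINT y|lborel. ?V y)"
    have fe: "fstep T a = cV / 2 + cosk T a" for a unfolding cV_def by (rule fstep_eq[OF T])
    have FV: "integrable lborel (\<lambda>y. F (t - y) * ?V y)"
      by (rule Bochner_Integration.integrable_bound[OF Vi])
        (use F01 fejer_nonneg[OF T] in \<open>auto intro!: AE_I2 mult_right_mono mult_left_le_one_le simp: abs_mult\<close>)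
    have GV: "integrable lborel (\<lambda>y. G (t - y) * ?V y)"
      by (rule Bochner_Integration.integrable_bound[of _ "\<lambda>y. B * ?V y"])
        (use Vi GB fejer_nonneg[OF T] order_trans[OF abs_ge_zero GB] in \<open>auto intro!: AE_I2 mult_right_mono simp: abs_mult\<close>)
    have FI: "(LINT y|lborel. F (t - y) * ?V y) = (\<Sum>i\<in>I. q i * fstep T (t - w i))"
    proof -
      have "F (t - y) * ?V y = (\<Sum>i\<in>I. q i * (indicator {..<t - w i} y * ?V y))" for y
        unfolding F_def sum_distrib_right by (intro sum.cong refl) (auto simp: indicator_def)
      then show ?thesis
        unfolding fstep_def[OF T] by (simp add: Bochner_Integration.integral_sum indicator_fejer_integrable[OF T])
    qed
    have gV: "integrable (lborel \<Otimes>\<^sub>M lborel) (\<lambda>(u, y). indicator {..<t - y} u * ?g u * ?V y)"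
    proof (rule Bochner_Integration.integrable_bound[OF integrable_product_lborel[OF gi Vi]])
      have "(\<lambda>(u, y). (if u < t - y then 1 else 0) * ?g u * ?V y) \<in> borel_measurable (lborel \<Otimes>\<^sub>M lborel)"
        by measurable
      then show "(\<lambda>(u, y). indicator {..<t - y} u * ?g u * ?V y) \<in> borel_measurable (lborel \<Otimes>\<^sub>M lborel)"
        by (simp add: indicator_def of_bool_def)
    qed (auto simp: indicator_def)
    have inner: "(LINT y|lborel. indicator {..<t - y} u * ?g u * ?V y) = ?g u * fstep T (t - u)" for u
    proof -
      have "indicator {..<t - y} u * ?g u * ?V y = ?g u * (indicator {..<t - u} y * ?V y)" for y
        by (auto simp: indicator_def)
      then show ?thesis by (simp only: fstep_def[OF T] integral_mult_right_zero)
    qed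
    have GI: "(LINT y|lborel. G (t - y) * ?V y) = (LINT u|lborel. ?g u * fstep T (t - u))"
    proof -
      have "(LINT y|lborel. G (t - y) * ?V y) = (LINT y|lborel. LINT u|lborel. indicator {..<t - y} u * ?g u * ?V y)"
        unfolding G_def by simp
      also have "\<dots> = (LINT u|lborel. LINT y|lborel. indicator {..<t - y} u * ?g u * ?V y)"
        by (rule lborel_pair.Fubini_integral[OF gV])
      finally show ?thesis unfolding inner .
    qed
    have gfi: "integrable lborel (\<lambda>u. ?g u * fstep T (t - u))"
      using lborel_pair.integrable_fst'[OF gV] by (simp add: inner)
    then have gci: "integrable lborel (\<lambda>u. ?g u * cosk T (t - u))"
    proof -
      have "integrable lborel (\<lambda>u. ?g u * fstep T (t - u) - cV / 2 * ?g u)"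
        using gfi gi by auto
      then show ?thesis by (simp add: fe algebra_simps)
    qed
    have g1: "(LINT u|lborel. ?g u) = 1"
    proof -
      have "integrable lborel std_normal_density" by (simp add: integrable_normal_density)
      moreover have "integrable lborel (\<lambda>u. std_normal_density u * u)"
        using integrable_std_normal_moment[of 1] by simp
      moreover have "(LINT u|lborel. std_normal_density u * u) = 0"
        using integral_std_normal_moment_odd[of 0] by simp
      moreover have "?g u = std_normal_density u + C * (std_normal_density u * u)" for u
        by (simp add: edgeworth_density_def algebra_simps)
      ultimately show ?thesis by (simp add: integral_normal_density)
    qed
    define A where "A i \<tau> = indicator {0..T} \<tau> * ((1 - \<tau> / T) * ((t - w i) * sincr (\<tau> * (t - w i))))" for i \<tau>
    define Z where "Z \<tau> = indicator {0..T} \<tau> * ((1 - \<tau> / T) * (LINT u|lborel. ?g u * ((t - u) * sincr (\<tau> * (t - u)))))" for \<tau>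
    have i0T: "integrable lborel (indicator {0..T} :: real \<Rightarrow> real)"
      using T by (intro integrable_real_indicator) (auto simp: emeasure_lborel_Icc_eq)
    have kb: "\<bar>indicator {0..T} \<tau> * ((1 - \<tau> / T) * (a * sincr (\<tau> * a)))\<bar> \<le> indicator {0..T} \<tau> * \<bar>a\<bar>" for \<tau> a
    proof (cases "\<tau> \<in> {0..T}")
      case True
      then have "\<bar>1 - \<tau> / T\<bar> * (\<bar>a\<bar> * \<bar>sincr (\<tau> * a)\<bar>) \<le> 1 * (\<bar>a\<bar> * 1)"
        using T abs_sincr_le_1 by (intro mult_mono) auto
      then show ?thesis using True by (simp add: abs_mult)
    qed simp
    have Ai: "integrable lborel (A i)" for i
    proof (rule Bochner_Integration.integrable_bound)
      show "integrable lborel (\<lambda>\<tau>. indicator {0..T} \<tau> * \<bar>t - w i\<bar>)" using i0T by (rule integrable_mult_left)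
      show "A i \<in> borel_measurable lborel" unfolding A_def by measurable
    qed (use kb in \<open>auto simp: A_def intro!: AE_I2\<close>)
    have SA: "(\<Sum>i\<in>I. q i * cosk T (t - w i)) = (\<Sum>i\<in>I. q i * (LINT \<tau>|lborel. A i \<tau>)) / pi"
      unfolding cosk_def[OF T] A_def by (simp add: sum_divide_distrib)
    have "integrable lborel (\<lambda>u. \<bar>?g u\<bar> * \<bar>t\<bar> + \<bar>?g u\<bar> * \<bar>u\<bar>)"
      using edgeworth_density_moment(2)[of C 0] edgeworth_density_moment(2)[of C 1] by auto
    note pr = integrable_product_lborel[OF i0T this]
    have kp: "integrable (lborel \<Otimes>\<^sub>M lborel) (\<lambda>(\<tau>, u). ?g u * (indicator {0..T} \<tau> * ((1 - \<tau> / T) * ((t - u) * sincr (\<tau> * (t - u))))))"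
    proof (rule Bochner_Integration.integrable_bound[OF pr])
      show "(\<lambda>(\<tau>, u). ?g u * (indicator {0..T} \<tau> * ((1 - \<tau> / T) * ((t - u) * sincr (\<tau> * (t - u)))))) \<in> borel_measurable (lborel \<Otimes>\<^sub>M lborel)"
        by measurable
      have "\<bar>?g u * (indicator {0..T} \<tau> * ((1 - \<tau> / T) * ((t - u) * sincr (\<tau> * (t - u)))))\<bar>
         \<le> indicator {0..T} \<tau> * (\<bar>?g u\<bar> * \<bar>t\<bar> + \<bar>?g u\<bar> * \<bar>u\<bar>)" for \<tau> u
      proof -
        have "\<bar>?g u * (indicator {0..T} \<tau> * ((1 - \<tau> / T) * ((t - u) * sincr (\<tau> * (t - u)))))\<bar>
           \<le> \<bar>?g u\<bar> * (indicator {0..T} \<tau> * \<bar>t - u\<bar>)"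
          unfolding abs_mult[of "?g u"] by (intro mult_left_mono kb) simp
        also have "\<dots> \<le> \<bar>?g u\<bar> * (indicator {0..T} \<tau> * (\<bar>t\<bar> + \<bar>u\<bar>))"
          by (intro mult_left_mono) auto
        finally show ?thesis by (simp add: algebra_simps)
      qed
      then show "AE x in lborel \<Otimes>\<^sub>M lborel. norm (case x of (\<tau>, u) \<Rightarrow> ?g u * (indicator {0..T} \<tau> * ((1 - \<tau> / T) * ((t - u) * sincr (\<tau> * (t - u))))))
        \<le> norm (case x of (x, y) \<Rightarrow> indicator {0..T} x * (\<bar>?g y\<bar> * \<bar>t\<bar> + \<bar>?g y\<bar> * \<bar>y\<bar>))"
        by (intro AE_I2) (auto simp: abs_mult split: prod.split)
    qed
    have innZ: "(LINT u|lborel. ?g u * (indicator {0..T} \<tau> * ((1 - \<tau> / T) * ((t - u) * sincr (\<tau> * (t - u)))))) = Z \<tau>" for \<tau>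
    proof -
      have "?g u * (indicator {0..T} \<tau> * ((1 - \<tau> / T) * ((t - u) * sincr (\<tau> * (t - u)))))
        = (indicator {0..T} \<tau> * (1 - \<tau> / T)) * (?g u * ((t - u) * sincr (\<tau> * (t - u))))" for u by (simp only: mult_ac)
      then show ?thesis unfolding Z_def by (simp only: integral_mult_right_zero mult.assoc)
    qed
    have Zi: "integrable lborel Z"
      using lborel_pair.integrable_fst'[OF kp] by (simp add: innZ)
    have IZ: "(LINT u|lborel. ?g u * cosk T (t - u)) = (LINT \<tau>|lborel. Z \<tau>) / pi"
    proof -
      have "(LINT u|lborel. ?g u * cosk T (t - u)) = (LINT u|lborel. (LINT \<tau>|lborel. ?g u * (indicator {0..T} \<tau> * ((1 - \<tau> / T) * ((t - u) * sincr (\<tau> * (t - u)))))) / pi)"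
        unfolding cosk_def[OF T] by simp
      also have "\<dots> = (LINT u|lborel. (LINT \<tau>|lborel. ?g u * (indicator {0..T} \<tau> * ((1 - \<tau> / T) * ((t - u) * sincr (\<tau> * (t - u))))))) / pi"
        by (rule integral_divide_zero)
      also have "\<dots> = (LINT \<tau>|lborel. Z \<tau>) / pi"
        unfolding lborel_pair.Fubini_integral[OF kp] innZ ..
      finally show ?thesis .
    qed
    have "(LINT y|lborel. \<Delta> (t - y) * ?V y) = (\<Sum>i\<in>I. q i * fstep T (t - w i)) - (LINT u|lborel. ?g u * fstep T (t - u))"
      unfolding \<Delta>_def left_diff_distrib using FV GV FI GI by simp
    \<comment> \<open>Both masses equal 1, so the half masses of the kernel cancel.\<close>
    also have "\<dots> = (\<Sum>i\<in>I. q i * cosk T (t - w i)) - (LINT u|lborel. ?g u * cosk T (t - u))"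
    proof -
      have "(\<Sum>i\<in>I. q i * fstep T (t - w i)) = cV / 2 * (\<Sum>i\<in>I. q i) + (\<Sum>i\<in>I. q i * cosk T (t - w i))"
        unfolding fe sum_distrib_left sum.distrib[symmetric] by (intro sum.cong refl) (simp add: algebra_simps)
      moreover have "(LINT u|lborel. ?g u * fstep T (t - u)) = cV / 2 * (LINT u|lborel. ?g u) + (LINT u|lborel. ?g u * cosk T (t - u))"
      proof -
        have "?g u * fstep T (t - u) = cV / 2 * ?g u + ?g u * cosk T (t - u)" for u
          by (simp add: fe algebra_simps)
        then show ?thesis using gi gci by simp
      qed
      ultimately show ?thesis using q g1 by simp
    qed
    also have "\<dots> = (LINT \<tau>|lborel. (\<Sum>i\<in>I. q i * A i \<tau>) - Z \<tau>) / pi"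
      unfolding SA IZ using Ai Zi by (simp add: Bochner_Integration.integral_sum diff_divide_distrib)
    finally have eq: "(LINT y|lborel. \<Delta> (t - y) * ?V y) = (LINT \<tau>|lborel. (\<Sum>i\<in>I. q i * A i \<tau>) - Z \<tau>) / pi" .
    have "\<bar>LINT \<tau>|lborel. (\<Sum>i\<in>I. q i * A i \<tau>) - Z \<tau>\<bar> \<le> (LINT \<tau>|lborel. \<bar>(\<Sum>i\<in>I. q i * A i \<tau>) - Z \<tau>\<bar>)"
      by (rule integral_abs_bound)
    also have "\<dots> \<le> (LINT \<tau>|lborel. indicator {0..T} \<tau> * b \<tau>)"
    proof (rule integral_mono_AE)
      show "integrable lborel (\<lambda>\<tau>. \<bar>(\<Sum>i\<in>I. q i * A i \<tau>) - Z \<tau>\<bar>)"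
        using Ai Zi by (intro integrable_abs Bochner_Integration.integrable_diff Bochner_Integration.integrable_sum integrable_mult_right) auto
      \<comment> \<open>The frequency 0, where the division by \<tau> is meaningless, is a null
        set.\<close>
      have pt: "\<bar>(\<Sum>i\<in>I. q i * A i \<tau>) - Z \<tau>\<bar> \<le> indicator {0..T} \<tau> * b \<tau>" if "\<tau> \<noteq> 0" for \<tau>
      proof (cases "\<tau> \<in> {0..T}")
        case False
        then show ?thesis by (simp add: A_def Z_def)
      next
        case True
        with that have \<tau>: "0 < \<tau>" "\<tau> \<le> T" by auto
        define e where "e = exp (- \<tau>\<^sup>2 / 2)"
        define R where "R = (\<Sum>i\<in>I. q i * cos (\<tau> * w i)) - e"
        define S where "S = (\<Sum>i\<in>I. q i * sin (\<tau> * w i)) - e * (\<tau> * C)"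
        have sc: "a * sincr (\<tau> * a) = sin (\<tau> * a) / \<tau>" for a
          using \<tau> by (simp add: sincr_def)
        have "(\<Sum>i\<in>I. q i * A i \<tau>) - Z \<tau> = (1 - \<tau> / T) * ((\<Sum>i\<in>I. q i * sin (\<tau> * (t - w i))) - (LINT u|lborel. ?g u * sin (\<tau> * (t - u)))) / \<tau>"
        proof -
          have "A i \<tau> = (1 - \<tau> / T) / \<tau> * sin (\<tau> * (t - w i))" for i
            unfolding A_def sc using True by simp
          then have "(\<Sum>i\<in>I. q i * A i \<tau>) = (1 - \<tau> / T) / \<tau> * (\<Sum>i\<in>I. q i * sin (\<tau> * (t - w i)))"
            unfolding sum_distrib_left by (intro sum.cong refl) (simp only: mult_ac)
          moreover have "Z \<tau> = (1 - \<tau> / T) / \<tau> * (LINT u|lborel. ?g u * sin (\<tau> * (t - u)))"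
            unfolding Z_def sc times_divide_eq_right integral_divide_zero using True by simp
          ultimately show ?thesis by (simp only: right_diff_distrib[symmetric] times_divide_eq_left diff_divide_distrib[symmetric])
        qed
        also have "(\<Sum>i\<in>I. q i * sin (\<tau> * (t - w i))) - (LINT u|lborel. ?g u * sin (\<tau> * (t - u))) = sin (\<tau> * t) * R - cos (\<tau> * t) * S"
        proof -
          have "(\<Sum>i\<in>I. q i * sin (\<tau> * (t - w i))) = sin (\<tau> * t) * (\<Sum>i\<in>I. q i * cos (\<tau> * w i)) - cos (\<tau> * t) * (\<Sum>i\<in>I. q i * sin (\<tau> * w i))"
            unfolding sum_distrib_left sum_subtractf[symmetric] right_diff_distrib sin_diff
            by (intro sum.cong refl) (simp add: algebra_simps)
          then show ?thesis unfolding edgeworth_sin R_def S_def e_def by (simp add: algebra_simps)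
        qed
        finally have D: "\<bar>(\<Sum>i\<in>I. q i * A i \<tau>) - Z \<tau>\<bar> = \<bar>1 - \<tau> / T\<bar> * \<bar>sin (\<tau> * t) * R - cos (\<tau> * t) * S\<bar> / \<tau>"
          using \<tau> by (simp add: abs_mult)
        \<comment> \<open>R and S are the real and imaginary parts of the difference of the
          transforms. Rotation by a unimodular number makes the bound independent of t.\<close>
        have "sin (\<tau> * t) * R - cos (\<tau> * t) * S = Im (cis (\<tau> * t) * cnj (Complex R S))" by simp
        then have "\<bar>sin (\<tau> * t) * R - cos (\<tau> * t) * S\<bar> \<le> cmod (cis (\<tau> * t) * cnj (Complex R S))"
          using abs_Im_le_cmod by metis
        also have "\<dots> = cmod (Complex R S)" by (simp add: norm_mult)
        also have "Complex R S = (\<Sum>i\<in>I. of_real (q i) * cis (\<tau> * w i)) - of_real (exp (- \<tau>\<^sup>2 / 2)) * Complex 1 (\<tau> * C)"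
          by (simp add: complex_eq_iff R_def S_def e_def)
        also have "cmod \<dots> \<le> \<tau> * b \<tau>" by (rule b[OF \<tau>])
        finally have "\<bar>1 - \<tau> / T\<bar> * \<bar>sin (\<tau> * t) * R - cos (\<tau> * t) * S\<bar> \<le> 1 * (\<tau> * b \<tau>)"
          using \<tau> T by (intro mult_mono) auto
        then show ?thesis using True \<tau> unfolding D by (simp add: divide_le_eq mult.commute)
      qed
      show "AE \<tau> in lborel. \<bar>(\<Sum>i\<in>I. q i * A i \<tau>) - Z \<tau>\<bar> \<le> indicator {0..T} \<tau> * b \<tau>"
        using AE_lborel_singleton[of "0::real"] by eventually_elim (rule pt)
    qed (rule bi)
    finally show ?thesis unfolding eq by (simp add: divide_right_mono)
  qed
  have "\<bar>\<Delta> x\<bar> \<le> 16 * pi * ((LINT \<tau>|lborel. indicator {0..T} \<tau> * b \<tau>) / pi + 40 * m / T)"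
  proof (rule smoothing_inequality[OF T _ _ m(1) mono E])
    show "\<Delta> \<in> borel_measurable borel" unfolding \<Delta>_def by measurable
    show "\<bar>\<Delta> x\<bar> \<le> 1 + B" for x using F01[of x] GB[of x] by (auto simp: \<Delta>_def)
  qed
  moreover have "F x = (\<Sum>i | i \<in> I \<and> w i < x. q i)"
    unfolding F_def using I by (intro sum.mono_neutral_cong_right) (auto simp: indicator_def)
  ultimately show ?thesis unfolding \<Delta>_def G_def edgeworth_integral by simp
qed

section \<open>The central limit theorem\<close>

text \<open>Telescoping: concavity of the power \<alpha>, in the form of weighted arithmetic and
  geometric means, bounds each summand by \<alpha>^(-1) times the increment of the power.\<close>

lemma sum_powr_le:
  assumes \<alpha>: "0 < \<alpha>" "\<alpha> \<le> 1"
  shows "(\<Sum>j=1..x. real j powr (\<alpha> - 1)) \<le> real x powr \<alpha> / \<alpha>"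
proof (induction x)
  case (Suc x)
  have "real x powr \<alpha> \<le> real (Suc x) powr \<alpha> - \<alpha> * real (Suc x) powr (\<alpha> - 1)"
  proof (cases "x = 0")
    case True
    then show ?thesis using \<alpha> by simp
  next
    case False
    have "(real x / real (Suc x)) powr \<alpha> * 1 powr (1 - \<alpha>) \<le> \<alpha> * (real x / real (Suc x)) + (1 - \<alpha>) * 1"
      using \<alpha> False by (intro Youngs_inequality_0) auto
    also have "\<dots> = 1 - \<alpha> / real (Suc x)" by (simp add: field_simps)
    finally have "real (Suc x) powr \<alpha> * (real x / real (Suc x)) powr \<alpha> \<le> real (Suc x) powr \<alpha> * (1 - \<alpha> / real (Suc x))"
      by (intro mult_left_mono) auto
    also have "real (Suc x) powr \<alpha> * (real x / real (Suc x)) powr \<alpha> = real x powr \<alpha>"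
      by (simp add: powr_divide)
    also have "real (Suc x) powr \<alpha> * (1 - \<alpha> / real (Suc x)) = real (Suc x) powr \<alpha> - \<alpha> * real (Suc x) powr (\<alpha> - 1)"
      by (simp add: powr_diff right_diff_distrib)
    finally show ?thesis .
  qed
  then have "real x powr \<alpha> / \<alpha> \<le> (real (Suc x) powr \<alpha> - \<alpha> * real (Suc x) powr (\<alpha> - 1)) / \<alpha>"
    using \<alpha> by (intro divide_right_mono) auto
  also have "\<dots> = real (Suc x) powr \<alpha> / \<alpha> - real (Suc x) powr (\<alpha> - 1)" using \<alpha> by (simp add: diff_divide_distrib)
  finally show ?case using Suc.IH by simp
qed simp

text \<open>Below (x + 1)/2 the singular factor is at most 2 and the power \<kappa> makes the sum
  converge at 0. Above, 1/j is at most 2/(x + 1), and the singularity is summable because \<gamma> <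
  1.\<close>

lemma wght_sum_le:
  assumes k: "0 < \<kappa>" "\<kappa> \<le> 1" and g: "0 \<le> \<gamma>" "\<gamma> < 1"
  shows "(\<Sum>j=1..x. wght \<kappa> \<gamma> x j / real j) \<le> 2 / \<kappa> + 2 / (1 - \<gamma>)"
proof -
  define X where "X = real (x + 1)"
  have X: "X \<ge> 1" by (simp add: X_def)
  have "wght \<kappa> \<gamma> x j / real j \<le> 2 * X powr (- \<kappa>) * real j powr (\<kappa> - 1) + 2 * X powr (\<gamma> - 1) * real (x + 1 - j) powr (- \<gamma>)"
    if j: "j \<in> {1..x}" for j
  proof (cases "2 * real j \<le> X")
    case True
    have "(X / (X - real j)) powr \<gamma> \<le> 2 powr \<gamma>"
      using True j g X by (intro powr_mono2) (auto simp: field_simps X_def)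
    also have "\<dots> \<le> 2" using powr_mono[of \<gamma> 1 2] g by simp
    finally have "wght \<kappa> \<gamma> x j / real j \<le> (real j / X) powr \<kappa> * 2 / real j"
      unfolding wght_def X_def[symmetric] by (intro divide_right_mono mult_left_mono) auto
    also have "\<dots> = 2 * X powr (- \<kappa>) * real j powr (\<kappa> - 1)"
      using j X by (simp add: powr_divide powr_minus_divide powr_diff)
    finally show ?thesis by (simp add: add_increasing2)
  next
    case False
    have r: "real (x + 1 - j) = X - real j" using j by (simp add: X_def of_nat_diff)
    have Xj: "X - real j > 0" using j by (auto simp: X_def)
    have "(real j / X) powr \<kappa> \<le> 1" using j k by (intro powr_le1) (auto simp: X_def)
    then have "wght \<kappa> \<gamma> x j / real j \<le> 1 * (X / (X - real j)) powr \<gamma> / real j"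
      unfolding wght_def X_def[symmetric] by (intro divide_right_mono mult_right_mono) auto
    also have "\<dots> \<le> (X / (X - real j)) powr \<gamma> / (X / 2)"
      unfolding mult_1 using False X j by (intro divide_left_mono) auto
    also have "\<dots> = 2 * X powr (\<gamma> - 1) * real (x + 1 - j) powr (- \<gamma>)"
      unfolding r using X Xj by (simp add: powr_divide powr_minus_divide powr_diff mult_ac)
    finally show ?thesis by (simp add: add_increasing)
  qed
  then have "(\<Sum>j=1..x. wght \<kappa> \<gamma> x j / real j)
      \<le> (\<Sum>j=1..x. 2 * X powr (- \<kappa>) * real j powr (\<kappa> - 1) + 2 * X powr (\<gamma> - 1) * real (x + 1 - j) powr (- \<gamma>))"
    by (rule sum_mono)
  also have "\<dots> = 2 * X powr (- \<kappa>) * (\<Sum>j=1..x. real j powr (\<kappa> - 1)) + 2 * X powr (\<gamma> - 1) * (\<Sum>j=1..x. real (x + 1 - j) powr (- \<gamma>))"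
    by (simp add: sum.distrib sum_distrib_left)
  also have "(\<Sum>j=1..x. real (x + 1 - j) powr (- \<gamma>)) = (\<Sum>j=1..x. real j powr ((1 - \<gamma>) - 1))"
    by (rule sum.reindex_bij_witness[where i="\<lambda>j. x + 1 - j" and j="\<lambda>j. x + 1 - j"]) auto
  also have "2 * X powr (- \<kappa>) * (\<Sum>j=1..x. real j powr (\<kappa> - 1)) \<le> 2 * X powr (- \<kappa>) * (X powr \<kappa> / \<kappa>)"
  proof (intro mult_left_mono order_trans[OF sum_powr_le] divide_right_mono powr_mono2)
  qed (use k in \<open>auto simp: X_def\<close>)
  also have "\<dots> = 2 / \<kappa>" using X by (simp add: powr_minus)
  also have "2 * X powr (\<gamma> - 1) * (\<Sum>j=1..x. real j powr ((1 - \<gamma>) - 1)) \<le> 2 * X powr (\<gamma> - 1) * (X powr (1 - \<gamma>) / (1 - \<gamma>))"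
  proof (intro mult_left_mono order_trans[OF sum_powr_le] divide_right_mono powr_mono2)
  qed (use g in \<open>auto simp: X_def\<close>)
  also have "\<dots> = 2 / (1 - \<gamma>)" using X by (simp flip: powr_add)
  finally show ?thesis by simp
qed

text \<open>The condition on \<open>\<gamma>\<close> says that the singularity of \<open>wght\<close> at \<open>j = x + 1\<close> stays integrable
  after raising to the exponent conjugate to \<open>p\<close>; this is where \<open>p > 1 / dmin\<close> is needed.\<close>

lemma hoelder_wght:
  fixes p :: ereal
  assumes k: "0 < \<kappa>" "\<kappa> \<le> 1" and g: "0 \<le> \<gamma>" and p: "p > 1"
    and gp: "p \<noteq> \<infinity> \<Longrightarrow> \<gamma> < 1 - 1 / real_of_ereal p" "\<gamma> < 1"
  obtains H where "H > 0" "\<And>n ht x. 1 \<le> x \<Longrightarrow> x \<le> n \<Longrightarrow>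
     (\<Sum>j=1..x. \<bar>ht j\<bar> / real j * wght \<kappa> \<gamma> x j) \<le> H * sqrt (L_two_root n ht p)"
proof (cases "p = \<infinity>")
  case True
  show ?thesis
  proof (rule that[of "2 / \<kappa> + 2 / (1 - \<gamma>)"])
    show "2 / \<kappa> + 2 / (1 - \<gamma>) > 0" using k gp by (simp add: add_pos_pos)
    fix n x :: nat and ht :: "nat \<Rightarrow> real" assume x: "1 \<le> x" "x \<le> n"
    define M where "M = Max ((\<lambda>j. \<bar>ht j\<bar>) ` {1..n})"
    have M: "\<bar>ht j\<bar> \<le> M" if "j \<in> {1..n}" for j unfolding M_def using that by (intro Max_ge) auto
    have M0: "M \<ge> 0" using M[of 1] x by auto
    have "(\<Sum>j=1..x. \<bar>ht j\<bar> / real j * wght \<kappa> \<gamma> x j) \<le> (\<Sum>j=1..x. M * (wght \<kappa> \<gamma> x j / real j))"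
    proof (rule sum_mono)
      fix j assume "j \<in> {1..x}"
      then have "\<bar>ht j\<bar> * (wght \<kappa> \<gamma> x j / real j) \<le> M * (wght \<kappa> \<gamma> x j / real j)"
        using M x by (intro mult_right_mono) (auto simp: wght_def)
      then show "\<bar>ht j\<bar> / real j * wght \<kappa> \<gamma> x j \<le> M * (wght \<kappa> \<gamma> x j / real j)" by simp
    qed
    also have "\<dots> = M * (\<Sum>j=1..x. wght \<kappa> \<gamma> x j / real j)" by (simp add: sum_distrib_left)
    also have "\<dots> \<le> M * (2 / \<kappa> + 2 / (1 - \<gamma>))"
      using M0 k g gp by (intro mult_left_mono wght_sum_le) auto
    also have "M = sqrt (L_two_root n ht p)" using M0 True by (simp add: L_two_root_def M_def)
    finally show "(\<Sum>j=1..x. \<bar>ht j\<bar> / real j * wght \<kappa> \<gamma> x j) \<le> (2 / \<kappa> + 2 / (1 - \<gamma>)) * sqrt (L_two_root n ht p)"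
      by (simp add: mult.commute)
  qed
next
  case False
  define r where "r = real_of_ereal p"
  have pr: "p = ereal r" using False p unfolding r_def by (cases p) auto
  have r: "r > 1" using p pr by simp
  \<comment> \<open>The exponent conjugate to r. In these terms \<gamma> < 1 - 1/r says exactly that
    \<gamma> q < 1.\<close>
  define q where "q = r / (r - 1)"
  have q: "q > 1" using r by (simp add: q_def field_simps)
  have rq: "1 / r + 1 / q = 1" using r by (simp add: q_def field_simps)
  have gq: "\<gamma> * q < 1"
  proof -
    have "\<gamma> < (r - 1) / r" using gp(1) False r by (simp add: r_def[symmetric] field_simps)
    then show ?thesis using r by (simp add: q_def field_simps)
  qed
  define M where "M = 2 / \<kappa> + 2 / (1 - \<gamma> * q)"
  have M: "M > 0" using k gq unfolding M_def by (simp add: add_pos_pos)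
  show ?thesis
  proof (rule that[of "1 + M"])
    show "1 + M > 0" using M by simp
    fix n x :: nat and ht :: "nat \<Rightarrow> real" assume x: "1 \<le> x" "x \<le> n"
    define \<rho> where "\<rho> = L_sum n ht r powr (1 / r)"
    have L0: "L_sum n ht r \<ge> 0" unfolding L_sum_def by (intro sum_nonneg) auto
    have rho: "sqrt (L_two_root n ht p) = \<rho>"
    proof -
      have "\<rho>\<^sup>2 = L_two_root n ht p"
        using False L0 by (cases "L_sum n ht r = 0")
          (simp_all add: L_two_root_def \<rho>_def r_def[symmetric] powr_powr powr_realpow[symmetric] del: powr_realpow)
      moreover have "\<rho> \<ge> 0" by (simp add: \<rho>_def)
      ultimately show ?thesis by (metis real_sqrt_abs abs_of_nonneg)
    qed
    show "(\<Sum>j=1..x. \<bar>ht j\<bar> / real j * wght \<kappa> \<gamma> x j) \<le> (1 + M) * sqrt (L_two_root n ht p)"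
    proof (cases "\<rho> = 0")
      case True
      then have "L_sum n ht r = 0" by (simp add: \<rho>_def)
      then have "ht j = 0" if "j \<in> {1..n}" for j
        using that unfolding L_sum_def by (subst (asm) sum_nonneg_eq_0_iff) auto
      then have "(\<Sum>j=1..x. \<bar>ht j\<bar> / real j * wght \<kappa> \<gamma> x j) = 0" using x by (intro sum.neutral) auto
      then show ?thesis using rho True by simp
    next
      case False
      then have rp: "\<rho> > 0" by (simp add: \<rho>_def)
      have rpr: "\<rho> powr r = L_sum n ht r" using r L0 False by (simp add: \<rho>_def powr_powr)
      have "(\<Sum>j=1..x. \<bar>ht j\<bar> / real j * wght \<kappa> \<gamma> x j) \<le> (\<Sum>j=1..x. \<rho> * (\<bar>ht j\<bar> powr r / real j / \<rho> powr r + wght \<kappa> (\<gamma> * q) x j / real j))"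
      proof (rule sum_mono)
        fix j assume j: "j \<in> {1..x}"
        have w0: "wght \<kappa> \<gamma> x j \<ge> 0" by (simp add: wght_def)
        \<comment> \<open>Hoelder's inequality by way of Young's: after division by \<rho> the r-th
          powers have total at most 1, and the q-th power of the weight is at most the weight with
          \<gamma> q in place of \<gamma>, because its first base is at most 1.\<close>
        have "(\<bar>ht j\<bar> / \<rho>) * wght \<kappa> \<gamma> x j \<le> (\<bar>ht j\<bar> / \<rho>) powr r / r + wght \<kappa> \<gamma> x j powr q / q"
          using r q rq rp w0 by (intro Youngs_inequality) auto
        also have "\<dots> \<le> (\<bar>ht j\<bar> / \<rho>) powr r + wght \<kappa> \<gamma> x j powr q"
          using r q by (intro add_mono) (auto simp: divide_le_eq mult_le_cancel_left1)
        also have "wght \<kappa> \<gamma> x j powr q \<le> wght \<kappa> (\<gamma> * q) x j"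
        proof -
          have "wght \<kappa> \<gamma> x j powr q = (real j / real (x + 1)) powr (\<kappa> * q) * (real (x + 1) / (real (x + 1) - real j)) powr (\<gamma> * q)"
            unfolding wght_def by (simp add: powr_mult powr_powr)
          also have "(real j / real (x + 1)) powr (\<kappa> * q) \<le> (real j / real (x + 1)) powr \<kappa>"
            using j k q by (intro powr_mono') (auto simp: field_simps)
          finally show ?thesis unfolding wght_def by (simp add: mult_right_mono)
        qed
        also have "(\<bar>ht j\<bar> / \<rho>) powr r = \<bar>ht j\<bar> powr r / \<rho> powr r" using rp by (simp add: powr_divide)
        finally have "\<rho> / real j * ((\<bar>ht j\<bar> / \<rho>) * wght \<kappa> \<gamma> x j) \<le> \<rho> / real j * (\<bar>ht j\<bar> powr r / \<rho> powr r + wght \<kappa> (\<gamma> * q) x j)"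
          using rp by (intro mult_left_mono) auto
        then show "\<bar>ht j\<bar> / real j * wght \<kappa> \<gamma> x j \<le> \<rho> * (\<bar>ht j\<bar> powr r / real j / \<rho> powr r + wght \<kappa> (\<gamma> * q) x j / real j)"
          using rp j by (simp add: field_simps)
      qed
      also have "\<dots> = \<rho> * ((\<Sum>j=1..x. \<bar>ht j\<bar> powr r / real j) / \<rho> powr r + (\<Sum>j=1..x. wght \<kappa> (\<gamma> * q) x j / real j))"
        by (simp add: sum_distrib_left sum.distrib sum_divide_distrib distrib_left)
      also have "\<dots> \<le> \<rho> * (1 + M)"
      proof (intro mult_left_mono add_mono)
        have "(\<Sum>j=1..x. \<bar>ht j\<bar> powr r / real j) \<le> L_sum n ht r"
          unfolding L_sum_def using x by (intro sum_mono2) auto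
        moreover have "L_sum n ht r > 0" using rpr rp powr_gt_zero[of \<rho> r] by simp
        ultimately show "(\<Sum>j=1..x. \<bar>ht j\<bar> powr r / real j) / \<rho> powr r \<le> 1"
          unfolding rpr by (subst divide_le_eq_1_pos)
        show "(\<Sum>j=1..x. wght \<kappa> (\<gamma> * q) x j / real j) \<le> M"
          unfolding M_def using k g gq q by (intro wght_sum_le) auto
      qed (use rp in auto)
      finally show ?thesis unfolding rho by (simp add: mult.commute)
    qed
  qed
qed

lemma cis_taylor:
  "cmod (cis y - 1) \<le> \<bar>y\<bar>"
  "cmod (cis y - 1 - \<i> * y) \<le> y\<^sup>2 / 2"
  "cmod (cis y - 1 - \<i> * y + of_real (y\<^sup>2 / 2)) \<le> \<bar>y\<bar> ^ 3 / 6"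
proof -
  show "cmod (cis y - 1) \<le> \<bar>y\<bar>" using iexp_approx1[of y 0] by (simp add: cis_conv_exp)
  show "cmod (cis y - 1 - \<i> * y) \<le> y\<^sup>2 / 2"
    using iexp_approx1[of y 1] by (simp add: cis_conv_exp numeral_2_eq_2 diff_diff_eq)
  show "cmod (cis y - 1 - \<i> * y + of_real (y\<^sup>2 / 2)) \<le> \<bar>y\<bar> ^ 3 / 6"
    using iexp_approx1[of y 2]
    by (simp add: cis_conv_exp numeral_2_eq_2 numeral_3_eq_3 power2_eq_square algebra_simps)
qed

lemma norm_exp_minus_1_le: "cmod (exp z - 1) \<le> cmod z * exp (cmod z)"
proof -
  have "cmod (exp z - 1) \<le> exp \<bar>Re z\<bar> * cmod z" using Taylor_exp[of z 0] by simp
  also have "\<dots> \<le> exp (cmod z) * cmod z" using abs_Re_le_cmod by (intro mult_right_mono) auto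
  finally show ?thesis by (simp add: mult.commute)
qed

section \<open>The characteristic function of the normalised additive function\<close>

locale clt_setup =
  fixes n :: nat and dh ht :: "nat \<Rightarrow> real" and a D \<kappa> R0 :: real
  assumes n: "n \<ge> 1"
    and kap: "0 < \<kappa>" "868 * \<kappa> \<le> a" and a: "a \<le> 1" and D: "1 \<le> D"
    and dh: "\<And>j. 1 \<le> j \<Longrightarrow> j \<le> n \<Longrightarrow> a \<le> dh j \<and> dh j \<le> D"
    and variance: "(\<Sum>k=1..n. dh k * (ht k)\<^sup>2 / real k) = 1"
    and R0: "0 \<le> R0" "\<And>x. 1 \<le> x \<Longrightarrow> x \<le> n \<Longrightarrow> (\<Sum>j=1..x. \<bar>ht j\<bar> / real j * wght \<kappa> (1 - a + 6 * \<kappa>) x j) \<le> R0"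
begin

definition ft :: "real \<Rightarrow> nat \<Rightarrow> complex" where "ft t j = cis (t * ht j)"
text \<open>The constant in the lower bound for \<open>p_avg\<close>, with the least admissible
  integer L.\<close>

definition c0 :: real where "c0 = a / 2 * exp (- (D * real (nat \<lceil>2 * D\<rceil>)))"
definition P :: real where "P = p_avg dh n"
definition L3 :: real where "L3 = L_sum n ht 3"
text \<open>96 C5 stems from the second differences, exp (81 \<kappa>) is the part of
  \<open>BB\<close> free of \<open>Wf\<close>, D^2 comes from |u_j| \<le> D |t h_j| / j, and 1 / c0
  from division by p_n.\<close>

definition KK :: real where "KK = 96 * tilted.C5 a D \<kappa> * exp (81 * \<kappa>) * D\<^sup>2 / c0"
definition KC :: real where "KC = 2 * tilted.C5 a D \<kappa> * exp (81 * \<kappa>) * D / c0"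

lemma a_pos: "a > 0" using kap by simp

lemma dh_nonneg: "1 \<le> j \<Longrightarrow> j \<le> n \<Longrightarrow> 0 \<le> dh j" using dh[of j] a_pos by auto

lemma tilted_ft: "tilted n dh (ft t) a D \<kappa>"
  using kap a D dh by unfold_locales (auto simp: ft_def)

lemma c0_pos: "c0 > 0" unfolding c0_def using a_pos by simp

lemma C5_pos: "tilted.C5 a D \<kappa> > 0"
  using tilted.C5_ge[OF tilted_ft[of 0]] tilted.C3_ge[OF tilted_ft[of 0]] by linarith

text \<open>The natural size of an n-th coefficient is at most a constant times p_n, so absolute
  errors become errors relative to p_n.\<close>

lemma exp_Lam_le: "exp (tilted.Lam dh n) / real (n + 1) \<le> P / c0" and P_pos: "P > 0"
proof -
  have "c0 * (exp (tilted.Lam dh n) / real n) \<le> P"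
    unfolding c0_def P_def tilted.Lam_def[OF tilted_ft]
    by (rule p_avg_lower_bound[OF a_pos dh D _ n]) linarith+
  moreover have "exp (tilted.Lam dh n) / real (n + 1) \<le> exp (tilted.Lam dh n) / real n"
    using n by (intro divide_left_mono) auto
  ultimately have "c0 * (exp (tilted.Lam dh n) / real (n + 1)) \<le> P"
    using c0_pos by (meson less_imp_le mult_left_mono order_trans)
  then show le: "exp (tilted.Lam dh n) / real (n + 1) \<le> P / c0"
    using c0_pos by (simp add: pos_le_divide_eq mult.commute)
  have "0 < exp (tilted.Lam dh n) / real (n + 1)" by simp
  then have "0 < P / c0" using le by linarith
  then show "P > 0" using c0_pos by (simp add: zero_less_divide_iff)
qed

lemma rcond_scaled:
  assumes "\<And>j. 0 \<le> v j" "s \<ge> 0" "\<And>j. 1 \<le> j \<Longrightarrow> j \<le> n \<Longrightarrow> v j \<le> s * (\<bar>ht j\<bar> / real j)"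
  shows "tilted.rcond n a \<kappa> v (s * R0)"
  unfolding tilted.rcond_def[OF tilted_ft] tilted.gam_def[OF tilted_ft]
proof (intro conjI allI impI)
  fix x assume x: "1 \<le> x" "x \<le> n"
  have "(\<Sum>j=1..x. v j * wght \<kappa> (1 - a + 6 * \<kappa>) x j)
    \<le> (\<Sum>j=1..x. s * (\<bar>ht j\<bar> / real j * wght \<kappa> (1 - a + 6 * \<kappa>) x j))"
    unfolding mult.assoc[symmetric] using assms(3) x by (intro sum_mono mult_right_mono) (auto simp: wght_def)
  also have "\<dots> \<le> s * R0"
    unfolding sum_distrib_left[symmetric] using R0(2)[OF x] assms(2) by (rule mult_left_mono)
  finally show "(\<Sum>j=1..x. v j * wght \<kappa> (1 - a + 6 * \<kappa>) x j) \<le> s * R0" .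
qed (use assms R0 in auto)

text \<open>The correction is a weighted sum of first differences of the p_m, the case f = 1 and s =
  0 of the general bound; there \<open>Wf\<close> vanishes and \<open>BB\<close> is exp (81
  \<kappa>).\<close>

lemma C_corr_le: "\<bar>C_corr n dh ht\<bar> \<le> KC * R0"
proof -
  interpret t: tilted n dh "ft 0" a D \<kappa> by (rule tilted_ft)
  have N: "ecoef_int (t.cs 0) (int m) = complex_of_real (p_avg dh m)" for m
    by (simp add: p_avg_eq_ecoef t.cs_def[abs_def])
  have N': "ecoef_int (t.cs 0) (int n - int j) = complex_of_real (p_avg dh (n - j))" if "j \<in> {1..n}" for j
  proof -
    have "int n - int j = int (n - j)" using that by auto
    then show ?thesis by (simp only: N)
  qed
  have BB: "t.BB = exp (81 * \<kappa>)" by (simp add: t.BB_def t.Wf_def ft_def mult.commute)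
  have "(\<Sum>j=1..n. \<bar>ht j\<bar> / real j * cmod (ecoef_int (t.cs (of_real 0)) (int n) - ecoef_int (t.cs (of_real 0)) (int n - int j)))
     \<le> 2 * t.C5 * t.BB * t.QQ 0 * (1 * R0) * t.qq n powr t.gam"
    by (rule t.sum_diff_all_le[OF rcond_scaled]) auto
  also have "\<dots> = 2 * t.C5 * exp (81 * \<kappa>) * R0 * (exp (t.Lam n) / real (n + 1))"
    by (simp add: t.QQ_def t.psi_def t.qq_def BB)
  also have "\<dots> \<le> 2 * t.C5 * exp (81 * \<kappa>) * R0 * (P / c0)"
    using C5_pos R0(1) by (intro mult_left_mono exp_Lam_le) auto
  finally have S0: "(\<Sum>j=1..n. \<bar>ht j\<bar> / real j * cmod (ecoef_int (t.cs (of_real 0)) (int n) - ecoef_int (t.cs (of_real 0)) (int n - int j)))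
     \<le> 2 * t.C5 * exp (81 * \<kappa>) * R0 * (P / c0)" .
  have S: "(\<Sum>j=1..n. \<bar>ht j\<bar> / real j * \<bar>P - p_avg dh (n - j)\<bar>) \<le> 2 * t.C5 * exp (81 * \<kappa>) * R0 * (P / c0)"
  proof -
    have "\<bar>P - p_avg dh (n - j)\<bar> = cmod (ecoef_int (t.cs (of_real 0)) (int n) - ecoef_int (t.cs (of_real 0)) (int n - int j))"
      if "j \<in> {1..n}" for j
      unfolding of_real_0 N N'[OF that] P_def of_real_diff[symmetric] norm_of_real ..
    then show ?thesis using S0 by (simp only: cong: sum.cong)
  qed
  have "\<bar>C_corr n dh ht\<bar> \<le> (\<Sum>j=1..n. \<bar>dh j * (ht j / real j) * (p_avg dh (n - j) / P - 1)\<bar>)"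
    unfolding C_corr_def P_def by (rule sum_abs)
  also have "\<dots> \<le> (\<Sum>j=1..n. D / P * (\<bar>ht j\<bar> / real j * \<bar>P - p_avg dh (n - j)\<bar>))"
  proof (rule sum_mono)
    fix j assume j: "j \<in> {1..n}"
    have "\<bar>p_avg dh (n - j) / P - 1\<bar> = \<bar>P - p_avg dh (n - j)\<bar> / P"
    proof -
      have "p_avg dh (n - j) / P - 1 = (p_avg dh (n - j) - P) / P" using P_pos by (simp add: diff_divide_distrib)
      then show ?thesis using P_pos by (simp only: abs_divide abs_minus_commute[of P] abs_of_pos)
    qed
    then have "\<bar>dh j * (ht j / real j) * (p_avg dh (n - j) / P - 1)\<bar> = dh j * (\<bar>ht j\<bar> / real j * (\<bar>P - p_avg dh (n - j)\<bar> / P))"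
      using dh_nonneg[of j] j by (simp add: abs_mult mult_ac)
    also have "\<dots> \<le> D * (\<bar>ht j\<bar> / real j * (\<bar>P - p_avg dh (n - j)\<bar> / P))"
      using dh[of j] j P_pos by (intro mult_right_mono) auto
    finally show "\<bar>dh j * (ht j / real j) * (p_avg dh (n - j) / P - 1)\<bar> \<le> D / P * (\<bar>ht j\<bar> / real j * \<bar>P - p_avg dh (n - j)\<bar>)"
      by (simp add: mult_ac)
  qed
  also have "\<dots> \<le> D / P * (2 * t.C5 * exp (81 * \<kappa>) * R0 * (P / c0))"
    unfolding sum_distrib_left[symmetric] using S D P_pos by (intro mult_left_mono) auto
  also have "\<dots> = KC * R0" using P_pos by (simp add: KC_def)
  finally show ?thesis .
qed

definition ut :: "real \<Rightarrow> nat \<Rightarrow> complex" where "ut t j = of_real (dh j) * (ft t j - 1) / of_nat j"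
definition Ut :: "real \<Rightarrow> complex" where "Ut t = (\<Sum>j=1..n. ut t j)"
definition ratio :: "nat \<Rightarrow> real" where "ratio j = p_avg dh (n - j) / P - 1"
definition phi :: "real \<Rightarrow> complex" where "phi t = ecoef (\<lambda>j. of_real (dh j) * ft t j) n / of_real P"

lemma phi_expansion:
  "cmod (phi t - exp (Ut t) * (1 + (\<Sum>j=1..n. ut t j * of_real (ratio j))))
     \<le> KK * t\<^sup>2 * R0\<^sup>2 * exp (27 * \<kappa> * tilted.Wf n (ft t) - \<kappa> * tilted.Tf (ft t) n)"
proof -
  interpret t: tilted n dh "ft t" a D \<kappa> by (rule tilted_ft)
  have u: "t.uu = ut t" and U: "t.UU = Ut t"
    by (auto simp: t.uu_def ut_def fun_eq_iff t.UU_def Ut_def)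
  have R: "t.rcond (\<lambda>j. cmod (t.uu j)) (D * \<bar>t\<bar> * R0)"
  proof (rule rcond_scaled)
    fix j assume j: "1 \<le> j" "j \<le> n"
    have "cmod (t.uu j) = dh j * (cmod (ft t j - 1) / real j)"
      using dh_nonneg[OF j] by (simp add: t.uu_def norm_mult norm_divide)
    also have "\<dots> \<le> D * (\<bar>t * ht j\<bar> / real j)"
      using dh[OF j] D cis_taylor(1)[of "t * ht j"] unfolding ft_def by (intro mult_mono divide_right_mono) auto
    finally show "cmod (t.uu j) \<le> D * \<bar>t\<bar> * (\<bar>ht j\<bar> / real j)" by (simp add: abs_mult)
  qed (use D in auto)
  define X where "X = ecoef (\<lambda>j. of_real (dh j) * ft t j) n - exp (Ut t) *
      (of_real P + (\<Sum>j=1..n. ut t j * (of_real (p_avg dh (n - j)) - of_real P)))"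
  have "cmod X \<le> 96 * t.C5 * t.BB * (D * \<bar>t\<bar> * R0)\<^sup>2 * (exp (t.Lam n - \<kappa> * t.Tf n) / real (n + 1))"
    using t.ecoef_expansion[OF R] by (simp add: X_def u U p_avg_eq_ecoef[symmetric] P_def)
  also have "\<dots> = 96 * t.C5 * (D * \<bar>t\<bar> * R0)\<^sup>2 * exp (81 * \<kappa>) * exp (27 * \<kappa> * t.Wf - \<kappa> * t.Tf n) * (exp (t.Lam n) / real (n + 1))"
    by (simp add: t.BB_def exp_add[symmetric] exp_diff algebra_simps)
  also have "\<dots> \<le> 96 * t.C5 * (D * \<bar>t\<bar> * R0)\<^sup>2 * exp (81 * \<kappa>) * exp (27 * \<kappa> * t.Wf - \<kappa> * t.Tf n) * (P / c0)"
    using C5_pos by (intro mult_left_mono exp_Lam_le) auto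
  also have "\<dots> = KK * t\<^sup>2 * R0\<^sup>2 * exp (27 * \<kappa> * t.Wf - \<kappa> * t.Tf n) * P"
    by (simp add: KK_def power_mult_distrib)
  finally have "cmod X / P \<le> KK * t\<^sup>2 * R0\<^sup>2 * exp (27 * \<kappa> * t.Wf - \<kappa> * t.Tf n)"
    using P_pos by (simp add: pos_divide_le_eq)
  moreover have "phi t - exp (Ut t) * (1 + (\<Sum>j=1..n. ut t j * of_real (ratio j))) = X / of_real P"
  proof -
    have "(\<Sum>j=1..n. ut t j * of_real (ratio j)) = (\<Sum>j=1..n. ut t j * (of_real (p_avg dh (n - j)) - of_real P)) / of_real P"
      unfolding sum_divide_distrib using P_pos
      by (intro sum.cong refl) (simp add: ratio_def field_simps)
    then show ?thesis unfolding X_def phi_def using P_pos by (simp add: field_simps)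
  qed
  ultimately show ?thesis using P_pos by (simp add: norm_divide)
qed

lemma L3_eq: "L3 = (\<Sum>j=1..n. \<bar>ht j\<bar> ^ 3 / real j)"
  unfolding L3_def L_sum_def by (intro sum.cong refl) (simp add: powr_numeral)

lemma L3_nonneg: "L3 \<ge> 0" unfolding L3_eq by (intro sum_nonneg) auto

text \<open>The frequency range will be of length proportional to 1 / \<open>L3\<close>. If
  \<open>L3\<close> were 0, all values of h would be 0, contradicting the variance 1.\<close>

lemma L3_pos: "L3 > 0"
proof (rule ccontr)
  assume "\<not> L3 > 0"
  then have "L3 = 0" using L3_nonneg by simp
  then have z: "\<And>j. j \<in> {1..n} \<Longrightarrow> \<bar>ht j\<bar> ^ 3 / real j = 0"
    unfolding L3_eq by (subst (asm) sum_nonneg_eq_0_iff) auto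
  have "(\<Sum>k=1..n. dh k * (ht k)\<^sup>2 / real k) = 0"
    using z by (intro sum.neutral) fastforce
  then show False using variance by simp
qed

text \<open>The normalisation of the variance and d_j \<le> D bound the sum of the h_j^2 / j from
  below by 1/D; Taylor expansion gives 2 - 2 cos y \<ge> y^2 - |y|^3.\<close>

lemma Tf_ge: "t\<^sup>2 / D - \<bar>t\<bar> ^ 3 * L3 \<le> tilted.Tf (ft t) n"
proof -
  have "1 \<le> D * (\<Sum>j=1..n. (ht j)\<^sup>2 / real j)"
    unfolding variance[symmetric] sum_distrib_left using dh by (intro sum_mono) (auto intro!: divide_right_mono mult_right_mono)
  then have "1 / D \<le> (\<Sum>j=1..n. (ht j)\<^sup>2 / real j)" using D by (simp add: divide_le_eq mult.commute)
  then have "t\<^sup>2 * (1 / D) \<le> t\<^sup>2 * (\<Sum>j=1..n. (ht j)\<^sup>2 / real j)" by (intro mult_left_mono) auto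
  then have "t\<^sup>2 / D - \<bar>t\<bar> ^ 3 * L3 \<le> t\<^sup>2 * (\<Sum>j=1..n. (ht j)\<^sup>2 / real j) - \<bar>t\<bar> ^ 3 * (\<Sum>j=1..n. \<bar>ht j\<bar> ^ 3 / real j)"
    by (simp add: L3_eq)
  also have "\<dots> = (\<Sum>j=1..n. ((t * ht j)\<^sup>2 - \<bar>t * ht j\<bar> ^ 3) / real j)"
    unfolding sum_distrib_left sum_subtractf[symmetric]
    by (intro sum.cong refl) (simp add: diff_divide_distrib power_mult_distrib abs_mult)
  also have "\<dots> \<le> tilted.Tf (ft t) n"
    unfolding tilted.Tf_def[OF tilted_ft]
  proof (intro sum_mono divide_right_mono)
    fix j
    let ?y = "t * ht j"
    have "\<bar>Re (cis ?y - 1 - \<i> * ?y + of_real (?y\<^sup>2 / 2))\<bar> \<le> \<bar>?y\<bar> ^ 3 / 6"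
      by (rule order_trans[OF abs_Re_le_cmod cis_taylor(3)])
    then have "\<bar>cos ?y - 1 + ?y\<^sup>2 / 2\<bar> \<le> \<bar>?y\<bar> ^ 3 / 6" by simp
    moreover have "\<bar>?y\<bar> ^ 3 \<ge> 0" by simp
    ultimately have "?y\<^sup>2 - \<bar>?y\<bar> ^ 3 \<le> 2 - 2 * cos ?y" by linarith
    then show "?y\<^sup>2 - \<bar>?y\<bar> ^ 3 \<le> (cmod (1 - ft t j))\<^sup>2" unfolding ft_def norm_one_minus_cis_sq .
  qed auto
  finally show ?thesis .
qed

text \<open>Every counted index has |t h_j| at least 1/4, so 1 is at most 4^3 = 64 times the
  cube.\<close>

lemma Wf_le: "tilted.Wf n (ft t) \<le> 64 * \<bar>t\<bar> ^ 3 * L3"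
proof -
  have "tilted.Wf n (ft t) = (\<Sum>j | j \<in> {1..n} \<and> 1/4 \<le> cmod (1 - ft t j). 1 / real j)"
    by (rule tilted.Wf_def[OF tilted_ft])
  also have "\<dots> \<le> (\<Sum>j | j \<in> {1..n} \<and> 1/4 \<le> cmod (1 - ft t j). 64 * (\<bar>t\<bar> ^ 3 * (\<bar>ht j\<bar> ^ 3 / real j)))"
  proof (rule sum_mono)
    fix j assume "j \<in> {j. j \<in> {1..n} \<and> 1/4 \<le> cmod (1 - ft t j)}"
    then have "1/4 \<le> \<bar>t * ht j\<bar>"
      using norm_one_minus_cis_le[of "t * ht j"] by (auto simp: ft_def)
    then have "(1/4) ^ 3 \<le> \<bar>t * ht j\<bar> ^ 3" by (intro power_mono) auto
    then have "1 / real j \<le> 64 * \<bar>t * ht j\<bar> ^ 3 / real j"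
      by (intro divide_right_mono) (auto simp: power3_eq_cube)
    then show "1 / real j \<le> 64 * (\<bar>t\<bar> ^ 3 * (\<bar>ht j\<bar> ^ 3 / real j))" by (simp add: abs_mult power_mult_distrib)
  qed
  also have "\<dots> \<le> (\<Sum>j=1..n. 64 * (\<bar>t\<bar> ^ 3 * (\<bar>ht j\<bar> ^ 3 / real j)))"
    by (intro sum_mono2) auto
  also have "\<dots> = 64 * \<bar>t\<bar> ^ 3 * L3" by (simp add: L3_eq sum_distrib_left mult_ac)
  finally show ?thesis .
qed

text \<open>27 Wf - Tf is at most (27 * 64 + 1) |t|^3 L3 - t^2 / D. Since 3458 = 2 * 1729, the
  restriction on t spends exactly half of t^2 / D on the cubic term.\<close>

lemma exponent_le:
  assumes t: "\<bar>t\<bar> * L3 \<le> 1 / (3458 * D)"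
  shows "27 * \<kappa> * tilted.Wf n (ft t) - \<kappa> * tilted.Tf (ft t) n \<le> - (\<kappa> / (2 * D)) * t\<^sup>2"
proof -
  have "\<bar>t\<bar> ^ 3 * L3 = t\<^sup>2 * (\<bar>t\<bar> * L3)" by (simp add: power3_eq_cube power2_eq_square)
  also have "\<dots> \<le> t\<^sup>2 * (1 / (3458 * D))" using t by (intro mult_left_mono) auto
  finally have "27 * tilted.Wf n (ft t) - tilted.Tf (ft t) n \<le> 1729 * (t\<^sup>2 * (1 / (3458 * D))) - t\<^sup>2 / D"
    using Wf_le[of t] Tf_ge[of t] by linarith
  also have "\<dots> = - (t\<^sup>2 / (2 * D))" using D by (simp add: field_simps)
  finally have "\<kappa> * (27 * tilted.Wf n (ft t) - tilted.Tf (ft t) n) \<le> \<kappa> * - (t\<^sup>2 / (2 * D))"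
    using kap by (intro mult_left_mono) auto
  then show ?thesis by (simp add: algebra_simps)
qed

text \<open>The three error terms have separate origins: the second order Taylor remainder, the
  cubic remainder \<open>r\<close> in the exponent after mean and variance are split off, and the
  quadratic remainder \<open>r2\<close> in the linear term, which carries p_{n-j}/p_n - 1 and so
  produces \<open>L'_two\<close>.\<close>

lemma centered_expansion:
  assumes t: "t > 0" "t * L3 \<le> 1 / (3458 * D)"
  defines "C \<equiv> C_corr n dh ht"
  shows "cmod (cis (- (t * A_center n dh ht)) * phi t - of_real (exp (- t\<^sup>2 / 2)) * Complex 1 (t * C))
     \<le> (KK * t\<^sup>2 * R0\<^sup>2 + D * t ^ 3 * L3 * (1 + t * \<bar>C\<bar>) + D * t\<^sup>2 * L'_two n dh ht) * exp (- (\<kappa> / (2 * D)) * t\<^sup>2)"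
proof -
  define A where "A = A_center n dh ht"
  define r where "r = (\<Sum>j=1..n. of_real (dh j) * (cis (t * ht j) - 1 - \<i> * of_real (t * ht j) + of_real ((t * ht j)\<^sup>2 / 2)) / of_nat j)"
  define r2 where "r2 = (\<Sum>j=1..n. of_real (dh j) * (cis (t * ht j) - 1 - \<i> * of_real (t * ht j)) / of_nat j * of_real (ratio j))"
  define E where "E = exp (- (\<kappa> / (2 * D)) * t\<^sup>2)"
  have U: "Ut t = \<i> * of_real (t * A) - of_real (t\<^sup>2 / 2) + r"
  proof -
    have i1: "\<i> * of_real (t * A) = (\<Sum>j=1..n. \<i> * of_real (t * (dh j * ht j / real j)))"
      unfolding A_def A_center_def by (simp add: sum_distrib_left)
    have "complex_of_real (t\<^sup>2 / 2) = of_real (t\<^sup>2 / 2 * (\<Sum>k=1..n. dh k * (ht k)\<^sup>2 / real k))"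
      by (simp only: variance mult_1_right)
    then have i2: "complex_of_real (t\<^sup>2 / 2) = (\<Sum>j=1..n. of_real (t\<^sup>2 / 2 * (dh j * (ht j)\<^sup>2 / real j)))"
      by (simp only: sum_distrib_left of_real_sum)
    show ?thesis
      unfolding r_def Ut_def i1 i2 sum_subtractf[symmetric] sum.distrib[symmetric]
    proof (intro sum.cong refl)
      fix j
      have "complex_of_real (t * (dh j * ht j / real j)) = of_real (dh j) * of_real (t * ht j) / of_nat j"
        by (simp add: mult_ac)
      moreover have "complex_of_real (t\<^sup>2 / 2 * (dh j * (ht j)\<^sup>2 / real j)) = of_real (dh j) * of_real ((t * ht j)\<^sup>2 / 2) / of_nat j"
        by (simp add: power_mult_distrib mult_ac)
      ultimately show "ut t j = \<i> * of_real (t * (dh j * ht j / real j)) - of_real (t\<^sup>2 / 2 * (dh j * (ht j)\<^sup>2 / real j))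
        + of_real (dh j) * (cis (t * ht j) - 1 - \<i> * of_real (t * ht j) + of_real ((t * ht j)\<^sup>2 / 2)) / of_nat j"
        unfolding ut_def ft_def
        by (simp only: times_divide_eq_right diff_divide_distrib[symmetric] add_divide_distrib[symmetric]) (simp add: algebra_simps)
    qed
  qed
  have S: "(\<Sum>j=1..n. ut t j * of_real (ratio j)) = \<i> * of_real (t * C) + r2"
  proof -
    have "\<i> * of_real (t * C) = (\<Sum>j=1..n. \<i> * of_real (t * (dh j * (ht j / real j) * ratio j)))"
      unfolding C_def C_corr_def ratio_def P_def by (simp add: sum_distrib_left)
    then show ?thesis
      unfolding r2_def sum.distrib[symmetric]
    proof (simp only: sum.distrib[symmetric], intro sum.cong refl)
      fix j
      have "complex_of_real (t * (dh j * (ht j / real j) * ratio j)) = of_real (dh j) * of_real (t * ht j) / of_nat j * of_real (ratio j)"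
        by (simp add: mult_ac)
      then show "ut t j * of_real (ratio j) = \<i> * of_real (t * (dh j * (ht j / real j) * ratio j))
        + of_real (dh j) * (cis (t * ht j) - 1 - \<i> * of_real (t * ht j)) / of_nat j * of_real (ratio j)"
        unfolding ut_def ft_def
        by (simp only: times_divide_eq_right times_divide_eq_left add_divide_distrib[symmetric]) (simp add: algebra_simps)
    qed
  qed
  have rb: "cmod r \<le> D * t ^ 3 * L3"
  proof -
    have "cmod r \<le> (\<Sum>j=1..n. D * (t ^ 3 * (\<bar>ht j\<bar> ^ 3 / real j)))"
      unfolding r_def
    proof (rule sum_norm_le)
      fix j assume j: "j \<in> {1..n}"
      let ?w = "cis (t * ht j) - 1 - \<i> * of_real (t * ht j) + of_real ((t * ht j)\<^sup>2 / 2)"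
      have "cmod (of_real (dh j) * ?w / of_nat j) = dh j * (cmod ?w / real j)"
        using dh_nonneg[of j] j by (simp add: norm_mult norm_divide)
      also have "\<dots> \<le> D * (\<bar>t * ht j\<bar> ^ 3 / real j)"
      proof (intro mult_mono divide_right_mono)
        show "cmod ?w \<le> \<bar>t * ht j\<bar> ^ 3" using cis_taylor(3)[of "t * ht j"] zero_le_power[OF abs_ge_zero, of "t * ht j" 3] by linarith
      qed (use dh[of j] D j in auto)
      finally show "cmod (of_real (dh j) * ?w / of_nat j) \<le> D * (t ^ 3 * (\<bar>ht j\<bar> ^ 3 / real j))"
        using t by (simp add: abs_mult power_mult_distrib)
    qed
    then show ?thesis by (simp add: L3_eq sum_distrib_left mult_ac)
  qed
  have r2b: "cmod r2 \<le> D * t\<^sup>2 * L'_two n dh ht"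
  proof -
    have "cmod r2 \<le> (\<Sum>j=1..n. D * (t\<^sup>2 * ((ht j)\<^sup>2 / real j * \<bar>ratio j\<bar>)))"
      unfolding r2_def
    proof (rule sum_norm_le)
      fix j assume j: "j \<in> {1..n}"
      let ?w = "cis (t * ht j) - 1 - \<i> * of_real (t * ht j)"
      have "cmod (of_real (dh j) * ?w / of_nat j * of_real (ratio j)) = dh j * (cmod ?w / real j * \<bar>ratio j\<bar>)"
        using dh_nonneg[of j] j by (simp add: norm_mult norm_divide)
      also have "\<dots> \<le> D * ((t * ht j)\<^sup>2 / real j * \<bar>ratio j\<bar>)"
      proof (intro mult_mono divide_right_mono mult_right_mono)
        show "cmod ?w \<le> (t * ht j)\<^sup>2" using cis_taylor(2)[of "t * ht j"] zero_le_power2[of "t * ht j"] by linarith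
      qed (use dh[of j] D j in auto)
      finally show "cmod (of_real (dh j) * ?w / of_nat j * of_real (ratio j)) \<le> D * (t\<^sup>2 * ((ht j)\<^sup>2 / real j * \<bar>ratio j\<bar>))"
        by (simp add: power_mult_distrib)
    qed
    then show ?thesis by (simp add: L'_two_def ratio_def P_def sum_distrib_left mult_ac)
  qed
  \<comment> \<open>The range of t keeps |r| below t^2/4, so half of the Gaussian exponent survives;
    \<kappa>/(2 D) is at most 1/4, which puts all terms under one common Gaussian.\<close>
  have rs: "cmod r \<le> t\<^sup>2 / 4"
  proof -
    have "D * t ^ 3 * L3 = D * t\<^sup>2 * (t * L3)" by (simp add: power3_eq_cube power2_eq_square)
    also have "\<dots> \<le> D * t\<^sup>2 * (1 / (3458 * D))" using t D by (intro mult_left_mono) auto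
    also have "\<dots> \<le> t\<^sup>2 / 4" using D by simp
    finally show ?thesis using rb by linarith
  qed
  have E4: "exp (- t\<^sup>2 / 2) * exp (cmod r) \<le> E"
  proof -
    have "\<kappa> / (2 * D) \<le> 1 / 4" using kap a D by (simp add: divide_le_eq)
    then have "\<kappa> / (2 * D) * t\<^sup>2 \<le> 1 / 4 * t\<^sup>2" by (intro mult_right_mono) auto
    then show ?thesis using rs unfolding E_def mult_exp_exp by simp
  qed
  define z where "z = - of_real (t\<^sup>2 / 2) + r"
  have cz: "cis (- (t * A)) * exp (Ut t) = exp z"
    unfolding U z_def cis_conv_exp mult_exp_exp by simp
  have ez: "exp z = of_real (exp (- t\<^sup>2 / 2)) * exp r"
    unfolding z_def exp_add by (simp add: exp_of_real[symmetric])
  have nz: "cmod (exp z) \<le> E"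
  proof -
    have "exp (- t\<^sup>2 / 2) * exp (Re r) \<le> exp (- t\<^sup>2 / 2) * exp (cmod r)"
      by (rule mult_left_mono) (simp_all add: complex_Re_le_cmod)
    moreover have "cmod (exp z) = exp (- t\<^sup>2 / 2) * exp (Re r)" unfolding ez by (simp add: norm_mult)
    ultimately show ?thesis using E4 by linarith
  qed
  have dz: "cmod (exp z - of_real (exp (- t\<^sup>2 / 2))) \<le> D * t ^ 3 * L3 * E"
  proof -
    have "exp z - of_real (exp (- t\<^sup>2 / 2)) = of_real (exp (- t\<^sup>2 / 2)) * (exp r - 1)"
      unfolding ez by (simp add: algebra_simps)
    then have "cmod (exp z - of_real (exp (- t\<^sup>2 / 2))) = exp (- t\<^sup>2 / 2) * cmod (exp r - 1)" by (simp add: norm_mult)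
    also have "\<dots> \<le> exp (- t\<^sup>2 / 2) * (cmod r * exp (cmod r))"
      by (intro mult_left_mono norm_exp_minus_1_le) auto
    also have "\<dots> = cmod r * (exp (- t\<^sup>2 / 2) * exp (cmod r))" by simp
    also have "\<dots> \<le> (D * t ^ 3 * L3) * E" using rb E4 D t L3_nonneg by (intro mult_mono) auto
    finally show ?thesis .
  qed
  have cx: "Complex 1 (t * C) = 1 + \<i> * of_real (t * C)" by (simp add: complex_eq_iff)
  have ncx: "cmod (Complex 1 (t * C)) \<le> 1 + t * \<bar>C\<bar>"
    unfolding cx using norm_triangle_ineq[of 1 "\<i> * of_real (t * C)"] t by (simp add: norm_mult abs_mult)
  define Y where "Y = phi t - exp (Ut t) * (1 + (\<Sum>j=1..n. ut t j * of_real (ratio j)))"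
  have Yb: "cmod Y \<le> KK * t\<^sup>2 * R0\<^sup>2 * E"
  proof -
    have KK0: "KK \<ge> 0" unfolding KK_def using C5_pos c0_pos by simp
    have "27 * \<kappa> * tilted.Wf n (ft t) - \<kappa> * tilted.Tf (ft t) n \<le> - (\<kappa> / (2 * D)) * t\<^sup>2"
      using t by (intro exponent_le) auto
    then have "exp (27 * \<kappa> * tilted.Wf n (ft t) - \<kappa> * tilted.Tf (ft t) n) \<le> E"
      unfolding E_def by (simp only: exp_le_cancel_iff)
    then have "KK * t\<^sup>2 * R0\<^sup>2 * exp (27 * \<kappa> * tilted.Wf n (ft t) - \<kappa> * tilted.Tf (ft t) n) \<le> KK * t\<^sup>2 * R0\<^sup>2 * E"
      using KK0 by (intro mult_left_mono) auto
    then show ?thesis using phi_expansion[of t] unfolding Y_def by linarith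
  qed
  have "cis (- (t * A)) * phi t - of_real (exp (- t\<^sup>2 / 2)) * Complex 1 (t * C)
    = cis (- (t * A)) * Y + (exp z - of_real (exp (- t\<^sup>2 / 2))) * Complex 1 (t * C) + exp z * r2"
    unfolding Y_def S cz[symmetric] cx by (simp add: algebra_simps)
  then have "cmod (cis (- (t * A)) * phi t - of_real (exp (- t\<^sup>2 / 2)) * Complex 1 (t * C))
    \<le> cmod (cis (- (t * A)) * Y) + cmod ((exp z - of_real (exp (- t\<^sup>2 / 2))) * Complex 1 (t * C)) + cmod (exp z * r2)"
    by (metis norm_triangle_le norm_triangle_ineq add_right_mono order_refl)
  also have "cmod (cis (- (t * A)) * Y) \<le> KK * t\<^sup>2 * R0\<^sup>2 * E" using Yb by (simp add: norm_mult)
  also have "cmod ((exp z - of_real (exp (- t\<^sup>2 / 2))) * Complex 1 (t * C)) \<le> (D * t ^ 3 * L3 * E) * (1 + t * \<bar>C\<bar>)"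
    unfolding norm_mult using dz ncx by (intro mult_mono) (auto intro: order_trans[OF norm_ge_zero])
  also have "cmod (exp z * r2) \<le> E * (D * t\<^sup>2 * L'_two n dh ht)"
    unfolding norm_mult using nz r2b by (intro mult_mono) (auto simp: E_def)
  finally show ?thesis unfolding A_def[symmetric] E_def[symmetric] by (simp add: algebra_simps)
qed

end

lemma integrable_poly_gaussian:
  assumes c: "c > 0"
  shows "integrable lborel (\<lambda>t::real. (1 + \<bar>t\<bar>) ^ 3 * exp (- c * t\<^sup>2))"
proof -
  define s where "s = sqrt (2 * c)"
  have s: "s > 0" "s\<^sup>2 = 2 * c" using c by (simp_all add: s_def)
  have i: "integrable lborel (\<lambda>t::real. \<bar>t\<bar> ^ k * exp (- c * t\<^sup>2))" for k
  proof -
    have "integrable lborel (\<lambda>t. std_normal_density (0 + s * t) * \<bar>0 + s * t\<bar> ^ k)"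
      using s by (intro lborel_integrable_real_affine[OF integrable_std_normal_moment_abs]) auto
    then have "integrable lborel (\<lambda>t. (sqrt (2 * pi) / s ^ k) * (std_normal_density (0 + s * t) * \<bar>0 + s * t\<bar> ^ k))"
      by (rule integrable_mult_right)
    moreover have "(sqrt (2 * pi) / s ^ k) * (std_normal_density (0 + s * t) * \<bar>0 + s * t\<bar> ^ k) = \<bar>t\<bar> ^ k * exp (- c * t\<^sup>2)" for t
      using s by (simp add: std_normal_density_def power_mult_distrib abs_mult)
    ultimately show ?thesis by simp
  qed
  have "integrable lborel (\<lambda>t::real. \<bar>t\<bar> ^ 0 * exp (- c * t\<^sup>2) + 3 * (\<bar>t\<bar> ^ 1 * exp (- c * t\<^sup>2)) + 3 * (\<bar>t\<bar> ^ 2 * exp (- c * t\<^sup>2)) + \<bar>t\<bar> ^ 3 * exp (- c * t\<^sup>2))"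
    by (intro Bochner_Integration.integrable_add integrable_mult_right i)
  then show ?thesis
    by (rule Bochner_Integration.integrable_cong[THEN iffD1, rotated -1]) (auto simp: power3_eq_cube power2_eq_square algebra_simps)
qed

lemma edgeworth_density_le: "edgeworth_density C u \<le> 1 + \<bar>C\<bar>"
proof -
  have "1 / sqrt (2 * pi) \<le> 1" using pi_gt3 by simp
  then have sd: "std_normal_density u \<le> exp (- u\<^sup>2 / 2)"
    using mult_right_mono[of "1 / sqrt (2 * pi)" 1 "exp (- u\<^sup>2 / 2)"] unfolding std_normal_density_def by simp
  have "1 + u\<^sup>2 / 2 \<le> exp (u\<^sup>2 / 2)" by (rule exp_ge_add_one_self)
  moreover have "\<bar>u\<bar> \<le> 1 + u\<^sup>2 / 2"
    using zero_le_power2[of "\<bar>u\<bar> - 1"] by (simp add: power2_eq_square algebra_simps)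
  ultimately have "\<bar>u\<bar> \<le> exp (u\<^sup>2 / 2)" by linarith
  then have "\<bar>u\<bar> * exp (- u\<^sup>2 / 2) \<le> exp (u\<^sup>2 / 2) * exp (- u\<^sup>2 / 2)"
    by (intro mult_right_mono) auto
  then have u1: "\<bar>u\<bar> * exp (- u\<^sup>2 / 2) \<le> 1" by (simp add: mult_exp_exp)
  have "edgeworth_density C u \<le> std_normal_density u * (1 + \<bar>C\<bar> * \<bar>u\<bar>)"
    unfolding edgeworth_density_def by (intro mult_left_mono add_left_mono) (auto simp: abs_mult[symmetric])
  also have "\<dots> \<le> exp (- u\<^sup>2 / 2) * (1 + \<bar>C\<bar> * \<bar>u\<bar>)" using sd by (intro mult_right_mono) auto
  also have "\<dots> = exp (- u\<^sup>2 / 2) + \<bar>C\<bar> * (\<bar>u\<bar> * exp (- u\<^sup>2 / 2))" by (simp add: algebra_simps)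
  also have "\<dots> \<le> 1 + \<bar>C\<bar> * 1" using u1 by (intro add_mono mult_left_mono) auto
  finally show ?thesis by simp
qed

text \<open>Esseen's inequality with T as large as the centered expansion permits, so 1/T is a
  multiple of \<open>L3\<close>. After division by t only powers up to t^3 remain, all dominated by
  (1 + t)^3, and the bound \<open>C8\<close> makes the factor 1 + t |C| harmless.\<close>

lemma (in clt_setup) clt_bound:
  fixes q w :: "'i \<Rightarrow> real"
  assumes I: "finite I" and q: "\<And>i. i \<in> I \<Longrightarrow> q i \<ge> 0" "(\<Sum>i\<in>I. q i) = 1"
    and char: "\<And>t. (\<Sum>i\<in>I. of_real (q i) * cis (t * w i)) = cis (- (t * A_center n dh ht)) * phi t"
    and C8: "\<bar>C_corr n dh ht\<bar> \<le> C8"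
  shows "\<bar>(\<Sum>i | i \<in> I \<and> w i < x. q i) - (Phi x - C_corr n dh ht * std_normal_density x)\<bar>
    \<le> 16 * pi * ((KK + D * (1 + C8)) * (R0\<^sup>2 + L3 + L'_two n dh ht)
           * (LINT t|lborel. (1 + \<bar>t\<bar>) ^ 3 * exp (- (\<kappa> / (2 * D)) * t\<^sup>2)) / pi + 40 * (1 + C8) * (3458 * D * L3))"
proof -
  define c where "c = \<kappa> / (2 * D)"
  have c: "c > 0" using kap D by (simp add: c_def)
  define C where "C = C_corr n dh ht"
  define L2 where "L2 = L'_two n dh ht"
  have L2: "L2 \<ge> 0" unfolding L2_def L'_two_def by (intro sum_nonneg) auto
  define K2 where "K2 = KK + D * (1 + C8)"
  have KK: "KK \<ge> 0" unfolding KK_def using C5_pos c0_pos by simp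
  have C80: "C8 \<ge> 0" using C8 by linarith
  define M where "M = R0\<^sup>2 + L3 + L2"
  have M: "M \<ge> 0" unfolding M_def using L3_nonneg L2 by simp
  have K2: "K2 \<ge> 0" unfolding K2_def using KK D C80 by simp
  define T where "T = 1 / (3458 * D * L3)"
  have T: "T > 0" unfolding T_def using D L3_pos by simp
  define b where "b t = K2 * M * ((1 + \<bar>t\<bar>) ^ 3 * exp (- c * t\<^sup>2))" for t
  note gi = integrable_poly_gaussian[OF c]
  have b0: "b t \<ge> 0" for t unfolding b_def using K2 M by simp
  have bint: "integrable lborel b" unfolding b_def using gi by (rule integrable_mult_right)
  have bi: "integrable lborel (\<lambda>t. indicator {0..T} t * b t)"
    using integrable_mult_indicator[OF _ bint, of "{0..T}"] by simp
  have bnd: "cmod ((\<Sum>i\<in>I. of_real (q i) * cis (t * w i)) - of_real (exp (- t\<^sup>2 / 2)) * Complex 1 (t * C)) \<le> t * b t"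
    if t: "0 < t" "t \<le> T" for t
  proof -
    define E where "E = exp (- c * t\<^sup>2)"
    define G where "G = (1 + t) ^ 3"
    have G: "G = 1 + 3 * t + 3 * t\<^sup>2 + t ^ 3" by (simp add: G_def power3_eq_cube power2_eq_square algebra_simps)
    have p: "0 \<le> t\<^sup>2" "0 \<le> t ^ 3" using t by auto
    have G0: "0 \<le> G" unfolding G_def using t by simp
    have "t * L3 \<le> 1 / (3458 * D)" using t L3_pos D by (simp add: T_def field_simps)
    then have "cmod ((\<Sum>i\<in>I. of_real (q i) * cis (t * w i)) - of_real (exp (- t\<^sup>2 / 2)) * Complex 1 (t * C))
      \<le> (KK * t\<^sup>2 * R0\<^sup>2 + D * t ^ 3 * L3 * (1 + t * \<bar>C\<bar>) + D * t\<^sup>2 * L2) * E"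
      using centered_expansion[OF t(1)] unfolding char C_def L2_def E_def c_def by simp
    also have "\<dots> \<le> (t * (K2 * M * G)) * E"
    proof (rule mult_right_mono)
      have "KK * R0\<^sup>2 * t \<le> KK * R0\<^sup>2 * G" using KK G p t by (intro mult_left_mono) auto
      moreover have "D * L3 * (t\<^sup>2 * (1 + t * \<bar>C\<bar>)) \<le> D * L3 * ((1 + C8) * G)"
      proof (intro mult_left_mono)
        have "t\<^sup>2 * (t * \<bar>C\<bar>) = t ^ 3 * \<bar>C\<bar>" by (simp add: power3_eq_cube power2_eq_square)
        also have "\<dots> \<le> G * C8" using C8 C80 G p t unfolding C_def by (intro mult_mono) auto
        finally have "t\<^sup>2 * (1 + t * \<bar>C\<bar>) \<le> t\<^sup>2 + G * C8" by (simp add: distrib_left)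
        also have "t\<^sup>2 \<le> G" using G p t by simp
        finally show "t\<^sup>2 * (1 + t * \<bar>C\<bar>) \<le> (1 + C8) * G" by (simp add: algebra_simps)
      qed (use D L3_nonneg in auto)
      moreover have "D * L2 * t \<le> D * L2 * ((1 + C8) * G)"
      proof (intro mult_left_mono)
        have "t \<le> G" using G p t by simp
        also have "\<dots> \<le> (1 + C8) * G" using mult_right_mono[of 1 "1 + C8" G] C80 G0 by simp
        finally show "t \<le> (1 + C8) * G" .
      qed (use D L2 in auto)
      moreover have "0 \<le> KK * G * (L3 + L2)" "0 \<le> D * (1 + C8) * G * R0\<^sup>2"
        using KK G p t L3_nonneg L2 D C80 by auto
      ultimately have "KK * R0\<^sup>2 * t + D * L3 * (t\<^sup>2 * (1 + t * \<bar>C\<bar>)) + D * L2 * t \<le> K2 * M * G"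
        unfolding K2_def M_def by (simp add: algebra_simps)
      then have "t * (KK * R0\<^sup>2 * t + D * L3 * (t\<^sup>2 * (1 + t * \<bar>C\<bar>)) + D * L2 * t) \<le> t * (K2 * M * G)"
        using t by (intro mult_left_mono) auto
      then show "KK * t\<^sup>2 * R0\<^sup>2 + D * t ^ 3 * L3 * (1 + t * \<bar>C\<bar>) + D * t\<^sup>2 * L2 \<le> t * (K2 * M * G)"
        by (simp add: power3_eq_cube power2_eq_square algebra_simps)
    qed (simp add: E_def)
    also have "\<dots> = t * b t" using t by (simp add: b_def E_def G_def)
    finally show ?thesis .
  qed
  have "\<bar>(\<Sum>i | i \<in> I \<and> w i < x. q i) - (Phi x - C * std_normal_density x)\<bar>
    \<le> 16 * pi * ((LINT t|lborel. indicator {0..T} t * b t) / pi + 40 * (1 + C8) / T)"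
  proof (rule esseen_inequality[OF I q T bnd bi])
    show "edgeworth_density C u \<le> 1 + C8" for u
      using edgeworth_density_le[of C u] C8 by (simp add: C_def)
  qed (use C80 in auto)
  also have "\<dots> \<le> 16 * pi * (K2 * M * (LINT t|lborel. (1 + \<bar>t\<bar>) ^ 3 * exp (- c * t\<^sup>2)) / pi + 40 * (1 + C8) * (3458 * D * L3))"
  proof (intro mult_left_mono add_mono divide_right_mono)
    have "(LINT t|lborel. indicator {0..T} t * b t) \<le> (LINT t|lborel. b t)"
      using b0 by (intro integral_mono bi bint) (auto simp: indicator_def)
    then show "(LINT t|lborel. indicator {0..T} t * b t) \<le> K2 * M * (LINT t|lborel. (1 + \<bar>t\<bar>) ^ 3 * exp (- c * t\<^sup>2))"
      unfolding b_def by simp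
    show "40 * (1 + C8) / T \<le> 40 * (1 + C8) * (3458 * D * L3)" by (simp add: T_def)
  qed auto
  finally show ?thesis unfolding C_def K2_def M_def L2_def c_def .
qed

section \<open>Return to permutations and choice of the uniform constant\<close>

lemma cis_sum: "finite A \<Longrightarrow> cis (\<Sum>x\<in>A. f x) = (\<Prod>x\<in>A. cis (f x))"
  by (induction A rule: finite_induct) (auto simp: cis_mult[symmetric])

lemma sum_permutations_d:
  assumes "multiplicative_with n d dh"
  shows "(\<Sum>w | w permutes {1..n}. d w) = fact n * p_avg dh n"
  using assms unfolding multiplicative_with_def p_avg_def by simp

lemma sum_permutations_char:
  assumes d: "multiplicative_with n d dh" and h: "additive_with n h ht"
  shows "(\<Sum>\<sigma> | \<sigma> permutes {1..n}. of_real (d \<sigma>) * cis (t * h \<sigma>))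
     = fact n * ecoef (\<lambda>j. of_real (dh j) * cis (t * ht j)) n"
proof -
  have "of_real (d \<sigma>) * cis (t * h \<sigma>) = (\<Prod>c\<in>cycles n \<sigma>. of_real (dh (card c)) * cis (t * ht (card c)))"
    if "\<sigma> permutes {1..n}" for \<sigma>
  proof -
    have "cis (t * h \<sigma>) = (\<Prod>c\<in>cycles n \<sigma>. cis (t * ht (card c)))"
      using that h by (simp add: additive_with_def sum_distrib_left cis_sum cycles_def)
    then show ?thesis using that d by (simp add: multiplicative_with_def prod.distrib)
  qed
  then have "(\<Sum>\<sigma> | \<sigma> permutes {1..n}. of_real (d \<sigma>) * cis (t * h \<sigma>))
    = (\<Sum>\<sigma> | \<sigma> permutes {1..n}. \<Prod>c\<in>cycles n \<sigma>. of_real (dh (card c)) * cis (t * ht (card c)))"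
    by (intro sum.cong) auto
  also have "\<dots> = fact n * ecoef (\<lambda>j. of_real (dh j) * cis (t * ht j)) n"
    by (rule sum_permutations_cycles)
  finally show ?thesis .
qed

lemma F_dist_eq_sum:
  assumes "\<And>\<sigma>. \<sigma> permutes {1..n} \<Longrightarrow> 0 \<le> d \<sigma>"
  shows "F_dist n d h a x = (\<Sum>\<sigma> | \<sigma> \<in> {\<sigma>. \<sigma> permutes {1..n}} \<and> h \<sigma> - a < x. d \<sigma> / (\<Sum>w | w permutes {1..n}. d w))"
proof -
  let ?S = "{\<sigma>. \<sigma> permutes {1..n}}"
  have fin: "finite ?S" by (rule finite_permutations) simp
  have D0: "(\<Sum>w\<in>?S. d w) \<ge> 0" using assms by (intro sum_nonneg) auto
  have "F_dist n d h a x = measure (point_measure ?S (\<lambda>\<sigma>. ennreal (d \<sigma> / (\<Sum>w\<in>?S. d w)))) {\<sigma> \<in> ?S. h \<sigma> - a < x}"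
    by (simp add: F_dist_def nu_def space_point_measure)
  also have "\<dots> = (\<Sum>\<sigma> \<in> {\<sigma> \<in> ?S. h \<sigma> - a < x}. d \<sigma> / (\<Sum>w\<in>?S. d w))"
    using fin assms D0 by (subst measure_point_measure_finite_if) auto
  finally show ?thesis by simp
qed

lemma Phi_bounds: "0 \<le> Phi x" "Phi x \<le> 1"
proof -
  interpret prob_space std_normal_distribution by (rule prob_space_normal_density) simp
  show "0 \<le> Phi x" "Phi x \<le> 1" unfolding Phi_def cdf_def by auto
qed

theorem theorem2:
  fixes dmin dmax :: real and p :: ereal
  assumes "0 < dmin" and "dmin \<le> dmax"
    and "p > ereal (max 2 (1 / dmin))"
  shows "\<exists>K>0. \<forall>(n::nat) (d :: (nat \<Rightarrow> nat) \<Rightarrow> real) (dh :: nat \<Rightarrow> real)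
            (h :: (nat \<Rightarrow> nat) \<Rightarrow> real) (ht :: nat \<Rightarrow> real).
     n \<ge> 1 \<longrightarrow>
     multiplicative_with n d dh \<longrightarrow>
     (\<forall>\<sigma>. \<sigma> permutes {1..n} \<longrightarrow> 0 \<le> d \<sigma>) \<longrightarrow>
     (\<forall>j\<in>{1..n}. dmin \<le> dh j \<and> dh j \<le> dmax) \<longrightarrow>
     additive_with n h ht \<longrightarrow>
     (\<Sum>k=1..n. dh k * (ht k)\<^sup>2 / real k) = 1 \<longrightarrow>
     (SUP x. \<bar>F_dist n d h (A_center n dh ht) x - Phi x
               + 1 / sqrt (2 * pi) * exp (- (x\<^sup>2) / 2) * C_corr n dh ht\<bar>)
       \<le> K * (L_sum n ht 3 + L_two_root n ht p + L'_two n dh ht)"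
proof -
  \<comment> \<open>Passing to the minimum and maximum with 1 only weakens the bounds on d_j and
    still leaves p > 1/a, because p > 2.\<close>
  define a where "a = min dmin 1"
  define D where "D = max dmax 1"
  have a: "0 < a" "a \<le> 1" "a \<le> dmin" using assms by (auto simp: a_def)
  have D: "1 \<le> D" "dmax \<le> D" by (auto simp: D_def)
  define i where "i = (if p = \<infinity> then 0 else 1 / real_of_ereal p)"
  have i: "i < a"
  proof (cases "p = \<infinity>")
    case False
    then obtain r where r: "p = ereal r" using assms(3) by (cases p) auto
    have "r > 2" "r > 1 / dmin" using assms(3) r by auto
    then have "1 / r < 1" "1 / r < dmin" using assms(1) by (auto simp: field_simps)
    then show ?thesis using r by (simp add: i_def a_def)
  qed (use a in \<open>simp add: i_def\<close>)
  have i0: "i \<ge> 0"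
  proof (cases "p = \<infinity>")
    case False
    then obtain r where r: "p = ereal r" using assms(3) by (cases p) auto
    then show ?thesis using assms(3) by (simp add: i_def)
  qed (simp add: i_def)
  \<comment> \<open>The first bound serves the decay on the circle. The second gives \<gamma> \<le>
    1 - (a + i)/2 < 1 - i, the condition in Hoelder's inequality; i stands for 1/p, read as 0 at p =
    \<infinity>.\<close>
  define \<kappa> where "\<kappa> = min (a / 868) ((a - i) / 12)"
  have "\<kappa> \<le> a / 868" "\<kappa> \<le> (a - i) / 12" unfolding \<kappa>_def by (rule min.cobounded1, rule min.cobounded2)
  then have \<kappa>: "0 < \<kappa>" "868 * \<kappa> \<le> a" "12 * \<kappa> \<le> a - i" using a i by (auto simp: \<kappa>_def)
  define \<gamma> where "\<gamma> = 1 - a + 6 * \<kappa>"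
  have \<gamma>: "0 \<le> \<gamma>" "\<gamma> < 1 - i" using a \<kappa> i by (auto simp: \<gamma>_def)
  have p1: "p > 1"
  proof -
    have "ereal 2 \<le> ereal (max 2 (1 / dmin))" by (simp only: ereal_less_eq max.cobounded1)
    then have "ereal 2 < p" using assms(3) by (rule le_less_trans)
    moreover have "1 < ereal 2" by (simp add: one_ereal_def)
    ultimately show ?thesis by (rule less_trans[rotated])
  qed
  obtain H where H: "H > 0" "\<And>n ht x. 1 \<le> x \<Longrightarrow> x \<le> n \<Longrightarrow>
     (\<Sum>j=1..x. \<bar>ht j\<bar> / real j * wght \<kappa> \<gamma> x j) \<le> H * sqrt (L_two_root n ht p)"
  proof (rule hoelder_wght[of \<kappa> \<gamma> p])
    show "\<gamma> < 1 - 1 / real_of_ereal p" if "p \<noteq> \<infinity>" using \<gamma>(2) that by (simp add: i_def)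
  qed (use \<kappa> a \<gamma> i0 p1 that in auto)
  \<comment> \<open>These constants involve only a, D and \<kappa>, so they can be fixed before n, d
    and h are given; absolute values secure nonnegativity at this stage.\<close>
  define bC where "bC = \<bar>clt_setup.KC a D \<kappa>\<bar>"
  define bK where "bK = \<bar>clt_setup.KK a D \<kappa>\<bar>"
  define J where "J = (LINT t|lborel. (1 + \<bar>t\<bar>) ^ 3 * exp (- (\<kappa> / (2 * D)) * t\<^sup>2))"
  define C8 where "C8 = bC * H"
  have nn: "bC \<ge> 0" "bK \<ge> 0" "J \<ge> 0" "C8 \<ge> 0"
    using H by (auto simp: bC_def bK_def J_def C8_def intro!: Bochner_Integration.integral_nonneg)
  define KA where "KA = 16 * pi * ((bK + D * (1 + C8)) * (H\<^sup>2 + 1) * J / pi + 40 * (1 + C8) * (3458 * D))"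
  define K where "K = KA + (1 + C8)"
  have KA: "KA \<ge> 0" unfolding KA_def using nn D by simp
  have K: "K > 0" unfolding K_def using KA nn by linarith
  show ?thesis
  proof (intro exI[of _ K] conjI K allI impI cSUP_least)
    fix n d dh h ht x
    assume n: "n \<ge> 1" and mult: "multiplicative_with n d dh"
      and dnn: "\<forall>\<sigma>. \<sigma> permutes {1..n} \<longrightarrow> 0 \<le> d \<sigma>"
      and dh: "\<forall>j\<in>{1..n}. dmin \<le> dh j \<and> dh j \<le> dmax"
      and add: "additive_with n h ht"
      and var: "(\<Sum>k=1..n. dh k * (ht k)\<^sup>2 / real k) = 1"
    define \<rho> where "\<rho> = sqrt (L_two_root n ht p)"
    define A where "A = A_center n dh ht"
    define C where "C = C_corr n dh ht"
    define F where "F = F_dist n d h A x"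
    define L2 where "L2 = L'_two n dh ht"
    have L2: "L2 \<ge> 0" unfolding L2_def L'_two_def by (intro sum_nonneg) auto
    have Lr: "L_two_root n ht p \<ge> 0" by (simp add: L_two_root_def)
    have \<rho>: "\<rho> \<ge> 0" "\<rho>\<^sup>2 = L_two_root n ht p" using Lr by (simp_all add: \<rho>_def)
    interpret clt_setup n dh ht a D \<kappa> "H * \<rho>"
    proof
      show "a \<le> dh j \<and> dh j \<le> D" if "1 \<le> j" "j \<le> n" for j
        using dh a D that by (meson atLeastAtMost_iff order_trans)
      show "(\<Sum>j=1..x. \<bar>ht j\<bar> / real j * wght \<kappa> (1 - a + 6 * \<kappa>) x j) \<le> H * \<rho>" if "1 \<le> x" "x \<le> n" for x
        using H(2)[OF that] by (simp add: \<rho>_def \<gamma>_def)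
    qed (use n \<kappa> a D var H \<rho> in auto)
    let ?I = "{\<sigma>. \<sigma> permutes {1..n}}"
    define q where "q \<sigma> = d \<sigma> / (\<Sum>w | w permutes {1..n}. d w)" for \<sigma>
    have Dt: "(\<Sum>w | w permutes {1..n}. d w) = fact n * P"
      using sum_permutations_d[OF mult] by (simp add: P_def)
    have Dp: "fact n * P > 0" using P_pos by simp
    have fin: "finite ?I" by (rule finite_permutations) simp
    have q: "q \<sigma> \<ge> 0" if "\<sigma> \<in> ?I" for \<sigma> unfolding q_def Dt using dnn that Dp by simp
    have qs: "(\<Sum>\<sigma>\<in>?I. q \<sigma>) = 1" unfolding q_def sum_divide_distrib[symmetric] Dt using P_pos by simp
    have FE: "F = (\<Sum>\<sigma> | \<sigma> \<in> ?I \<and> h \<sigma> - A < x. q \<sigma>)"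
      unfolding F_def q_def using dnn by (intro F_dist_eq_sum) auto
    have char: "(\<Sum>\<sigma>\<in>?I. of_real (q \<sigma>) * cis (t * (h \<sigma> - A))) = cis (- (t * A)) * phi t" for t
    proof -
      have "(\<Sum>\<sigma>\<in>?I. of_real (q \<sigma>) * cis (t * (h \<sigma> - A)))
        = (\<Sum>\<sigma>\<in>?I. cis (- (t * A)) / of_real (fact n * P) * (of_real (d \<sigma>) * cis (t * h \<sigma>)))"
      proof (rule sum.cong[OF refl])
        fix \<sigma>
        have "cis (t * (h \<sigma> - A)) = cis (- (t * A)) * cis (t * h \<sigma>)" by (simp add: cis_mult algebra_simps)
        then show "of_real (q \<sigma>) * cis (t * (h \<sigma> - A)) = cis (- (t * A)) / of_real (fact n * P) * (of_real (d \<sigma>) * cis (t * h \<sigma>))"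
          unfolding q_def Dt by (simp add: mult_ac)
      qed
      also have "\<dots> = cis (- (t * A)) / of_real (fact n * P) * (fact n * ecoef (\<lambda>j. of_real (dh j) * cis (t * ht j)) n)"
        unfolding sum_distrib_left[symmetric] sum_permutations_char[OF mult add] ..
      also have "\<dots> = cis (- (t * A)) * phi t"
        by (simp add: phi_def ft_def[abs_def])
      finally show ?thesis .
    qed
    have Cb: "\<bar>C\<bar> \<le> C8 * \<rho>"
    proof -
      have "\<bar>C\<bar> \<le> clt_setup.KC a D \<kappa> * (H * \<rho>)" using C_corr_le by (simp add: C_def)
      also have "\<dots> \<le> bC * (H * \<rho>)" unfolding bC_def using H \<rho> by (intro mult_right_mono) auto
      finally show ?thesis by (simp add: C8_def)
    qed
    define Tot where "Tot = L_sum n ht 3 + L_two_root n ht p + L'_two n dh ht"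
    have Tot: "Tot \<ge> L3" "Tot \<ge> \<rho>\<^sup>2" "Tot \<ge> 0" "Tot = L3 + \<rho>\<^sup>2 + L2"
      using L3_nonneg L2 Lr by (auto simp: Tot_def L3_def L2_def \<rho>)
    have main: "\<bar>F - (Phi x - C * std_normal_density x)\<bar> \<le> K * Tot"
    \<comment> \<open>For \<rho> at most 1 the correction C is bounded by \<open>C8\<close> and the
      analytic estimate applies. For larger \<rho> the left side is at most 1 + |C|, and both 1 and
      |C| \<le> C8 \<rho> are absorbed by multiples of \<rho>^2.\<close>
    proof (cases "\<rho> \<le> 1")
      case True
      have "\<bar>C\<bar> \<le> C8" using Cb mult_left_mono[OF True nn(4)] by simp
      then have "\<bar>F - (Phi x - C * std_normal_density x)\<bar>
        \<le> 16 * pi * ((clt_setup.KK a D \<kappa> + D * (1 + C8)) * ((H * \<rho>)\<^sup>2 + L3 + L2) * J / pi + 40 * (1 + C8) * (3458 * D * L3))"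
        unfolding FE C_def A_def L2_def J_def
        by (intro clt_bound[OF fin q qs char[unfolded A_def]]) auto
      also have "\<dots> \<le> 16 * pi * ((bK + D * (1 + C8)) * ((H\<^sup>2 + 1) * Tot) * J / pi + 40 * (1 + C8) * (3458 * D * Tot))"
      proof (intro mult_left_mono add_mono divide_right_mono mult_right_mono mult_mono)
        have "0 \<le> H\<^sup>2 * (L3 + L2)" "0 \<le> \<rho>\<^sup>2" using L3_nonneg L2 by auto
        then show "(H * \<rho>)\<^sup>2 + L3 + L2 \<le> (H\<^sup>2 + 1) * Tot"
          unfolding Tot(4) by (simp add: power_mult_distrib algebra_simps)
      qed (use nn D Tot L3_nonneg L2 in \<open>auto simp: bK_def\<close>)
      also have "\<dots> = KA * Tot" by (simp add: KA_def algebra_simps)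
      also have "\<dots> \<le> K * Tot" unfolding K_def using nn Tot by (intro mult_right_mono) auto
      finally show ?thesis .
    next
      case False
      have F01: "0 \<le> F" "F \<le> 1"
      proof -
        show "0 \<le> F" unfolding FE using q by (intro sum_nonneg) auto
        have "F \<le> (\<Sum>\<sigma>\<in>?I. q \<sigma>)" unfolding FE using q fin by (intro sum_mono2) auto
        then show "F \<le> 1" using qs by simp
      qed
      have s1: "std_normal_density x \<le> 1"
        using edgeworth_density_le[of 0 x] by (simp add: edgeworth_density_def)
      have "\<bar>C * std_normal_density x\<bar> \<le> \<bar>C\<bar> * 1"
        unfolding abs_mult using s1 by (intro mult_left_mono) auto
      then have "\<bar>F - (Phi x - C * std_normal_density x)\<bar> \<le> 1 + \<bar>C\<bar>"
        using F01 Phi_bounds[of x] by linarith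
      also have "\<dots> \<le> \<rho>\<^sup>2 + C8 * \<rho>\<^sup>2"
      proof -
        have "1 \<le> \<rho>\<^sup>2" using False by (simp add: one_le_power)
        moreover have "C8 * \<rho> \<le> C8 * \<rho>\<^sup>2"
          using nn False by (intro mult_left_mono) (auto simp: power2_eq_square)
        ultimately show ?thesis using Cb by linarith
      qed
      also have "\<dots> = (1 + C8) * \<rho>\<^sup>2" by (simp add: algebra_simps)
      also have "\<dots> \<le> K * Tot" unfolding K_def using KA nn Tot by (intro mult_mono) auto
      finally show ?thesis .
    qed
    have "F - Phi x + 1 / sqrt (2 * pi) * exp (- (x\<^sup>2) / 2) * C = F - (Phi x - C * std_normal_density x)"
      by (simp add: std_normal_density_def)
    then show "\<bar>F_dist n d h (A_center n dh ht) x - Phi x + 1 / sqrt (2 * pi) * exp (- (x\<^sup>2) / 2) * C_corr n dh ht\<bar>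
       \<le> K * (L_sum n ht 3 + L_two_root n ht p + L'_two n dh ht)"
      using main unfolding F_def A_def C_def Tot_def by simp
  qed simp
qed

end
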